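(* Let $\Omega$ be a domain in $\mathbb{C}$ and let $K$ be a compact set in $\Omega$ such that $\Omega \setminus K$ has no relatively compact components in $\Omega$. Then: (a) every $f \in \mathcal{H}_{l.u.}(K)$ can be approximated uniformly on $K$ by functions in $\mathcal{H}_{l.u.}(\Omega)$; (b) every $f \in \mathcal{M}_{l.u.}(K)$ can be approximated $\chi$-uniformly on $K$ by functions in $\mathcal{M}_{l.u.}(\mathbb{C})$, provided that $\mathbb{C}\setminus K$ is connected.
   Context: A meromorphic function $f$ is called locally univalent if it has at most simple poles and $f'(z)\neq 0$ for all $z$ in its domain with $f(z)\neq\infty$. For an open set $U\subseteq\mathbb{C}$, $\mathcal{H}_{l.u.}(U)$ and $\mathcal{M}_{l.u.}(U)$ denote the sets of locally univalent holomorphic, respectively meromorphic, functions on $U$. For a compact set $K\subseteq\mathbb{C}$, $\mathcal{H}_{l.u.}(K)$ and $\mathcal{M}_{l.u.}(K)$ denote the sets of all functions that are holomorphic, respectively meromorphic, and locally univalent on (the components of) some open neighborhood of $K$ (depending on the function). $\chi$ is the chordal metric on $\hat{\mathbb{C}}=\mathbb{C}\cup\{\infty\}$: $\chi(z_1,z_2)=\frac{|z_1-z_2|}{\sqrt{1+|z_1|^2}\sqrt{1+|z_2|^2}}$ for $z_1,z_2\in\mathbb{C}$ and $\chi(z_1,\infty)=\chi(\infty,z_1)=\frac{1}{\sqrt{1+|z_1|^2}}$ for $z_1\in\mathbb{C}$. $\chi$-uniform approximation on $K$ means: for every $\varepsilon>0$ there is an approximating function $g$ with $\max_{z\in K}\chi(f(z),g(z))<\varepsilon$.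 *)

theory Defs
  imports "HOL-Complex_Analysis.Complex_Analysis"
begin

definition holo_lu :: "complex set \<Rightarrow> (complex \<Rightarrow> complex) set" where
  "holo_lu U = {f. f holomorphic_on U \<and> (\<forall>z\<in>U. deriv f z \<noteq> 0)}"

text \<open>
  A meromorphic function on an open set \<open>U\<close>, as a map to the Riemann sphere, is represented by a
  function that is \<^const>\<open>nicely_meromorphic_on\<close> \<open>U\<close>: it is continuous at every point of \<open>U\<close> that is
  not a pole (so there are no removable singularities with a wrong value), and it has the dummy
  value \<open>0\<close> at the poles. The true value \<open>\<infinity>\<close> at the poles is restored by \<open>sphere_val\<close> below.
\<close>
definition mero_lu :: "complex set \<Rightarrow> (complex \<Rightarrow> complex) set" where
  "mero_lu U = {f. f nicely_meromorphic_on U \<and>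
     (\<forall>z\<in>U. is_pole f z \<longrightarrow> zorder f z = -1) \<and>
     (\<forall>z\<in>U. \<not> is_pole f z \<longrightarrow> deriv f z \<noteq> 0)}"

text \<open>
  The germ versions for a compact set \<open>K\<close>; the neighbourhood depends on the function and need not
  be connected.
\<close>
definition holo_lu_near :: "complex set \<Rightarrow> (complex \<Rightarrow> complex) set" where
  "holo_lu_near K = {f. \<exists>U. open U \<and> K \<subseteq> U \<and> f \<in> holo_lu U}"

definition mero_lu_near :: "complex set \<Rightarrow> (complex \<Rightarrow> complex) set" where
  "mero_lu_near K = {f. \<exists>U. open U \<and> K \<subseteq> U \<and> f \<in> mero_lu U}"

text \<open>The Riemann sphere is modelled by \<open>complex option\<close>, with \<^const>\<open>None\<close> as \<open>\<infinity>\<close>.\<close>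

fun chordal :: "complex option \<Rightarrow> complex option \<Rightarrow> real" where
  "chordal (Some z) (Some w) =
     cmod (z - w) / (sqrt (1 + (cmod z)\<^sup>2) * sqrt (1 + (cmod w)\<^sup>2))"
| "chordal (Some z) None = 1 / sqrt (1 + (cmod z)\<^sup>2)"
| "chordal None (Some z) = 1 / sqrt (1 + (cmod z)\<^sup>2)"
| "chordal None None = 0"

definition sphere_val :: "(complex \<Rightarrow> complex) \<Rightarrow> complex \<Rightarrow> complex option" where
  "sphere_val f z = (if is_pole f z then None else Some (f z))"

definition relatively_compact_in :: "complex set \<Rightarrow> complex set \<Rightarrow> bool" where
  "relatively_compact_in C \<Omega> \<longleftrightarrow> compact (closure C) \<and> closure C \<subseteq> \<Omega>"

text \<open>
  In the two notions below the maximum over \<open>K\<close> being less than \<open>\<epsilon>\<close> is spelled out pointwise, which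
  also covers \<open>K = {}\<close>.
\<close>
definition unif_approx_by ::
    "complex set \<Rightarrow> (complex \<Rightarrow> complex) \<Rightarrow> (complex \<Rightarrow> complex) set \<Rightarrow> bool" where
  "unif_approx_by K f G \<longleftrightarrow> (\<forall>\<epsilon>>0. \<exists>g\<in>G. \<forall>z\<in>K. cmod (f z - g z) < \<epsilon>)"

definition chordal_unif_approx_by ::
    "complex set \<Rightarrow> (complex \<Rightarrow> complex) \<Rightarrow> (complex \<Rightarrow> complex) set \<Rightarrow> bool" where
  "chordal_unif_approx_by K f G \<longleftrightarrow>
     (\<forall>\<epsilon>>0. \<exists>g\<in>G. \<forall>z\<in>K. chordal (sphere_val f z) (sphere_val g z) < \<epsilon>)"

end

theory Submission
  imports Defs "HOL-Computational_Algebra.Fundamental_Theorem_Algebra"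
begin

text \<open>
  The approximation is carried out on derivatives. Near \<open>K\<close> the function \<open>f\<close> is first replaced by a
  rational function \<open>g\<close> (Runge's theorem, \<open>runge_rational\<close>); since derivatives converge as well,
  \<open>g'\<close> has no zero on \<open>K\<close>. Such a \<open>g\<close> is locally univalent on the whole plane with the exception of
  finitely many points off \<open>K\<close>, the poles of \<open>g\<close> and the zeros of \<open>g'\<close>
  (\<open>lu_class_approx_on_neighbourhood\<close>). These exceptional points have to be moved out of \<open>\<Omega>\<close> for (a) and
  to \<open>\<infinity>\<close> for (b), at the cost of a small change of \<open>g\<close> on \<open>K\<close>; the poles of \<open>f\<close> in \<open>K\<close> stay where they are.

  Zeros and poles of \<open>g'\<close> are moved by Runge's pole pushing applied to logarithms. If \<open>s\<close> lies in a disc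
  with centre \<open>d\<close>, then \<open>z - s = (z - d) exp (Ln (1 - (s - d) / (z - d)))\<close> outside the disc, and the
  exponent is there a limit of polynomials in \<open>1 / (z - d)\<close>. Replacing it by such a polynomial turns the
  exceptional point \<open>s\<close> into an exceptional point \<open>d\<close>, in general an essential singularity, and creates no
  zero. The modified derivative has a primitive if and only if its residues at the finitely many
  exceptional points and poles vanish. These residues are small, and they are brought back to zero by a further
  factor \<open>exp (\<Sum>j. t j * \<phi> j)\<close> in which \<open>\<phi> j\<close> approximates \<open>1 / ((z - j) g')\<close>: to first order in \<open>t\<close> this
  factor changes the residue at \<open>j\<close> by \<open>t j\<close> and no other, so a small solution \<open>t\<close> is found by iteration
  (\<open>kill_functionals_by_exponential\<close>). The complement of a disc and finitely many points is connected,
  hence the new primitive is close to \<open>g\<close> on compact sets as soon as its derivative is close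
  (\<open>primitive_control\<close>); in particular no constants have to be matched between different components of
  \<open>K\<close>. This is \<open>lu_class_approx\<close>.

  Chains of small discs move an exceptional point anywhere within its component of the complement of
  \<open>K\<close>, and finally everything outside a large disc can be discarded (\<open>lu_class_push\<close>). The hypothesis on
  \<open>\<Omega> - K\<close> says that each component of the complement of \<open>K\<close> is unbounded or contains a point
  outside \<open>\<Omega>\<close>. For (b) the derivatives in question have double poles with residue zero at the poles of
  \<open>f\<close>. Near such a pole \<open>a\<close> the numerators \<open>(z - a) f z\<close> and \<open>(z - a) g z\<close> are holomorphic and compared
  by the maximum principle, which controls the chordal distance.
\<close>

section \<open>Rational functions and zero-free functions with prescribed singularities\<close>

text \<open>
  Rational functions with poles in \<open>S\<close>, given by generators and not as quotients of polynomials, since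
  approximations are built generator by generator. Values at points of \<open>S\<close> are dummies (\<open>1 / 0 = 0\<close>).
\<close>
inductive_set rat_alg :: "complex set \<Rightarrow> (complex \<Rightarrow> complex) set" for S where
  rat_const: "(\<lambda>z. c) \<in> rat_alg S"
| rat_id: "(\<lambda>z. z) \<in> rat_alg S"
| rat_pole: "s \<in> S \<Longrightarrow> (\<lambda>z. 1 / (z - s)) \<in> rat_alg S"
| rat_add: "f \<in> rat_alg S \<Longrightarrow> g \<in> rat_alg S \<Longrightarrow> (\<lambda>z. f z + g z) \<in> rat_alg S"
| rat_mult: "f \<in> rat_alg S \<Longrightarrow> g \<in> rat_alg S \<Longrightarrow> (\<lambda>z. f z * g z) \<in> rat_alg S"

text \<open>
  The derivatives that occur: holomorphic and zero-free off \<open>S\<close>, with zeros, poles or essential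
  singularities at the points of \<open>S\<close>. The class is closed under inversion and under multiplication by
  exponentials of rational functions.
\<close>
inductive_set zero_free :: "complex set \<Rightarrow> (complex \<Rightarrow> complex) set" for S where
  zf_exp: "Q \<in> rat_alg S \<Longrightarrow> (\<lambda>z. exp (Q z)) \<in> zero_free S"
| zf_lin: "s \<in> S \<Longrightarrow> (\<lambda>z. z - s) \<in> zero_free S"
| zf_inv_lin: "s \<in> S \<Longrightarrow> (\<lambda>z. 1 / (z - s)) \<in> zero_free S"
| zf_mult: "f \<in> zero_free S \<Longrightarrow> g \<in> zero_free S \<Longrightarrow> (\<lambda>z. f z * g z) \<in> zero_free S"

lemma rat_alg_holomorphic:
  assumes "Q \<in> rat_alg S" shows "Q holomorphic_on - S"
  using assms by induction (auto intro!: holomorphic_intros)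

lemma rat_alg_mono:
  assumes "Q \<in> rat_alg S" "S \<subseteq> T" shows "Q \<in> rat_alg T"
  using assms by induction (auto intro: rat_alg.intros)

lemma rat_alg_finite:
  assumes "Q \<in> rat_alg S" obtains T where "finite T" "T \<subseteq> S" "Q \<in> rat_alg T"
proof -
  have join: "\<exists>T. finite T \<and> T \<subseteq> S \<and> f \<in> rat_alg T \<and> g \<in> rat_alg T"
    if "\<exists>T. finite T \<and> T \<subseteq> S \<and> f \<in> rat_alg T" "\<exists>T. finite T \<and> T \<subseteq> S \<and> g \<in> rat_alg T" for f g
    using that by (meson finite_UnI le_sup_iff rat_alg_mono sup_ge1 sup_ge2)
  have "\<exists>T. finite T \<and> T \<subseteq> S \<and> Q \<in> rat_alg T"
    using assms
  proof induction
    case (rat_pole s) then show ?case by (intro exI[of _ "{s}"]) (auto intro: rat_alg.intros)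
  next
    case (rat_add f g)
    then obtain T where "finite T" "T \<subseteq> S" "f \<in> rat_alg T" "g \<in> rat_alg T" using join[of f g] by blast
    then show ?case by (intro exI[of _ T]) (auto intro: rat_alg.intros)
  next
    case (rat_mult f g)
    then obtain T where "finite T" "T \<subseteq> S" "f \<in> rat_alg T" "g \<in> rat_alg T" using join[of f g] by blast
    then show ?case by (intro exI[of _ T]) (auto intro: rat_alg.intros)
  qed (auto intro!: exI[of _ "{}"] rat_alg.intros)
  then show ?thesis using that by blast
qed

lemma rat_alg_cmult: "f \<in> rat_alg S \<Longrightarrow> (\<lambda>z. c * f z) \<in> rat_alg S"
  by (rule rat_mult[OF rat_const])

lemma rat_alg_diff_const: "(\<lambda>z. z - c) \<in> rat_alg S"
  using rat_add[OF rat_id rat_const[of "-c"], of S] by simp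

lemma rat_alg_sum:
  assumes "\<And>i. i \<in> I \<Longrightarrow> f i \<in> rat_alg S" shows "(\<lambda>z. \<Sum>i\<in>I. f i z) \<in> rat_alg S"
  using assms by (induction I rule: infinite_finite_induct) (auto intro: rat_alg.intros)

lemma rat_alg_prod:
  assumes "\<And>i. i \<in> I \<Longrightarrow> f i \<in> rat_alg S" shows "(\<lambda>z. \<Prod>i\<in>I. f i z) \<in> rat_alg S"
  using assms by (induction I rule: infinite_finite_induct) (auto intro: rat_alg.intros)

lemma rat_alg_power: "f \<in> rat_alg S \<Longrightarrow> (\<lambda>z. f z ^ n) \<in> rat_alg S"
  by (induction n) (auto intro: rat_alg.intros)

lemma rat_alg_deriv:
  assumes "Q \<in> rat_alg S"
  obtains Q' where "Q' \<in> rat_alg S" "\<And>z. z \<notin> S \<Longrightarrow> (Q has_field_derivative Q' z) (at z)"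
proof -
  have "\<exists>Q'\<in>rat_alg S. \<forall>z. z \<notin> S \<longrightarrow> (Q has_field_derivative Q' z) (at z)"
    using assms
  proof induction
    case (rat_const c)
    show ?case by (intro bexI[of _ "\<lambda>z. 0"]) (auto intro: rat_alg.intros)
  next
    case rat_id
    show ?case by (intro bexI[of _ "\<lambda>z. 1"]) (auto intro: rat_alg.intros)
  next
    case (rat_pole s)
    have *: "(\<lambda>z. (- 1) * (1 / (z - s) * (1 / (z - s)))) \<in> rat_alg S"
      using rat_pole by (intro rat_alg.intros)
    have "((\<lambda>z. 1 / (z - s)) has_field_derivative (- 1) * (1 / (z - s) * (1 / (z - s)))) (at z)"
      if "z \<notin> S" for z
      using that rat_pole by (auto intro!: derivative_eq_intros simp: divide_simps)
    then show ?case by (intro bexI[OF _ *]) auto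
  next
    case (rat_add f g)
    then obtain f' g' where "f' \<in> rat_alg S" "g' \<in> rat_alg S"
      "\<And>z. z \<notin> S \<Longrightarrow> (f has_field_derivative f' z) (at z)" "\<And>z. z \<notin> S \<Longrightarrow> (g has_field_derivative g' z) (at z)"
      by blast
    then show ?case by (intro bexI[of _ "\<lambda>z. f' z + g' z"]) (auto intro: rat_alg.intros derivative_intros)
  next
    case (rat_mult f g)
    then obtain f' g' where "f' \<in> rat_alg S" "g' \<in> rat_alg S"
      "\<And>z. z \<notin> S \<Longrightarrow> (f has_field_derivative f' z) (at z)" "\<And>z. z \<notin> S \<Longrightarrow> (g has_field_derivative g' z) (at z)"
      by blast
    then show ?case using rat_mult
      by (intro bexI[of _ "\<lambda>z. f' z * g z + g' z * f z"])
         (auto intro!: rat_alg.intros intro: DERIV_mult)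
  qed
  then show ?thesis using that by blast
qed

lemma zero_free_nonzero:
  assumes "F \<in> zero_free S" "z \<notin> S" shows "F z \<noteq> 0"
  using assms by induction auto

lemma zero_free_holomorphic:
  assumes "F \<in> zero_free S" shows "F holomorphic_on - S"
  using assms
proof induction
  case (zf_exp Q) then show ?case using rat_alg_holomorphic[of Q S] by (auto intro!: holomorphic_intros)
qed (auto intro!: holomorphic_intros)

lemma zero_free_inverse:
  assumes "F \<in> zero_free S" shows "(\<lambda>z. 1 / F z) \<in> zero_free S"
  using assms
proof induction
  case (zf_exp Q)
  have "(\<lambda>z. exp ((-1) * Q z)) \<in> zero_free S"
    by (intro zero_free.intros rat_alg_cmult zf_exp)
  then show ?case by (simp add: exp_minus inverse_eq_divide)
next
  case (zf_mult f g)
  then show ?case using zero_free.zf_mult[of "\<lambda>z. 1 / f z" S "\<lambda>z. 1 / g z"] by simp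
qed (auto intro: zero_free.intros)

lemma zero_free_mono:
  assumes "F \<in> zero_free S" "S \<subseteq> T" shows "F \<in> zero_free T"
  using assms by induction (auto intro: zero_free.intros rat_alg_mono)

lemma zero_free_const: "c \<noteq> 0 \<Longrightarrow> (\<lambda>z. c) \<in> zero_free S"
  using zf_exp[OF rat_const[of "Ln c"], of S] by simp

section \<open>Uniform approximation on compact sets\<close>

lemma approx_member: "f \<in> C \<Longrightarrow> unif_approx_by L f C"
  unfolding unif_approx_by_def by (metis diff_self norm_zero)

lemma approx_cong:
  assumes "unif_approx_by L f C" "\<And>z. z \<in> L \<Longrightarrow> f z = g z" shows "unif_approx_by L g C"
  using assms unfolding unif_approx_by_def by simp

lemma approx_trans:
  assumes "unif_approx_by L f C" "\<And>g. g \<in> C \<Longrightarrow> unif_approx_by L g C'"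
  shows "unif_approx_by L f C'"
  unfolding unif_approx_by_def
proof (intro allI impI)
  fix e :: real assume "e > 0"
  then have "e/2 > 0" by simp
  then obtain g where g: "g \<in> C" "\<forall>z\<in>L. cmod (f z - g z) < e/2"
    using assms(1) unfolding unif_approx_by_def by blast
  then obtain h where h: "h \<in> C'" "\<forall>z\<in>L. cmod (g z - h z) < e/2"
    using assms(2) \<open>e/2 > 0\<close> unfolding unif_approx_by_def by blast
  have "cmod (f z - h z) < e" if "z \<in> L" for z
    using g h that norm_triangle_lt[of "f z - g z" "g z - h z" e] by fastforce
  then show "\<exists>g\<in>C'. \<forall>z\<in>L. cmod (f z - g z) < e" using h by blast
qed

lemma approx_add:
  assumes "unif_approx_by L f C" "unif_approx_by L g C"
    and "\<And>u v. u \<in> C \<Longrightarrow> v \<in> C \<Longrightarrow> (\<lambda>z. u z + v z) \<in> C"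
  shows "unif_approx_by L (\<lambda>z. f z + g z) C"
  unfolding unif_approx_by_def
proof (intro allI impI)
  fix e :: real assume "e > 0"
  then have "e/2 > 0" by simp
  then obtain u v where u: "u \<in> C" "\<forall>z\<in>L. cmod (f z - u z) < e/2"
    and v: "v \<in> C" "\<forall>z\<in>L. cmod (g z - v z) < e/2"
    using assms(1,2) unfolding unif_approx_by_def by blast
  have "cmod (f z + g z - (u z + v z)) < e" if "z \<in> L" for z
    using u v that norm_triangle_lt[of "f z - u z" "g z - v z" e] by (fastforce simp: algebra_simps)
  then show "\<exists>h\<in>C. \<forall>z\<in>L. cmod (f z + g z - h z) < e"
    using assms(3)[OF u(1) v(1)] by (intro bexI[of _ "\<lambda>z. u z + v z"]) auto
qed

lemma approx_mult:
  assumes "unif_approx_by L f C" "unif_approx_by L g C"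
    and "\<And>u v. u \<in> C \<Longrightarrow> v \<in> C \<Longrightarrow> (\<lambda>z. u z * v z) \<in> C"
    and "bounded (f ` L)" "bounded (g ` L)"
  shows "unif_approx_by L (\<lambda>z. f z * g z) C"
  unfolding unif_approx_by_def
proof (intro allI impI)
  fix e :: real assume "e > 0"
  obtain B1 B2 where B12: "\<forall>z\<in>L. cmod (f z) \<le> B1" "\<forall>z\<in>L. cmod (g z) \<le> B2"
    using assms(4,5) unfolding bounded_iff by auto
  define B where "B = max 1 (max B1 B2)"
  have B: "B \<ge> 1" "\<And>z. z \<in> L \<Longrightarrow> cmod (f z) \<le> B" "\<And>z. z \<in> L \<Longrightarrow> cmod (g z) \<le> B"
    using B12 unfolding B_def by fastforce+
  define d where "d = min 1 (e / (4 * B))"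
  have d: "d > 0" "d \<le> 1" "d * (4 * B) \<le> e"
    using \<open>e > 0\<close> B(1) unfolding d_def by (auto simp: min_def field_simps)
  obtain u v where u: "u \<in> C" "\<forall>z\<in>L. cmod (f z - u z) < d"
    and v: "v \<in> C" "\<forall>z\<in>L. cmod (g z - v z) < d"
    using assms(1,2) d(1) unfolding unif_approx_by_def by blast
  have "cmod (f z * g z - (u z * v z)) < e" if "z \<in> L" for z
  proof -
    have "cmod (v z) \<le> 2 * B"
      using norm_triangle_ineq3[of "v z" "g z"] v(2) B(1) B(3)[OF that] that d(2)
      by (fastforce simp: norm_minus_commute)
    have "f z * g z - u z * v z = f z * (g z - v z) + (f z - u z) * v z" by (simp add: algebra_simps)
    then have "cmod (f z * g z - (u z * v z)) \<le> cmod (f z) * cmod (g z - v z) + cmod (f z - u z) * cmod (v z)"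
      by (metis norm_mult norm_triangle_ineq)
    also have "\<dots> \<le> B * d + d * (2 * B)"
      using u v that B d(1) \<open>cmod (v z) \<le> 2 * B\<close> by (intro add_mono mult_mono) (auto intro: less_imp_le)
    also have "\<dots> < d * (4 * B)" using d B(1) by (simp add: algebra_simps)
    finally show ?thesis using d(3) by simp
  qed
  then show "\<exists>h\<in>C. \<forall>z\<in>L. cmod (f z * g z - h z) < e"
    using assms(3)[OF u(1) v(1)] by (intro bexI[of _ "\<lambda>z. u z * v z"]) auto
qed

lemma approx_compose:
  assumes "unif_approx_by L f C" "bounded (f ` L)" "continuous_on UNIV h"
    and "\<And>u. u \<in> C \<Longrightarrow> (\<lambda>z. h (u z)) \<in> C'"
  shows "unif_approx_by L (\<lambda>z. h (f z)) C'"
  unfolding unif_approx_by_def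
proof (intro allI impI)
  fix e :: real assume "e > 0"
  obtain B where B: "\<forall>z\<in>L. cmod (f z) \<le> B" using assms(2) unfolding bounded_iff by auto
  have "uniformly_continuous_on (cball 0 (B + 1)) h"
    by (intro compact_uniformly_continuous continuous_on_subset[OF assms(3)]) auto
  then obtain d where d: "d > 0" "\<And>x y. x \<in> cball 0 (B + 1) \<Longrightarrow> y \<in> cball 0 (B + 1) \<Longrightarrow> dist x y < d \<Longrightarrow> dist (h x) (h y) < e"
    using \<open>e > 0\<close> unfolding uniformly_continuous_on_def by metis
  have "min 1 d > 0" using d by simp
  then obtain u where u: "u \<in> C" "\<forall>z\<in>L. cmod (f z - u z) < min 1 d"
    using assms(1) unfolding unif_approx_by_def by blast
  have "cmod (h (f z) - h (u z)) < e" if "z \<in> L" for z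
  proof -
    have "cmod (f z - u z) < 1" "cmod (f z - u z) < d" "cmod (f z) \<le> B" using u that B by auto
    moreover from this have "cmod (u z) \<le> B + 1"
      using norm_triangle_ineq3[of "u z" "f z"] by (simp add: norm_minus_commute)
    ultimately show ?thesis
      using d(2)[of "f z" "u z"] by (simp add: dist_norm)
  qed
  then show "\<exists>g\<in>C'. \<forall>z\<in>L. cmod (h (f z) - g z) < e"
    using assms(4)[OF u(1)] by (intro bexI[of _ "\<lambda>z. h (u z)"]) auto
qed

lemma approx_inverse:
  assumes "unif_approx_by L f C" "compact L" "continuous_on L f" "\<And>z. z \<in> L \<Longrightarrow> f z \<noteq> 0"
    and "\<And>u. u \<in> C \<Longrightarrow> (\<lambda>z. 1 / u z) \<in> C"
  shows "unif_approx_by L (\<lambda>z. 1 / f z) C"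
proof (cases "L = {}")
  case True
  obtain u where "u \<in> C" using assms(1) unfolding unif_approx_by_def by (meson zero_less_one)
  then show ?thesis using True unfolding unif_approx_by_def by auto
next
  case False
  obtain z0 where z0: "z0 \<in> L" "\<forall>z\<in>L. cmod (f z0) \<le> cmod (f z)"
    using continuous_attains_inf[OF assms(2) False continuous_on_norm[OF assms(3)]] by blast
  define c where "c = cmod (f z0)"
  have c: "c > 0" "\<And>z. z \<in> L \<Longrightarrow> c \<le> cmod (f z)" using assms(4) z0 by (auto simp: c_def)
  show ?thesis unfolding unif_approx_by_def
  proof (intro allI impI)
    fix e :: real assume "e > 0"
    define d where "d = min (c / 2) (e * c * c / 4)"
    have d: "d > 0" "d \<le> c / 2" "d \<le> e * c * c / 4" using \<open>e > 0\<close> c(1) unfolding d_def by auto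
    obtain u where u: "u \<in> C" "\<forall>z\<in>L. cmod (f z - u z) < d"
      using assms(1) d(1) unfolding unif_approx_by_def by blast
    have "cmod (1 / f z - 1 / u z) < e" if "z \<in> L" for z
    proof -
      have fz: "c \<le> cmod (f z)" and fu: "cmod (f z - u z) < d" using c u that by auto
      have uz: "c / 2 \<le> cmod (u z)" using norm_triangle_ineq2[of "f z" "u z"] fz fu d(2)
        by (simp add: norm_minus_commute)
      have nz: "f z \<noteq> 0" "u z \<noteq> 0" using fz uz c(1) by auto
      have "cmod (1 / f z - 1 / u z) = cmod (f z - u z) / (cmod (f z) * cmod (u z))"
        using nz by (simp add: divide_simps norm_divide norm_mult norm_minus_commute)
      also have "\<dots> \<le> d / (c * (c / 2))"
        using fz uz fu c(1) d(1) by (intro frac_le mult_mono) auto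
      also have "\<dots> \<le> (e * c * c / 4) / (c * (c / 2))"
        using d(3) c(1) by (intro divide_right_mono) auto
      also have "\<dots> < e" using c(1) \<open>e > 0\<close> by (simp add: field_simps)
      finally show ?thesis .
    qed
    then show "\<exists>g\<in>C. \<forall>z\<in>L. cmod (1 / f z - g z) < e"
      using assms(5)[OF u(1)] by (intro bexI[of _ "\<lambda>z. 1 / u z"]) auto
  qed
qed

lemma bounded_holomorphic_image:
  assumes "f holomorphic_on - S" "compact L" "L \<inter> S = {}"
  shows "bounded (f ` L)"
  using assms by (intro compact_imp_bounded compact_continuous_image holomorphic_on_imp_continuous_on)
     (auto intro: holomorphic_on_subset)

lemma bounded_approx_rational:
  assumes "unif_approx_by L f (rat_alg S)" "compact L" "L \<inter> S = {}"
  shows "bounded (f ` L)"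
proof -
  obtain q where q: "q \<in> rat_alg S" "\<And>z. z \<in> L \<Longrightarrow> cmod (f z - q z) < 1"
    using assms(1) unfolding unif_approx_by_def by (meson zero_less_one)
  obtain B where B: "\<And>z. z \<in> L \<Longrightarrow> cmod (q z) \<le> B"
    using bounded_holomorphic_image[OF rat_alg_holomorphic[OF q(1)] assms(2,3)] unfolding bounded_iff by auto
  have "cmod (f z) \<le> B + 1" if "z \<in> L" for z
    using norm_triangle_sub[of "f z" "q z"] q(2)[OF that] B[OF that] by linarith
  then show ?thesis unfolding bounded_iff by blast
qed

text \<open>The partial sums of the Taylor series of \<open>h\<close> are polynomials in \<open>w\<close> and hence remain in the algebra.\<close>
lemma approx_power_series:
  assumes h: "h holomorphic_on ball 0 R" and w: "w \<in> rat_alg S" and "r < R"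
    and wL: "\<And>z. z \<in> L \<Longrightarrow> cmod (w z) \<le> r"
  shows "unif_approx_by L (\<lambda>z. h (w z)) (rat_alg S)"
proof (cases "r < 0")
  case True
  then have "L = {}" using wL by (metis equals0I norm_ge_zero not_le order_trans)
  then show ?thesis unfolding unif_approx_by_def by (auto intro: rat_const)
next
  case False
  define a where "a n = (deriv ^^ n) h 0 / fact n" for n
  obtain r' where r': "r < r'" "r' < R" using \<open>r < R\<close> dense by blast
  have sums: "(\<lambda>n. a n * x ^ n) sums h x" if "cmod x < R" for x
    using holomorphic_power_series[OF h, of x] that by (simp add: a_def)
  have "summable (\<lambda>n. a n * complex_of_real r' ^ n)"
    using sums[of "complex_of_real r'"] r' False by (auto simp: summable_def)
  then have sm: "summable (\<lambda>n. cmod (a n * complex_of_real r ^ n))"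
    by (rule powser_insidea) (use r' False in auto)
  have ul: "uniform_limit L (\<lambda>n z. \<Sum>i<n. a i * w z ^ i) (\<lambda>z. \<Sum>i. a i * w z ^ i) sequentially"
  proof (rule Weierstrass_m_test[OF _ sm])
    fix n z assume "z \<in> L"
    show "cmod (a n * w z ^ n) \<le> cmod (a n * complex_of_real r ^ n)"
      using wL[OF \<open>z \<in> L\<close>] False by (auto simp: norm_mult norm_power intro!: mult_left_mono power_mono)
  qed
  show ?thesis unfolding unif_approx_by_def
  proof (intro allI impI)
    fix e :: real assume "e > 0"
    obtain n where n: "\<forall>z\<in>L. dist (\<Sum>i<n. a i * w z ^ i) (\<Sum>i. a i * w z ^ i) < e"
      using ul \<open>e > 0\<close> unfolding uniform_limit_iff eventually_sequentially by blast
    have "cmod (h (w z) - (\<Sum>i<n. a i * w z ^ i)) < e" if "z \<in> L" for z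
    proof -
      have "(\<Sum>i. a i * w z ^ i) = h (w z)"
        using sums[of "w z"] wL[OF that] \<open>r < R\<close> by (auto simp: sums_iff)
      then show ?thesis using n that by (auto simp: dist_norm norm_minus_commute)
    qed
    moreover have "(\<lambda>z. \<Sum>i<n. a i * w z ^ i) \<in> rat_alg S"
      by (intro rat_alg_sum rat_alg_cmult rat_alg_power w)
    ultimately show "\<exists>g\<in>rat_alg S. \<forall>z\<in>L. cmod (h (w z) - g z) < e"
      by (intro bexI[of _ "\<lambda>z. \<Sum>i<n. a i * w z ^ i"]) auto
  qed
qed

lemma zero_free_approx_rational:
  assumes "F \<in> zero_free S" "compact L" "L \<inter> S = {}"
  shows "unif_approx_by L F (rat_alg S)"
  using assms(1)
proof induction
  case (zf_exp Q)
  have "bounded (Q ` L)"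
    using assms rat_alg_holomorphic[OF zf_exp] by (intro bounded_holomorphic_image) auto
  then obtain B where B: "\<And>z. z \<in> L \<Longrightarrow> cmod (Q z) \<le> B" unfolding bounded_iff by auto
  show ?case
    by (rule approx_power_series[of exp "B + 1", OF _ zf_exp _ B]) (auto intro!: holomorphic_intros)
next
  case (zf_mult f g)
  then show ?case using assms(2,3) zero_free_holomorphic
    by (intro approx_mult bounded_holomorphic_image rat_alg.intros) auto
qed (auto intro!: approx_member rat_alg.intros rat_alg_diff_const)

text \<open>
  A change of the set of singularities only has to be verified on the linear factors \<open>z - s\<close>: simple
  fractions follow by inversion, rational exponents and products by continuity.
\<close>
lemma zero_free_approx_transfer:
  assumes "F \<in> zero_free S" "compact L" "L \<inter> S = {}" "L \<inter> S' = {}"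
    and lin: "\<And>s. s \<in> S \<Longrightarrow> unif_approx_by L (\<lambda>z. z - s) (zero_free S')"
  shows "unif_approx_by L F (zero_free S')"
proof -
  have inv: "unif_approx_by L (\<lambda>z. 1 / (z - s)) (zero_free S')" if "s \<in> S" for s
    using that assms by (intro approx_inverse lin zero_free_inverse) (auto intro!: continuous_intros)
  have alg: "unif_approx_by L Q (rat_alg S')" if "Q \<in> rat_alg S" for Q
    using that
  proof induction
    case (rat_pole s)
    then show ?case using assms by (auto intro: approx_trans[OF inv] zero_free_approx_rational)
  next
    case (rat_add f g)
    then show ?case by (intro approx_add rat_alg.intros)
  next
    case (rat_mult f g)
    then show ?case using assms rat_alg_holomorphic
      by (intro approx_mult bounded_holomorphic_image rat_alg.intros) auto
  qed (auto intro!: approx_member rat_alg.intros)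
  show ?thesis using assms(1)
  proof induction
    case (zf_exp Q)
    show ?case using assms rat_alg_holomorphic[OF zf_exp]
      by (intro approx_compose[OF alg[OF zf_exp]] bounded_holomorphic_image)
         (auto intro!: continuous_intros zero_free.intros)
  next
    case (zf_mult f g)
    then show ?case using assms zero_free_holomorphic
      by (intro approx_mult bounded_holomorphic_image zero_free.intros) auto
  qed (auto intro: lin inv)
qed

text \<open>
  With \<open>w = 1 / (z - d)\<close> one has \<open>z - s = (z - d) exp (Ln (1 - (s - d) w))\<close> outside the disc, where the
  logarithm is a power series in \<open>w\<close>.
\<close>
lemma linear_approx_move_to_center:
  assumes "compact L" "L \<inter> cball d \<rho> = {}" "s \<in> cball d \<rho>" "d \<in> S'"
  shows "unif_approx_by L (\<lambda>z. z - s) (zero_free S')"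
proof (cases "s = d \<or> L = {}")
  case True
  then have "unif_approx_by L (\<lambda>z. z - d) (zero_free S') \<and> (\<forall>z\<in>L. z - d = z - s)"
    using approx_member[OF zf_lin[OF assms(4)]] by auto
  then show ?thesis by (metis (mono_tags, lifting) approx_cong)
next
  case False
  define \<tau> where "\<tau> = cmod (s - d)"
  have \<tau>: "\<tau> > 0" "\<tau> \<le> \<rho>" using False assms(3) by (auto simp: \<tau>_def dist_norm norm_minus_commute)
  obtain z0 where z0: "z0 \<in> L" "\<And>z. z \<in> L \<Longrightarrow> cmod (z0 - d) \<le> cmod (z - d)"
    using continuous_attains_inf[OF assms(1), of "\<lambda>z. cmod (z - d)"] False
      continuous_on_norm[OF continuous_on_diff[OF continuous_on_id continuous_on_const], of L d] by blast
  define m where "m = cmod (z0 - d)"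
  have m: "m > \<tau>" "\<And>z. z \<in> L \<Longrightarrow> m \<le> cmod (z - d)"
    using z0 assms(2) \<tau>(2) by (auto simp: m_def dist_norm norm_minus_commute disjoint_iff)
  define h where "h w = Ln (1 - (s - d) * w)" for w
  have lt: "cmod ((s - d) * w) < 1" if "cmod w < 1 / \<tau>" for w
    proof -
    have "cmod ((s - d) * w) = \<tau> * cmod w" by (simp add: norm_mult \<tau>_def)
    then show ?thesis using that \<tau> by (simp add: field_simps)
  qed
  have half: "1 - (s - d) * w \<notin> \<real>\<^sub>\<le>\<^sub>0" if "cmod w < 1 / \<tau>" for w
  proof -
    have "Re ((s - d) * w) < 1" using lt[OF that] complex_Re_le_cmod[of "(s - d) * w"] by linarith
    then show ?thesis by (auto simp: complex_nonpos_Reals_iff)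
  qed
  have hol: "h holomorphic_on ball 0 (1 / \<tau>)"
    unfolding h_def using half by (auto intro!: holomorphic_intros)
  have ap: "unif_approx_by L (\<lambda>z. h (1 / (z - d))) (rat_alg {d})"
  proof (rule approx_power_series[where r = "1 / m", OF hol rat_pole])
    show "1 / m < 1 / \<tau>" using m(1) \<tau>(1) by (auto intro!: divide_strict_left_mono)
    show "cmod (1 / (z - d)) \<le> 1 / m" if "z \<in> L" for z
      using m(2)[OF that] m(1) \<tau>(1) by (simp add: norm_divide frac_le)
  qed simp
  have Ld: "L \<inter> {d} = {}" using m \<tau>(1) by fastforce
  have ex: "unif_approx_by L (\<lambda>z. exp (h (1 / (z - d)))) (zero_free {d})"
    using ap bounded_approx_rational[OF ap assms(1) Ld]
    by (rule approx_compose[where h = exp]) (auto intro!: continuous_intros zf_exp)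
  have eq: "(z - d) * exp (h (1 / (z - d))) = z - s" if "z \<in> L" for z
  proof -
    have "1 / cmod (z - d) < 1 / \<tau>"
      using m(2)[OF that] m(1) \<tau>(1) by (intro frac_less2) auto
    then have zd: "z - d \<noteq> 0" "cmod (1 / (z - d)) < 1 / \<tau>"
      using m(2)[OF that] m(1) \<tau>(1) by (auto simp only: norm_divide norm_one) auto
    then have "1 - (s - d) * (1 / (z - d)) \<noteq> 0" using half by fastforce
    then have "exp (h (1 / (z - d))) = 1 - (s - d) * (1 / (z - d))" unfolding h_def by (rule exp_Ln)
    then show ?thesis using zd(1) by (simp add: field_simps)
  qed
  have bd: "bounded ((\<lambda>z. exp (h (1 / (z - d)))) ` L)"
    using approx_trans[OF ex zero_free_approx_rational[OF _ assms(1) Ld]] assms(1) Ld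
    by (rule bounded_approx_rational)
  have "unif_approx_by L (\<lambda>z. (z - d) * exp (h (1 / (z - d)))) (zero_free {d})"
    using assms(1) by (intro approx_mult ex bd zf_mult approx_member zf_lin compact_imp_bounded
        compact_continuous_image continuous_intros) auto
  then have "unif_approx_by L (\<lambda>z. z - s) (zero_free {d})" by (rule approx_cong) (rule eq)
  then show ?thesis
    by (rule approx_trans) (use assms(4) in \<open>auto intro: approx_member zero_free_mono\<close>)
qed

text \<open>The same with the point at infinity as centre: \<open>z - s = - s exp (Ln (1 - z / s))\<close> for \<open>\<bar>z\<bar> < \<bar>s\<bar>\<close>.\<close>
lemma linear_approx_move_to_infinity:
  assumes "compact L" "L \<subseteq> ball 0 \<rho>" "\<rho> > 0" "cmod s \<ge> \<rho>"
  shows "unif_approx_by L (\<lambda>z. z - s) (zero_free S')"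
proof (cases "L = {}")
  case True
  then show ?thesis using zero_free_const[of 1] by (auto simp: unif_approx_by_def)
next
  case False
  obtain z0 where z0: "z0 \<in> L" "\<And>z. z \<in> L \<Longrightarrow> cmod z \<le> cmod z0"
    using continuous_attains_sup[OF assms(1), of "\<lambda>z. cmod z"] False
      continuous_on_norm[OF continuous_on_id, of L] by blast
  have s: "s \<noteq> 0" using assms by auto
  define h where "h w = Ln (1 - w / s)" for w
  have half: "1 - w / s \<notin> \<real>\<^sub>\<le>\<^sub>0" if "cmod w < \<rho>" for w
  proof -
    have "cmod (w / s) < 1" using that assms(3,4) s by (simp add: norm_divide pos_divide_less_eq)
    then have "Re (w / s) < 1" using complex_Re_le_cmod[of "w / s"] by linarith
    then show ?thesis by (auto simp: complex_nonpos_Reals_iff)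
  qed
  have hol: "h holomorphic_on ball 0 \<rho>"
    unfolding h_def using half s by (auto intro!: holomorphic_intros)
  have ap: "unif_approx_by L (\<lambda>z. h z) (rat_alg S')"
    by (rule approx_power_series[OF hol rat_id, of "cmod z0"]) (use z0 assms in auto)
  have "continuous_on L h" using hol assms(2)
    by (meson holomorphic_on_imp_continuous_on holomorphic_on_subset)
  then have bd: "bounded (h ` L)" "bounded ((\<lambda>z. exp (h z)) ` L)"
    using assms(1) by (intro compact_imp_bounded compact_continuous_image continuous_intros; simp)+
  have "unif_approx_by L (\<lambda>z. (- s) * exp (h z)) (zero_free S')"
  proof (rule approx_mult)
    show "unif_approx_by L (\<lambda>z. exp (h z)) (zero_free S')"
      by (rule approx_compose[OF ap bd(1)]) (auto intro!: continuous_intros zero_free.intros)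
    show "unif_approx_by L (\<lambda>z. - s) (zero_free S')"
      using s by (intro approx_member zero_free_const) auto
  qed (use bd False in \<open>auto intro: zero_free.intros simp: image_constant_conv\<close>)
  moreover have "(- s) * exp (h z) = z - s" if "z \<in> L" for z
  proof -
    have "1 - z / s \<noteq> 0" using half[of z] that assms(2) by fastforce
    then show ?thesis using s unfolding h_def by (simp add: field_simps)
  qed
  ultimately show ?thesis by (rule approx_cong)
qed

section \<open>Approximation of holomorphic functions by rational functions\<close>

text \<open>
  A Cauchy integral over a segment is a uniform limit of Riemann sums, and these are combinations of simple
  fractions with poles on the segment. The Riemann sums are produced by repeated bisection.
\<close>
lemma cauchy_integral_approx:
  assumes K: "compact K" and f: "continuous_on (closed_segment a b) f" and disj: "closed_segment a b \<inter> K = {}"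
  shows "unif_approx_by K (\<lambda>z. contour_integral (linepath a b) (\<lambda>w. f w / (w - z))) (rat_alg (- K))"
  unfolding unif_approx_by_def
proof (intro allI impI)
  fix eps :: real assume "eps > 0"
  define eta where "eta = eps / (2 * (cmod (b - a) + 1))"
  have eta: "eta > 0" "eta * cmod (b - a) < eps"
  proof -
    have pos: "2 * (cmod (b - a) + 1) > 0" by (simp add: add_nonneg_pos)
    then show "eta > 0" using \<open>eps > 0\<close> by (simp add: eta_def)
    have "eps * cmod (b - a) < eps * (2 * (cmod (b - a) + 1))"
      using \<open>eps > 0\<close> by (intro mult_strict_left_mono) (auto simp: add_nonneg_pos)
    then show "eta * cmod (b - a) < eps" using pos by (simp add: eta_def pos_divide_less_eq mult_ac)
  qed
  let ?X = "closed_segment a b \<times> K"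
  have "continuous_on ?X (\<lambda>(w, z). f w / (w - z))"
    unfolding split_def using disj
    by (intro continuous_intros continuous_on_compose2[OF f]) auto
  then have uc: "uniformly_continuous_on ?X (\<lambda>(w, z). f w / (w - z))"
    using K by (intro compact_uniformly_continuous compact_Times) auto
  obtain d where d: "d > 0" "\<And>x y. x \<in> ?X \<Longrightarrow> y \<in> ?X \<Longrightarrow> dist y x < d \<Longrightarrow>
       dist (case y of (w, z) \<Rightarrow> f w / (w - z)) (case x of (w, z) \<Rightarrow> f w / (w - z)) < eta"
    by (rule uniformly_continuous_onE[OF uc eta(1)]) (rule that; assumption)
  have osc: "cmod (f w / (w - z) - f v / (v - z)) \<le> eta"
    if "w \<in> closed_segment a b" "v \<in> closed_segment a b" "z \<in> K" "dist w v < d" for w v z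
    using d(2)[of "(v, z)" "(w, z)"] that by (auto simp: dist_norm dist_Pair_Pair intro: less_imp_le)
  have cont: "continuous_on (closed_segment a b) (\<lambda>w. f w / (w - z))" if "z \<in> K" for z
    using disj that by (intro continuous_intros f) auto
  have "\<exists>q\<in>rat_alg (- K). \<forall>z\<in>K. cmod (contour_integral (linepath u v) (\<lambda>w. f w / (w - z)) - q z) \<le> eta * cmod (v - u)"
    if "closed_segment u v \<subseteq> closed_segment a b" "cmod (v - u) < 2 ^ n * d" for n u v
    using that
  proof (induction n arbitrary: u v)
    case 0
    have uab: "u \<in> closed_segment a b" using 0(1) by auto
    then have "u \<in> - K" using disj by auto
    then have "(\<lambda>z. (- f u * (v - u)) * (1 / (z - u))) \<in> rat_alg (- K)"
      by (intro rat_alg_cmult rat_pole)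
    moreover have "cmod (contour_integral (linepath u v) (\<lambda>w. f w / (w - z)) - (- f u * (v - u)) * (1 / (z - u))) \<le> eta * cmod (v - u)"
      if z: "z \<in> K" for z
    proof -
      have int: "(\<lambda>w. f w / (w - z)) contour_integrable_on linepath u v"
        using cont[OF z] 0(1) by (intro contour_integrable_continuous_linepath) (rule continuous_on_subset)
      have "z \<noteq> u" using z \<open>u \<in> - K\<close> by auto
      then have "- f u * (v - u) * (1 / (z - u)) = f u / (u - z) * (v - u)"
        by (simp add: divide_simps) (simp add: algebra_simps)
      then have "contour_integral (linepath u v) (\<lambda>w. f w / (w - z)) - (- f u * (v - u)) * (1 / (z - u))
         = contour_integral (linepath u v) (\<lambda>w. f w / (w - z) - f u / (u - z))"
        using int by (subst contour_integral_diff) auto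
      also have "cmod \<dots> \<le> eta * cmod (v - u)"
      proof (rule contour_integral_bound_linepath)
        show "(\<lambda>w. f w / (w - z) - f u / (u - z)) contour_integrable_on linepath u v"
          using int by (intro contour_integrable_diff) auto
        fix w assume w: "w \<in> closed_segment u v"
        have "dist w u \<le> cmod (v - u)" using segment_bound1[OF w] by (simp add: dist_norm)
        then show "cmod (f w / (w - z) - f u / (u - z)) \<le> eta"
          using w 0 uab z by (intro osc) auto
      qed (use eta in simp)
      finally show ?thesis .
    qed
    ultimately show ?case by (intro bexI[of _ "\<lambda>z. (- f u * (v - u)) * (1 / (z - u))"]) auto
  next
    case (Suc n)
    define m where "m = midpoint u v"
    have m: "m \<in> closed_segment u v" by (simp add: m_def)
    have len: "cmod (m - u) = cmod (v - u) / 2" "cmod (v - m) = cmod (v - u) / 2"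
      using dist_midpoint[of u v] by (auto simp: m_def dist_norm norm_minus_commute)
    have sub: "closed_segment u m \<subseteq> closed_segment a b" "closed_segment m v \<subseteq> closed_segment a b"
      using Suc.prems(1) m subset_closed_segment by (metis ends_in_segment(1,2) order_trans)+
    obtain q1 where q1: "q1 \<in> rat_alg (- K)"
       "\<forall>z\<in>K. cmod (contour_integral (linepath u m) (\<lambda>w. f w / (w - z)) - q1 z) \<le> eta * cmod (m - u)"
      using Suc.IH[OF sub(1)] Suc.prems(2) len by auto
    obtain q2 where q2: "q2 \<in> rat_alg (- K)"
       "\<forall>z\<in>K. cmod (contour_integral (linepath m v) (\<lambda>w. f w / (w - z)) - q2 z) \<le> eta * cmod (v - m)"
      using Suc.IH[OF sub(2)] Suc.prems(2) len by auto
    have "cmod (contour_integral (linepath u v) (\<lambda>w. f w / (w - z)) - (q1 z + q2 z)) \<le> eta * cmod (v - u)"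
      if z: "z \<in> K" for z
    proof -
      let ?I = "\<lambda>x y. contour_integral (linepath x y) (\<lambda>w. f w / (w - z))"
      have "?I u v = ?I u m + ?I m v"
        using cont[OF z] Suc.prems(1) m by (intro contour_integral_split_linepath) (auto intro: continuous_on_subset)
      then have "?I u v - (q1 z + q2 z) = (?I u m - q1 z) + (?I m v - q2 z)" by simp
      also have "cmod \<dots> \<le> eta * cmod (m - u) + eta * cmod (v - m)"
        using q1(2) q2(2) z by (intro norm_triangle_le add_mono) auto
      also have "\<dots> = eta * cmod (v - u)" by (simp add: len)
      finally show ?thesis .
    qed
    then show ?case using rat_add[OF q1(1) q2(1)] by (intro bexI[of _ "\<lambda>z. q1 z + q2 z"]) auto
  qed
  moreover obtain n where "cmod (b - a) / d < 2 ^ n"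
    using real_arch_pow[of 2 "cmod (b - a) / d"] by auto
  then have "cmod (b - a) < 2 ^ n * d" using d(1) by (simp add: pos_divide_less_eq)
  ultimately obtain q where "q \<in> rat_alg (- K)"
    "\<forall>z\<in>K. cmod (contour_integral (linepath a b) (\<lambda>w. f w / (w - z)) - q z) \<le> eta * cmod (b - a)" by blast
  then show "\<exists>g\<in>rat_alg (- K). \<forall>z\<in>K. cmod (contour_integral (linepath a b) (\<lambda>w. f w / (w - z)) - g z) < eps"
    using eta(2) by (intro bexI[of _ q]) fastforce+
qed

lemma cauchy_integral_continuous:
  assumes f: "continuous_on (closed_segment a b) f" and z: "z \<notin> closed_segment a b"
  shows "isCont (\<lambda>z. contour_integral (linepath a b) (\<lambda>w. f w / (w - z))) z"
proof -
  have "((\<lambda>z. contour_integral (linepath a b) (\<lambda>w. f w / (w - z))) has_field_derivative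
      1 * contour_integral (linepath a b) (\<lambda>u. f u / (u - z) ^ Suc 1)) (at z)"
  proof -
    have "((\<lambda>u. f u / (u - w) ^ 1) has_contour_integral
        contour_integral (linepath a b) (\<lambda>u. f u / (u - w))) (linepath a b)" if "w \<notin> closed_segment a b" for w
    proof -
      have "(\<lambda>u. f u / (u - w)) contour_integrable_on linepath a b"
        using that by (intro contour_integrable_continuous_linepath continuous_intros f) auto
      then show ?thesis by (simp add: has_contour_integral_integral)
    qed
    then show ?thesis
      using Cauchy_next_derivative(2)[of "linepath a b" f "cmod (b - a)" UNIV 1
          "\<lambda>z. contour_integral (linepath a b) (\<lambda>w. f w / (w - z))" z] f z
      by simp
  qed
  then show ?thesis by (rule DERIV_isCont)
qed

text \<open>
  Used for the boundary of a union of grid squares, with \<open>t\<close> the passage to a neighbouring square: an edge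
  common to two squares of the union cancels, and the surviving edges belong to exactly one of them.
\<close>
lemma sum_shift_cancel:
  fixes H :: "'i \<Rightarrow> complex"
  assumes "finite S" "inj_on t S"
  shows "(\<Sum>x\<in>S. H x) - (\<Sum>x\<in>S. H (t x)) = (\<Sum>x\<in>S - t ` S. H x) - (\<Sum>x\<in>t ` S - S. H x)"
proof -
  have "(\<Sum>x\<in>S. H (t x)) = (\<Sum>x\<in>t ` S. H x)" using assms(2) by (simp add: sum.reindex)
  moreover have "(\<Sum>x\<in>S. H x) = (\<Sum>x\<in>S - t ` S. H x) + (\<Sum>x\<in>S \<inter> t ` S. H x)"
    using assms(1) by (metis Int_commute add.commute sum.Int_Diff)
  moreover have "(\<Sum>x\<in>t ` S. H x) = (\<Sum>x\<in>t ` S - S. H x) + (\<Sum>x\<in>S \<inter> t ` S. H x)"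
    using assms(1) by (metis Int_commute add.commute finite_imageI sum.Int_Diff)
  ultimately show ?thesis by simp
qed

text \<open>
  Cover \<open>K\<close> by the squares of a fine grid that meet \<open>K\<close>. Summing Cauchy's formula over these squares
  represents \<open>f\<close> inside them by an integral over those edges that belong to only one of the squares. Such an
  edge also lies in a neighbouring square that does not meet \<open>K\<close>, so it avoids \<open>K\<close>. Points of \<open>K\<close> on
  the grid lines are reached by a limit.
\<close>
lemma runge_rational:
  assumes U: "open U" "f holomorphic_on U" and K: "compact K" "K \<subseteq> U"
  shows "unif_approx_by K f (rat_alg (- K))"
proof (cases "K = {}")
  case True
  then show ?thesis by (auto simp: unif_approx_by_def intro: rat_id)
next
  case False
  obtain e where e: "e > 0" "(\<Union>x\<in>K. ball x e) \<subseteq> U"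
    using compact_subset_open_imp_ball_epsilon_subset[OF K(1) U(1) K(2)] by blast
  define h where "h = e / 4"
  have h: "h > 0" using e by (simp add: h_def)
  define p where "p x = Complex (of_int (fst x) * h) (of_int (snd x) * h)" for x :: "int \<times> int"
  define up where "up x = (fst x, snd x + 1)" for x :: "int \<times> int"
  define right where "right x = (fst x + 1, snd x)" for x :: "int \<times> int"
  define sq where "sq x = cbox (p x) (p (up (right x)))" for x
  have sq_iff: "w \<in> sq (i, j) \<longleftrightarrow> of_int i * h \<le> Re w \<and> Re w \<le> (of_int i + 1) * h \<and>
      of_int j * h \<le> Im w \<and> Im w \<le> (of_int j + 1) * h" for w i j
    by (auto simp: sq_def p_def up_def right_def in_cbox_complex_iff)
  define S where "S = {x. sq x \<inter> K \<noteq> {}}"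
  have sqU: "sq x \<subseteq> U" if x: "x \<in> S" for x
  proof
    fix w assume w: "w \<in> sq x"
    obtain v where v: "v \<in> sq x" "v \<in> K" using x by (auto simp: S_def)
    obtain i j where ij: "x = (i, j)" by force
    have "\<bar>Re (v - w)\<bar> \<le> h" "\<bar>Im (v - w)\<bar> \<le> h"
      using v(1) w unfolding ij sq_iff by (auto simp: algebra_simps)
    then have "cmod (v - w) \<le> 2 * h" using cmod_le[of "v - w"] by linarith
    then have "w \<in> ball v e" using e(1) by (simp add: dist_norm h_def)
    then show "w \<in> U" using v(2) e(2) by blast
  qed
  have finS: "finite S"
  proof -
    obtain B where B: "\<And>w. w \<in> K \<Longrightarrow> cmod w \<le> B" using compact_imp_bounded[OF K(1)] unfolding bounded_iff by blast
    define N where "N = \<lceil>B / h\<rceil> + 1"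
    have rng: "i \<in> {-N..N}" if "of_int i * h \<le> x" "x \<le> (of_int i + 1) * h" "\<bar>x\<bar> \<le> B" for i x
    proof -
      have "of_int i * h \<le> B" "- B \<le> (of_int i + 1) * h" using that by linarith+
      then have "of_int i \<le> B / h" "- (B / h) \<le> of_int i + 1" using h by (auto simp: field_simps)
      then show ?thesis unfolding N_def by (auto simp: le_ceiling_iff) linarith+
    qed
    have "S \<subseteq> {-N..N} \<times> {-N..N}"
    proof
      fix x assume "x \<in> S"
      then obtain v where v: "v \<in> sq x" "v \<in> K" by (auto simp: S_def)
      obtain i j where ij: "x = (i, j)" by force
      have "\<bar>Re v\<bar> \<le> B" "\<bar>Im v\<bar> \<le> B" using B[OF v(2)] abs_Re_le_cmod[of v] abs_Im_le_cmod[of v] by linarith+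
      then show "x \<in> {-N..N} \<times> {-N..N}" using v(1) rng[of i "Re v"] rng[of j "Im v"] unfolding ij sq_iff by auto
    qed
    then show ?thesis by (rule finite_subset) simp
  qed
  define E where "E u z x = contour_integral (linepath (p x) (p (u x))) (\<lambda>w. f w / (w - z))"
    for u :: "int \<times> int \<Rightarrow> int \<times> int" and z x
  define R where "R z = (((\<Sum>x\<in>S - up ` S. E right z x) - (\<Sum>x\<in>up ` S - S. E right z x))
     - ((\<Sum>x\<in>S - right ` S. E up z x) - (\<Sum>x\<in>right ` S - S. E up z x))) / (2 * of_real pi * \<i>)" for z
  \<comment> \<open>The edge in direction \<open>u\<close> that starts at the corner \<open>t x\<close> separates the squares \<open>x\<close> and \<open>t x\<close>.\<close>
  define dir where "dir = {(up, right), (right, up)}"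
  have inj: "inj t" and surj: "\<exists>y. x = t y" if "(t, u) \<in> dir" for t u x
    using that by (auto simp: dir_def inj_on_def up_def right_def prod_eq_iff) presburger+
  have edge: "closed_segment (p (t x)) (p (u (t x))) \<subseteq> sq x \<inter> sq (t x)" if "(t, u) \<in> dir" for t u x
  proof -
    have "p (t x) \<in> sq x \<inter> sq (t x)" "p (u (t x)) \<in> sq x \<inter> sq (t x)"
      using h that by (auto simp: dir_def sq_def p_def up_def right_def in_cbox_complex_iff algebra_simps)
    then show ?thesis by (intro closed_segment_subset convex_Int) (auto simp: sq_def)
  qed
  have edgeK: "closed_segment (p x) (p (u x)) \<subseteq> U - K"
    if tu: "(t, u) \<in> dir" and x: "x \<in> (S - t ` S) \<union> (t ` S - S)" for t u x
  proof -
    obtain y where y: "x = t y" using surj[OF tu] by blast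
    then have "x \<in> t ` S \<longleftrightarrow> y \<in> S" using inj_image_mem_iff[OF inj[OF tu]] by simp
    then have "x \<in> S \<and> y \<notin> S \<or> y \<in> S \<and> x \<notin> S" using x by auto
    then show ?thesis using edge[OF tu, of y] sqU[of x] sqU[of y] unfolding y S_def by auto
  qed
  have f_cont: "continuous_on X f" if "X \<subseteq> U" for X
    using U(2) that by (meson holomorphic_on_imp_continuous_on holomorphic_on_subset)
  \<comment> \<open>Off the grid lines no edge passes through \<open>z\<close>, and Cauchy's formula applies to each square.\<close>
  have inside: "f z = R z"
    if z: "of_int i0 * h < Re z" "Re z < (of_int i0 + 1) * h" "of_int j0 * h < Im z" "Im z < (of_int j0 + 1) * h"
      and ij0: "(i0, j0) \<in> S" for z i0 j0
  proof -
    have off: "z \<notin> closed_segment (p x) (p (u x))" if tu: "(t, u) \<in> dir" for t u x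
    proof
      assume "z \<in> closed_segment (p x) (p (u x))"
      moreover obtain y where y: "x = t y" using surj[OF tu] by blast
      ultimately have "z \<in> sq y \<inter> sq (t y)" using edge[OF tu] by blast
      moreover obtain i j where "y = (i, j)" by force
      ultimately have "Im z = of_int (j + 1) * h \<or> Re z = of_int (i + 1) * h"
        using tu by (auto simp: dir_def up_def right_def sq_iff algebra_simps)
      moreover have False if "of_int k0 * h < of_int k * h" "of_int k * h < (of_int k0 + 1) * h" for k k0 :: int
      proof -
        have "real_of_int k0 < of_int k" "real_of_int k < of_int (k0 + 1)" using that h by auto
        then have "k0 < k" "k < k0 + 1" by (simp_all only: of_int_less_iff)
        then show False by linarith
      qed
      ultimately show False using z by metis
    qed
    let ?\<phi> = "\<lambda>w. f w / (w - z)"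
    have zbox: "z \<in> box (p (i0, j0)) (p (up (right (i0, j0))))"
      using z by (auto simp: p_def up_def right_def in_box_complex_iff)
    have rect: "contour_integral (rectpath (p x) (p (up (right x)))) ?\<phi>
        = E right z x - E right z (up x) - (E up z x - E up z (right x))" if xS: "x \<in> S" for x
    proof -
      have rp: "rectpath (p x) (p (up (right x))) = linepath (p x) (p (right x)) +++ linepath (p (right x)) (p (up (right x)))
         +++ linepath (p (up (right x))) (p (up x)) +++ linepath (p (up x)) (p x)"
        by (simp add: rectpath_def p_def up_def right_def Let_def)
      have ur: "(up, right) \<in> dir" "(right, up) \<in> dir" by (auto simp: dir_def)
      have rup: "right (up x) = up (right x)" by (simp add: up_def right_def)
      have seg: "closed_segment (p y) (p (u y)) \<subseteq> sq x" if tu: "(t, u) \<in> dir" and y: "y = x \<or> y = t x" for t u y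
        using edge[OF tu, of x] edge[OF tu] surj[OF tu, of x] y by (metis le_inf_iff)
      have cont: "continuous_on (closed_segment (p y) (p (u y))) ?\<phi>"
        if "(t, u) \<in> dir" "y = x \<or> y = t x" for t u y
        using seg[OF that] off[OF that(1), of y] sqU[OF xS] by (intro continuous_intros f_cont) auto
      note cs = cont[OF ur(1), of x] cont[OF ur(1), of "up x"] cont[OF ur(2), of x] cont[OF ur(2), of "right x"]
      note ints = cs[simplified, THEN contour_integrable_continuous_linepath]
      have ints': "?\<phi> contour_integrable_on linepath (p (up (right x))) (p (up x))" "?\<phi> contour_integrable_on linepath (p (up x)) (p x)"
        using cs rup by (auto intro!: contour_integrable_continuous_linepath simp: closed_segment_commute)
      have rev: "contour_integral (linepath (p (up (right x))) (p (up x))) ?\<phi> = - E right z (up x)"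
        "contour_integral (linepath (p (up x)) (p x)) ?\<phi> = - E up z x"
        unfolding E_def rup using cs rup
        by (auto intro!: contour_integral_reverse_linepath simp: closed_segment_commute)
      show ?thesis
        unfolding rp using ints ints' rev by (simp add: contour_integrable_joinI) (simp add: E_def)
    qed
    have val: "contour_integral (rectpath (p x) (p (up (right x)))) ?\<phi> = (if x = (i0, j0) then 2 * of_real pi * \<i> * f z else 0)"
      if xS: "x \<in> S" for x
    proof (cases "x = (i0, j0)")
      case True
      have "(?\<phi> has_contour_integral (2 * pi * \<i> * winding_number (rectpath (p x) (p (up (right x)))) z * f z))
         (rectpath (p x) (p (up (right x))))"
      proof (rule Cauchy_integral_formula_convex_simple)
        show "convex (sq x)" by (simp add: sq_def)
        show "f holomorphic_on sq x" using U(2) sqU[OF xS] by (rule holomorphic_on_subset)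
        show "z \<in> interior (sq x)" using zbox True by (simp add: sq_def interior_cbox)
        show "path_image (rectpath (p x) (p (up (right x)))) \<subseteq> sq x - {z}"
          using path_image_rectpath_cbox_minus_box[of "p x" "p (up (right x))"] h zbox True
          by (auto simp: sq_def p_def up_def right_def)
      qed auto
      then show ?thesis using True winding_number_rectpath[OF zbox] by (auto dest!: contour_integral_unique)
    next
      case False
      obtain i j where ij: "x = (i, j)" by force
      have "z \<notin> sq x"
      proof
        assume "z \<in> sq x"
        then have "of_int i * h < (of_int i0 + 1) * h" "of_int i0 * h < (of_int i + 1) * h"
          "of_int j * h < (of_int j0 + 1) * h" "of_int j0 * h < (of_int j + 1) * h"
          using z unfolding ij sq_iff by linarith+
        then have "real_of_int i < of_int (i0 + 1)" "real_of_int i0 < of_int (i + 1)"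
          "real_of_int j < of_int (j0 + 1)" "real_of_int j0 < of_int (j + 1)" using h by simp_all
        then have "i < i0 + 1" "i0 < i + 1" "j < j0 + 1" "j0 < j + 1" by (simp_all only: of_int_less_iff)
        then show False using False ij by simp
      qed
      then have "?\<phi> holomorphic_on sq x"
        using holomorphic_on_subset[OF U(2) sqU[OF xS]] by (intro holomorphic_intros) auto
      then have "(?\<phi> has_contour_integral 0) (rectpath (p x) (p (up (right x))))"
        using path_image_rectpath_subset_cbox[of "p x" "p (up (right x))"] h
        by (intro Cauchy_theorem_convex_simple[of _ "sq x"]) (auto simp: sq_def p_def up_def right_def)
      then show ?thesis using False by (auto dest: contour_integral_unique)
    qed
    have "2 * of_real pi * \<i> * f z = (\<Sum>x\<in>S. if x = (i0, j0) then 2 * of_real pi * \<i> * f z else 0)"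
      using finS ij0 by simp
    also have "\<dots> = (\<Sum>x\<in>S. E right z x - E right z (up x) - (E up z x - E up z (right x)))"
      by (intro sum.cong refl trans[OF val[symmetric] rect])
    also have "\<dots> = (((\<Sum>x\<in>S. E right z x) - (\<Sum>x\<in>S. E right z (up x))) - ((\<Sum>x\<in>S. E up z x) - (\<Sum>x\<in>S. E up z (right x))))"
      by (simp add: sum_subtractf)
    also have "\<dots> = R z * (2 * of_real pi * \<i>)"
    proof -
      have "inj_on up S" "inj_on right S" by (auto simp: inj_on_def up_def right_def prod_eq_iff)
      then show ?thesis unfolding R_def using sum_shift_cancel[OF finS] by simp
    qed
    finally show ?thesis by simp
  qed
  have fR: "f z = R z" if z: "z \<in> K" for z
  proof -
    define i0 where "i0 = \<lfloor>Re z / h\<rfloor>"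
    define j0 where "j0 = \<lfloor>Im z / h\<rfloor>"
    have fl: "of_int \<lfloor>x / h\<rfloor> * h \<le> x" "x < (of_int \<lfloor>x / h\<rfloor> + 1) * h" for x
    proof -
      have "of_int \<lfloor>x / h\<rfloor> \<le> x / h" "x / h < of_int \<lfloor>x / h\<rfloor> + 1" by linarith+
      then show "of_int \<lfloor>x / h\<rfloor> * h \<le> x" "x < (of_int \<lfloor>x / h\<rfloor> + 1) * h"
        by (simp_all only: pos_le_divide_eq[OF h] pos_divide_less_eq[OF h])
    qed
    have "z \<in> sq (i0, j0)" unfolding sq_iff i0_def j0_def using fl less_imp_le by blast
    then have ij0: "(i0, j0) \<in> S" using z by (auto simp: S_def)
    define t0 where "t0 = min ((of_int i0 + 1) * h - Re z) ((of_int j0 + 1) * h - Im z)"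
    have "t0 > 0" using fl[of "Re z"] fl[of "Im z"] by (simp add: t0_def i0_def j0_def)
    \<comment> \<open>Points slightly to the upper right of \<open>z\<close> lie in the interior of the square \<open>(i0, j0)\<close>.\<close>
    define c where "c t = z + of_real t * Complex 1 1" for t
    have ct: "(c \<longlongrightarrow> z) (at_right 0)"
    proof -
      have "((\<lambda>t. z + of_real t * Complex 1 1) \<longlongrightarrow> z + of_real 0 * Complex 1 1) (at_right 0)"
        by (intro tendsto_intros)
      then show ?thesis by (simp add: c_def[abs_def])
    qed
    have zU: "z \<in> U" using z K by auto
    have "isCont f z" using f_cont[OF order_refl] U(1) zU continuous_on_eq_continuous_at by blast
    then have lim1: "((\<lambda>t. f (c t)) \<longlongrightarrow> f z) (at_right 0)" by (rule isCont_tendsto_compose[OF _ ct])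
    have contE: "isCont (\<lambda>z. E u z x) z" if "(t, u) \<in> dir" "x \<in> (S - t ` S) \<union> (t ` S - S)" for t u x
      unfolding E_def using edgeK[OF that] z by (intro cauchy_integral_continuous f_cont) auto
    have "isCont R z" unfolding R_def
      by (intro continuous_intros contE[where t = up] contE[where t = right]) (auto simp: dir_def)
    then have lim2: "((\<lambda>t. R (c t)) \<longlongrightarrow> R z) (at_right 0)" by (rule isCont_tendsto_compose[OF _ ct])
    have "eventually (\<lambda>t. f (c t) = R (c t)) (at_right 0)"
      unfolding eventually_at_right_field
    proof (intro exI[of _ t0] conjI allI impI)
      fix t :: real assume t: "t > 0" "t < t0"
      show "f (c t) = R (c t)"
      proof (rule inside[OF _ _ _ _ ij0])
        show "of_int i0 * h < Re (c t)" "of_int j0 * h < Im (c t)"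
          using fl[of "Re z"] fl[of "Im z"] t unfolding i0_def j0_def c_def by simp_all
        show "Re (c t) < (of_int i0 + 1) * h" "Im (c t) < (of_int j0 + 1) * h"
          using t unfolding t0_def c_def by simp_all
      qed
    qed (use \<open>t0 > 0\<close> in simp)
    then have "((\<lambda>t. R (c t)) \<longlongrightarrow> f z) (at_right 0)" using lim1 by (simp add: tendsto_cong)
    then show ?thesis using lim2 tendsto_unique trivial_limit_at_right_real by blast
  qed
  have approx_sum: "unif_approx_by K (\<lambda>z. \<Sum>x\<in>X. G z x) (rat_alg (- K))"
    if "finite X" "\<And>x. x \<in> X \<Longrightarrow> unif_approx_by K (\<lambda>z. G z x) (rat_alg (- K))"
    for X :: "(int \<times> int) set" and G
    using that
  proof (induction X rule: finite_induct)
    case empty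
    show ?case using rat_const[of 0] by (auto intro: approx_member)
  next
    case (insert x X)
    have "unif_approx_by K (\<lambda>z. G z x + (\<Sum>x\<in>X. G z x)) (rat_alg (- K))"
      using insert by (intro approx_add rat_add) auto
    then show ?case using insert.hyps by simp
  qed
  have aE: "unif_approx_by K (\<lambda>z. \<Sum>x\<in>X. E u z x) (rat_alg (- K))"
    if tu: "(t, u) \<in> dir" and X: "X \<subseteq> (S - t ` S) \<union> (t ` S - S)" for t u X
  proof (rule approx_sum)
    show "finite X" using X finS finite_subset by blast
    show "unif_approx_by K (\<lambda>z. E u z x) (rat_alg (- K))" if "x \<in> X" for x
      unfolding E_def using edgeK[OF tu, of x] that X by (intro cauchy_integral_approx K(1) f_cont) auto
  qed
  have cmult: "unif_approx_by K (\<lambda>z. k * u z) (rat_alg (- K))" if "unif_approx_by K u (rat_alg (- K))" for k u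
    using bounded_approx_rational[OF that K(1)] approx_member[OF rat_const] that
    by (intro approx_mult[where f = "\<lambda>z. k"] rat_mult) (auto simp: image_constant_conv)
  have diff: "unif_approx_by K (\<lambda>z. u z - v z) (rat_alg (- K))"
    if "unif_approx_by K u (rat_alg (- K))" "unif_approx_by K v (rat_alg (- K))" for u v
  proof -
    have "unif_approx_by K (\<lambda>z. u z + (- 1) * v z) (rat_alg (- K))"
      by (rule approx_add[OF that(1) cmult[OF that(2)]]) (rule rat_add)
    then show ?thesis by simp
  qed
  have "unif_approx_by K (\<lambda>z. 1 / (2 * of_real pi * \<i>) * (((\<Sum>x\<in>S - up ` S. E right z x) - (\<Sum>x\<in>up ` S - S. E right z x))
     - ((\<Sum>x\<in>S - right ` S. E up z x) - (\<Sum>x\<in>right ` S - S. E up z x)))) (rat_alg (- K))"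
    by (intro cmult diff aE[where t = up] aE[where t = right]) (auto simp: dir_def)
  then have "unif_approx_by K R (rat_alg (- K))" by (rule approx_cong) (simp add: R_def)
  then show ?thesis by (rule approx_cong) (simp add: fR)
qed

section \<open>Solving finitely many nonlinear equations by iteration\<close>

text \<open>
  Banach's fixed point theorem on a polydisc whose dimension \<open>card I\<close> is not fixed by a type; convergence is therefore
  shown coordinate by coordinate.
\<close>
lemma contraction_fixpoint_finite:
  fixes \<Psi> :: "('i \<Rightarrow> complex) \<Rightarrow> 'i \<Rightarrow> complex"
  assumes "finite I" "eta > 0"
    and ctr: "\<And>t t' m i. (\<And>i. i \<in> I \<Longrightarrow> cmod (t i) \<le> eta) \<Longrightarrow> (\<And>i. i \<in> I \<Longrightarrow> cmod (t' i) \<le> eta) \<Longrightarrow>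
      (\<And>i. i \<in> I \<Longrightarrow> cmod (t i - t' i) \<le> m) \<Longrightarrow> i \<in> I \<Longrightarrow> cmod (\<Psi> t i - \<Psi> t' i) \<le> m / 2"
    and start: "\<And>i. i \<in> I \<Longrightarrow> cmod (\<Psi> (\<lambda>_. 0) i) \<le> eta / 2"
  obtains t where "\<And>i. i \<in> I \<Longrightarrow> cmod (t i) \<le> eta" "\<And>i. i \<in> I \<Longrightarrow> \<Psi> t i = t i"
proof -
  define x where "x n = (\<Psi> ^^ n) (\<lambda>_. 0)" for n
  have x0: "x 0 = (\<lambda>_. 0)" and xS: "x (Suc n) = \<Psi> (x n)" for n by (simp_all add: x_def)
  have bd: "cmod (x n i) \<le> eta" if "i \<in> I" for n i
    using that
  proof (induction n arbitrary: i)
    case 0 then show ?case using \<open>eta > 0\<close> by (simp add: x0)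
  next
    case (Suc n)
    have "cmod (\<Psi> (x n) i - \<Psi> (\<lambda>_. 0) i) \<le> eta / 2"
      using Suc \<open>eta > 0\<close> by (intro ctr) auto
    then show ?case using start[OF \<open>i \<in> I\<close>] norm_triangle_sub[of "\<Psi> (x n) i" "\<Psi> (\<lambda>_. 0) i"]
      by (simp add: xS)
  qed
  have step: "cmod (x (Suc n) i - x n i) \<le> eta / 2 * (1/2) ^ n" if "i \<in> I" for n i
    using that
  proof (induction n arbitrary: i)
    case 0 then show ?case using start by (simp add: xS x0)
  next
    case (Suc n)
    have "cmod (\<Psi> (x (Suc n)) i - \<Psi> (x n) i) \<le> (eta / 2 * (1/2) ^ n) / 2"
      using Suc bd by (intro ctr) auto
    then show ?case by (simp add: xS)
  qed
  have conv: "convergent (\<lambda>n. x n i)" if "i \<in> I" for i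
  proof -
    have "summable (\<lambda>n. x (Suc n) i - x n i)"
    proof (rule summable_comparison_test')
      show "summable (\<lambda>n. eta / 2 * (1/2::real) ^ n)" by (intro summable_mult summable_geometric) simp
    qed (use step[OF that] in simp)
    then have "convergent (\<lambda>n. \<Sum>k<n. x (Suc k) i - x k i)" by (simp add: summable_iff_convergent)
    moreover have "(\<Sum>k<n. x (Suc k) i - x k i) = x n i" for n
      using sum_lessThan_telescope[of "\<lambda>k. x k i" n] by (simp add: x0)
    ultimately show ?thesis by simp
  qed
  define t where "t i = lim (\<lambda>n. x n i)" for i
  have lim: "(\<lambda>n. x n i) \<longlonglongrightarrow> t i" if "i \<in> I" for i
    using conv[OF that] by (simp add: t_def convergent_LIMSEQ_iff)
  have tb: "cmod (t i) \<le> eta" if "i \<in> I" for i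
    using bd[OF that] by (intro Lim_bounded[OF tendsto_norm[OF lim[OF that]], of 0]) auto
  define m where "m n = (\<Sum>i\<in>I. cmod (t i - x n i))" for n
  have m0: "m \<longlonglongrightarrow> 0"
  proof -
    have "(\<lambda>n. \<Sum>i\<in>I. cmod (t i - x n i)) \<longlonglongrightarrow> (\<Sum>i\<in>I. cmod (t i - t i))"
      by (intro tendsto_intros lim)
    then show ?thesis by (simp add: m_def[abs_def])
  qed
  have "\<Psi> t i = t i" if i: "i \<in> I" for i
  proof -
    have le: "cmod (x (Suc n) i - \<Psi> t i) \<le> m n" for n
    proof -
      have "cmod (\<Psi> t i - \<Psi> (x n) i) \<le> m n / 2"
        using tb bd i \<open>finite I\<close> by (intro ctr) (auto simp: m_def intro: member_le_sum)
      moreover have "m n \<ge> 0" unfolding m_def by (simp add: sum_nonneg)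
      ultimately show ?thesis by (simp add: xS norm_minus_commute)
    qed
    have "(\<lambda>n. x (Suc n) i - \<Psi> t i) \<longlonglongrightarrow> 0"
      by (rule Lim_null_comparison[OF _ m0]) (simp add: le)
    then have "(\<lambda>n. x (Suc n) i) \<longlonglongrightarrow> \<Psi> t i" by (simp add: LIM_zero_iff)
    moreover have "(\<lambda>n. x (Suc n) i) \<longlonglongrightarrow> t i" using LIMSEQ_Suc[OF lim[OF i]] .
    ultimately show ?thesis using LIMSEQ_unique by blast
  qed
  with tb that show ?thesis by blast
qed

lemma exp_linear_remainder:
  fixes x y :: complex
  assumes "cmod x \<le> r" "cmod y \<le> r" "r \<le> 1"
  shows "cmod (exp x - exp y - (x - y)) \<le> 3 * r * cmod (x - y)"
proof -
  have r0: "r \<ge> 0" using assms(1) norm_ge_zero order_trans by blast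
  have e3: "cmod (exp z) \<le> 3" if "z \<in> cball 0 r" for z :: complex
  proof -
    have "cmod (exp z) \<le> exp (cmod z)" by (rule norm_exp)
    also have "\<dots> \<le> exp 1" using that assms(3) by auto
    also have "\<dots> \<le> 3" using exp_le by simp
    finally show ?thesis .
  qed
  have e1: "cmod (exp z - 1) \<le> 3 * r" if "z \<in> cball 0 r" for z :: complex
  proof -
    have "cmod (exp z - exp 0) \<le> 3 * cmod (z - 0)"
      by (rule field_differentiable_bound[of "cball 0 r" exp exp]) (use that e3 r0 in \<open>auto intro!: derivative_eq_intros\<close>)
    then show ?thesis using that by auto
  qed
  have "cmod ((exp x - x) - (exp y - y)) \<le> 3 * r * cmod (x - y)"
    by (rule field_differentiable_bound[of "cball 0 r" "\<lambda>z. exp z - z" "\<lambda>z. exp z - 1"])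
       (use assms e1 in \<open>auto intro!: derivative_eq_intros\<close>)
  then show ?thesis by (simp add: algebra_simps)
qed

text \<open>
  Let \<open>F\<close> be annihilated by finitely many bounded functionals \<open>J k\<close>. The map
  \<open>t \<mapsto> (J k (G exp (\<Sum>j. t j * \<phi> j)))\<close> is small at \<open>0\<close> for \<open>G\<close> near \<open>F\<close>, and its derivative there is near the
  matrix \<open>J k (F \<phi> j)\<close>, which is nearly the identity. Hence \<open>t \<mapsto> t - J (G exp (\<Sum>j. t j * \<phi> j))\<close> is a
  contraction of a small polydisc, and its fixed point is the required zero.
\<close>
lemma kill_functionals_by_exponential:
  fixes J :: "'i \<Rightarrow> (complex \<Rightarrow> complex) \<Rightarrow> complex" and c C eta :: real
  assumes fin: "finite I"
    and lin: "\<And>k f g a b. k \<in> I \<Longrightarrow> continuous_on L f \<Longrightarrow> continuous_on L g \<Longrightarrow>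
       J k (\<lambda>z. a * f z + b * g z) = a * J k f + b * J k g"
    and bnd: "\<And>k f B. k \<in> I \<Longrightarrow> continuous_on L f \<Longrightarrow> (\<And>z. z \<in> L \<Longrightarrow> cmod (f z) \<le> B) \<Longrightarrow> B \<ge> 0 \<Longrightarrow> cmod (J k f) \<le> c * B"
    and c: "c > 0" and C: "C > 0"
    and F: "continuous_on L F" "\<And>z. z \<in> L \<Longrightarrow> cmod (F z) \<le> C"
    and \<phi>: "\<And>j. j \<in> I \<Longrightarrow> continuous_on L (\<phi> j)" "\<And>j z. j \<in> I \<Longrightarrow> z \<in> L \<Longrightarrow> cmod (\<phi> j z) \<le> C"
    and zero: "\<And>k. k \<in> I \<Longrightarrow> J k F = 0"
    and diag: "\<And>k j. k \<in> I \<Longrightarrow> j \<in> I \<Longrightarrow>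
       cmod ((if k = j then 1 else 0) - J k (\<lambda>z. F z * \<phi> j z)) \<le> 1 / (4 * (real (card I) + 1))"
    and "eta > 0"
  shows "\<exists>\<delta>>0. \<forall>G. continuous_on L G \<longrightarrow> (\<forall>z\<in>L. cmod (G z - F z) \<le> \<delta>) \<longrightarrow>
      (\<exists>t. (\<forall>j\<in>I. cmod (t j) \<le> eta) \<and> (\<forall>k\<in>I. J k (\<lambda>z. G z * exp (\<Sum>j\<in>I. t j * \<phi> j z)) = 0))"
proof -
  define N where "N = real (card I) + 1"
  have N: "N \<ge> 1" by (simp add: N_def)
  \<comment> \<open>\<open>x\<close>, \<open>eta0\<close> and \<open>\<delta>\<close> make the remainder of the exponential and the error \<open>G - F\<close> contribute at most \<open>1/8\<close>
      each to the Lipschitz constant; the linear part contributes \<open>1/4\<close>.\<close>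
  define x where "x = min 1 (1 / (8 * c * (C + 1) * (N * C)))"
  have x: "x > 0" "x \<le> 1" "c * (C + 1) * x * (N * C) \<le> 1/8"
  proof -
    have pos: "8 * c * (C + 1) * (N * C) > 0" using c C N by (intro mult_pos_pos) auto
    then show "x > 0" "x \<le> 1" by (auto simp: x_def)
    have "x \<le> 1 / (8 * c * (C + 1) * (N * C))" by (simp add: x_def)
    then have "x * (8 * c * (C + 1) * (N * C)) \<le> 1" using pos by (simp add: pos_le_divide_eq)
    then show "c * (C + 1) * x * (N * C) \<le> 1/8" by (simp add: algebra_simps)
  qed
  define eta0 where "eta0 = min eta (x / (3 * (N * C)))"
  have NC: "N * C > 0" using N C by auto
  have eta0: "eta0 > 0" "eta0 \<le> eta" "3 * (N * C * eta0) \<le> x"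
  proof -
    show "eta0 > 0" "eta0 \<le> eta" using x NC \<open>eta > 0\<close> by (auto simp: eta0_def)
    have "eta0 \<le> x / (3 * (N * C))" by (simp add: eta0_def)
    then show "3 * (N * C * eta0) \<le> x" using NC by (simp add: pos_le_divide_eq algebra_simps)
  qed
  define \<delta> where "\<delta> = min 1 (min (1 / (8 * c * (N * C))) (eta0 / (2 * c)))"
  have \<delta>: "\<delta> > 0" "\<delta> \<le> 1" "c * \<delta> * (N * C) \<le> 1/8" "c * \<delta> \<le> eta0 / 2"
  proof -
    show "\<delta> > 0" "\<delta> \<le> 1" using c NC eta0 by (auto simp: \<delta>_def)
    have "\<delta> \<le> 1 / (8 * c * (N * C))" by (simp add: \<delta>_def)
    moreover have "8 * c * (N * C) > 0" using c NC by simp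
    ultimately have "\<delta> * (8 * c * (N * C)) \<le> 1" by (simp only: pos_le_divide_eq)
    then show "c * \<delta> * (N * C) \<le> 1/8" by (simp add: algebra_simps)
    have "\<delta> \<le> eta0 / (2 * c)" by (simp add: \<delta>_def)
    then show "c * \<delta> \<le> eta0 / 2" using c by (simp add: pos_le_divide_eq algebra_simps)
  qed
  show ?thesis
  proof (rule exI[of _ \<delta>], intro conjI \<delta>(1) allI impI)
    fix G assume G_cont: "continuous_on L G" and G_near: "\<forall>z\<in>L. cmod (G z - F z) \<le> \<delta>"
    have G: "continuous_on L G" "\<And>z. z \<in> L \<Longrightarrow> cmod (G z - F z) \<le> \<delta>" using G_cont G_near by auto
    define u where "u t z = (\<Sum>j\<in>I. t j * \<phi> j z)" for t :: "'i \<Rightarrow> complex" and z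
    define \<Psi> where "\<Psi> t k = t k - J k (\<lambda>z. G z * exp (u t z))" for t k
    have u_cont [continuous_intros]: "continuous_on L (u t)" for t
      unfolding u_def by (intro continuous_intros \<phi>)
    note cont = F(1) G(1) u_cont
    have J_add: "J k (\<lambda>z. f z + g z) = J k f + J k g" if "k \<in> I" "continuous_on L f" "continuous_on L g" for k f g
      using lin[OF that, of 1 1] by simp
    have J_diff: "J k (\<lambda>z. f z - g z) = J k f - J k g" if "k \<in> I" "continuous_on L f" "continuous_on L g" for k f g
      using lin[OF that, of 1 "-1"] by simp
    have J_sum: "J k (\<lambda>z. \<Sum>j\<in>A. a j * f j z) = (\<Sum>j\<in>A. a j * J k (f j))"
      if "finite A" "k \<in> I" "\<And>j. j \<in> A \<Longrightarrow> continuous_on L (f j)" for k A a f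
      using that(1,3)
    proof (induction A rule: finite_induct)
      case empty
      show ?case using lin[OF that(2) F(1) F(1), of 0 0] by simp
    next
      case (insert j A)
      have "J k (\<lambda>z. a j * f j z + 1 * (\<Sum>j\<in>A. a j * f j z)) = a j * J k (f j) + 1 * J k (\<lambda>z. \<Sum>j\<in>A. a j * f j z)"
        using insert.prems by (intro lin[OF that(2)]) (auto intro!: continuous_intros)
      then show ?case using insert by simp
    qed
    have u_bd: "cmod (u t z) \<le> N * C * m" if "\<And>j. j \<in> I \<Longrightarrow> cmod (t j) \<le> m" "z \<in> L" "m \<ge> 0" for t z m
    proof -
      have "cmod (u t z) \<le> (\<Sum>j\<in>I. cmod (t j * \<phi> j z))" unfolding u_def by (rule norm_sum)
      also have "\<dots> \<le> (\<Sum>j\<in>I. m * C)"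
        using that \<phi>(2) by (intro sum_mono) (auto simp: norm_mult intro!: mult_mono)
      also have "\<dots> \<le> N * C * m" using C that(3) by (simp add: N_def algebra_simps)
      finally show ?thesis .
    qed
    have u_diff: "u t z - u t' z = u (\<lambda>j. t j - t' j) z" for t t' z
      by (simp add: u_def sum_subtractf algebra_simps)
    obtain t where t: "\<And>i. i \<in> I \<Longrightarrow> cmod (t i) \<le> eta0" "\<And>i. i \<in> I \<Longrightarrow> \<Psi> t i = t i"
    proof (rule contraction_fixpoint_finite[OF fin eta0(1), of \<Psi>])
      fix t t' m k
      assume t: "\<And>i. i \<in> I \<Longrightarrow> cmod (t i) \<le> eta0" and t': "\<And>i. i \<in> I \<Longrightarrow> cmod (t' i) \<le> eta0"
        and m: "\<And>i. i \<in> I \<Longrightarrow> cmod (t i - t' i) \<le> m" and k: "k \<in> I"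
      have m0: "m \<ge> 0" using m[OF k] norm_ge_zero order_trans by blast
      define w where "w z = u t z - u t' z" for z
      have w_cont: "continuous_on L w" unfolding w_def by (intro continuous_intros)
      have w_bd: "cmod (w z) \<le> N * C * m" if "z \<in> L" for z
        unfolding w_def u_diff by (rule u_bd[OF m that m0])
      define q where "q z = exp (u t z) - exp (u t' z) - w z" for z
      have q_cont: "continuous_on L q" unfolding q_def by (intro continuous_intros w_cont)
      have q_bd: "cmod (q z) \<le> x * (N * C * m)" if "z \<in> L" for z
      proof -
        have "N * C * eta0 \<ge> 0" using NC eta0(1) by simp
        then have "N * C * eta0 \<le> 1" using eta0(3) x(2) by linarith
        then have "cmod (q z) \<le> 3 * (N * C * eta0) * cmod (w z)"
          unfolding q_def w_def using t t' eta0(1) that by (intro exp_linear_remainder u_bd) auto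
        also have "\<dots> \<le> x * (N * C * m)" using eta0(3) w_bd[OF that] x(1) by (intro mult_mono) auto
        finally show ?thesis .
      qed
      have split: "G z * exp (u t z) - G z * exp (u t' z) = F z * w z + ((G z - F z) * w z + G z * q z)" for z
        by (simp add: q_def algebra_simps)
      have "J k (\<lambda>z. G z * exp (u t z)) - J k (\<lambda>z. G z * exp (u t' z))
          = J k (\<lambda>z. F z * w z + ((G z - F z) * w z + G z * q z))"
        unfolding split[symmetric] using k by (intro J_diff[symmetric] continuous_intros cont)
      also have "\<dots> = J k (\<lambda>z. F z * w z) + (J k (\<lambda>z. (G z - F z) * w z) + J k (\<lambda>z. G z * q z))"
        using k by (simp add: J_add continuous_intros cont w_cont q_cont)
      finally have Jd: "J k (\<lambda>z. G z * exp (u t z)) - J k (\<lambda>z. G z * exp (u t' z)) =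
         J k (\<lambda>z. F z * w z) + (J k (\<lambda>z. (G z - F z) * w z) + J k (\<lambda>z. G z * q z))" .
      have "(\<lambda>z. F z * w z) = (\<lambda>z. \<Sum>j\<in>I. (t j - t' j) * (F z * \<phi> j z))"
        by (simp add: fun_eq_iff w_def u_diff) (simp add: u_def sum_distrib_left algebra_simps)
      then have "J k (\<lambda>z. F z * w z) = (\<Sum>j\<in>I. (t j - t' j) * J k (\<lambda>z. F z * \<phi> j z))"
        using k fin by (simp add: J_sum[OF fin k] continuous_intros cont \<phi>)
      moreover have "t k - t' k = (\<Sum>j\<in>I. (t j - t' j) * (if k = j then 1 else 0))"
        using fin k by (simp add: if_distrib[of "\<lambda>x. _ * x"] cong: if_cong)
      ultimately have A: "(t k - t' k) - J k (\<lambda>z. F z * w z)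
          = (\<Sum>j\<in>I. (t j - t' j) * ((if k = j then 1 else 0) - J k (\<lambda>z. F z * \<phi> j z)))"
        by (simp only: right_diff_distrib sum_subtractf)
      have A_bd: "cmod ((t k - t' k) - J k (\<lambda>z. F z * w z)) \<le> m / 4"
      proof -
        have "cmod ((t k - t' k) - J k (\<lambda>z. F z * w z)) \<le>
          (\<Sum>j\<in>I. cmod ((t j - t' j) * ((if k = j then 1 else 0) - J k (\<lambda>z. F z * \<phi> j z))))"
          unfolding A by (rule norm_sum)
        also have "\<dots> \<le> (\<Sum>j\<in>I. m * (1 / (4 * N)))"
          unfolding norm_mult N_def using m diag[OF k] m0 by (intro sum_mono mult_mono) auto
        also have "\<dots> \<le> m / 4" using m0 N by (simp add: N_def divide_simps) (simp add: algebra_simps)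
        finally show ?thesis .
      qed
      have B_bd: "cmod (J k (\<lambda>z. (G z - F z) * w z)) \<le> m / 8"
      proof -
        have "cmod (J k (\<lambda>z. (G z - F z) * w z)) \<le> c * (\<delta> * (N * C * m))"
          using k \<delta>(1) N C m0 by (intro bnd) (auto simp: norm_mult intro!: continuous_intros cont w_cont mult_mono G w_bd)
        also have "\<dots> = (c * \<delta> * (N * C)) * m" by (simp add: algebra_simps)
        also have "\<dots> \<le> 1/8 * m" using \<delta>(3) m0 by (intro mult_right_mono) auto
        finally show ?thesis by simp
      qed
      have C_bd: "cmod (J k (\<lambda>z. G z * q z)) \<le> m / 8"
      proof -
        have Gb: "cmod (G z) \<le> C + 1" if "z \<in> L" for z
          using norm_triangle_sub[of "G z" "F z"] G(2)[OF that] F(2)[OF that] \<delta>(2) by linarith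
        have "cmod (J k (\<lambda>z. G z * q z)) \<le> c * ((C + 1) * (x * (N * C * m)))"
          using k x(1) N C m0 Gb q_bd by (intro bnd) (auto simp: norm_mult intro!: continuous_intros cont q_cont mult_mono)
        also have "\<dots> = (c * (C + 1) * x * (N * C)) * m" by (simp add: algebra_simps)
        also have "\<dots> \<le> 1/8 * m" using x(3) m0 by (intro mult_right_mono) auto
        finally show ?thesis by simp
      qed
      have "\<Psi> t k - \<Psi> t' k = ((t k - t' k) - J k (\<lambda>z. F z * w z)) - (J k (\<lambda>z. (G z - F z) * w z) + J k (\<lambda>z. G z * q z))"
        using Jd by (simp add: \<Psi>_def algebra_simps)
      also have "cmod \<dots> \<le> m / 4 + (m / 8 + m / 8)"
        using A_bd B_bd C_bd by (smt (verit) norm_triangle_ineq norm_triangle_ineq4)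
      finally show "cmod (\<Psi> t k - \<Psi> t' k) \<le> m / 2" by simp
    next
      fix k assume k: "k \<in> I"
      have "J k G = J k (\<lambda>z. G z - F z)" using zero[OF k] J_diff[OF k G(1) F(1)] by simp
      moreover have "cmod (J k (\<lambda>z. G z - F z)) \<le> c * \<delta>"
        using k \<delta>(1) by (intro bnd) (auto intro!: continuous_intros cont G)
      ultimately show "cmod (\<Psi> (\<lambda>_. 0) k) \<le> eta0 / 2"
        using \<delta>(4) by (simp add: \<Psi>_def u_def)
    qed (rule that)
    show "\<exists>t. (\<forall>j\<in>I. cmod (t j) \<le> eta) \<and> (\<forall>k\<in>I. J k (\<lambda>z. G z * exp (\<Sum>j\<in>I. t j * \<phi> j z)) = 0)"
      using t eta0(2) by (intro exI[of _ t]) (fastforce simp: \<Psi>_def u_def)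
  qed
qed

section \<open>Primitives\<close>

text \<open>By the residue theorem path integrals in the complement of \<open>T\<close> depend on the end points only.\<close>
lemma primitive_of_zero_residues:
  assumes "finite T" and hol: "F holomorphic_on - T" and res: "\<And>p. p \<in> T \<Longrightarrow> residue F p = 0"
  obtains g where "\<And>z. z \<notin> T \<Longrightarrow> (g has_field_derivative F z) (at z)"
proof -
  have op: "open (- T)" using \<open>finite T\<close> by (simp add: finite_imp_closed open_Compl)
  have con: "connected (- T)"
    using connected_open_delete_finite[of "UNIV :: complex set" T] \<open>finite T\<close>
    by (simp add: Compl_eq_Diff_UNIV connected_UNIV)
  have loop: "contour_integral \<gamma> F = 0"
    if "valid_path \<gamma>" "pathfinish \<gamma> = pathstart \<gamma>" "path_image \<gamma> \<subseteq> - T" for \<gamma>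
    using Residue_theorem[of UNIV T F \<gamma>] that assms by (simp add: Compl_eq_Diff_UNIV connected_UNIV)
  have int: "F contour_integrable_on \<gamma>" if "valid_path \<gamma>" "path_image \<gamma> \<subseteq> - T" for \<gamma>
    by (rule contour_integrable_holomorphic_simple[OF hol op that])
  obtain a where a: "a \<in> - T"
    using \<open>finite T\<close> infinite_UNIV_char_0 by (metis ComplI ex_new_if_finite)
  define P where "P z \<gamma> \<longleftrightarrow> valid_path \<gamma> \<and> path_image \<gamma> \<subseteq> - T \<and> pathstart \<gamma> = a \<and> pathfinish \<gamma> = z" for z \<gamma>
  have ex: "\<exists>\<gamma>. P z \<gamma>" if "z \<in> - T" for z
    using connected_open_polynomial_connected[OF op con a that] unfolding P_def
    by (metis valid_path_polynomial_function)
  define p where "p z = (SOME \<gamma>. P z \<gamma>)" for z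
  have p: "P z (p z)" if "z \<in> - T" for z unfolding p_def by (rule someI_ex[OF ex[OF that]])
  define g where "g z = contour_integral (p z) F" for z
  have "(g has_field_derivative F z) (at z)" if z: "z \<notin> T" for z
  proof -
    obtain e where e: "e > 0" "ball z e \<subseteq> - T" using op z open_contains_ball by (metis ComplI)
    obtain h where h: "\<And>w. w \<in> ball z e \<Longrightarrow> (h has_field_derivative F w) (at w)"
    proof -
      have "F holomorphic_on ball z e" using hol e(2) holomorphic_on_subset by blast
      then obtain h where "\<And>w. w \<in> ball z e \<Longrightarrow> (h has_field_derivative F w) (at w within ball z e)"
        using holomorphic_convex_primitive'[of "ball z e" F] by auto
      then show ?thesis using that by (metis at_within_open open_ball)
    qed
    have eq: "g w = h w + (g z - h z)" if w: "w \<in> ball z e" for w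
    proof -
      have seg: "closed_segment z w \<subseteq> ball z e"
        using w e(1) by (intro closed_segment_subset) auto
      have lin: "contour_integral (linepath z w) F = h w - h z"
        using contour_integral_primitive[of "ball z e" h F "linepath z w"] h seg
        by (auto intro: contour_integral_unique has_field_derivative_at_within)
      have pz: "P z (p z)" "P w (p w)" using p z w e(2) by auto
      define \<gamma> where "\<gamma> = (p z +++ linepath z w) +++ reversepath (p w)"
      have \<gamma>: "valid_path \<gamma>" "pathfinish \<gamma> = pathstart \<gamma>" "path_image \<gamma> \<subseteq> - T"
        using pz seg e(2) unfolding \<gamma>_def P_def
        by (auto intro!: valid_path_join simp: path_image_reversepath path_image_join)
      have "0 = contour_integral \<gamma> F" using loop \<gamma> by simp
      also have "\<dots> = contour_integral (p z) F + contour_integral (linepath z w) F - contour_integral (p w) F"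
      proof -
        have i: "F contour_integrable_on p z" "F contour_integrable_on p w" "F contour_integrable_on linepath z w"
          using pz seg e(2) by (auto intro!: int simp: P_def)
        show ?thesis using pz i unfolding \<gamma>_def P_def
          by (simp add: contour_integrable_reversepath contour_integrable_joinI valid_path_join contour_integral_reversepath)
      qed
      finally show ?thesis using lin by (simp add: g_def algebra_simps)
    qed
    have "((\<lambda>w. h w + (g z - h z)) has_field_derivative F z) (at z)"
      using h[of z] e(1) by (auto intro!: derivative_eq_intros)
    then show ?thesis
      by (rule has_field_derivative_transform_within_open[OF _ open_ball, of _ _ _ z e])
         (use e(1) in simp, rule eq[symmetric])
  qed
  with that show ?thesis by blast
qed

text \<open>
  A bound for the derivative on a sufficiently large compact subset controls the oscillation of a primitive.
  The pairs of points for which this holds form an equivalence relation with open classes, because it holds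
  on discs; so all points of the connected set \<open>V\<close> are equivalent, and compactness makes the estimate uniform.
\<close>
lemma primitive_control:
  assumes V: "open V" "connected V" and L0: "compact L0" "L0 \<subseteq> V" and z0: "z0 \<in> V"
  obtains L M where "compact L" "L \<subseteq> V" "M > 0"
    "\<And>h h' \<delta>. (\<And>z. z \<in> V \<Longrightarrow> (h has_field_derivative h' z) (at z)) \<Longrightarrow> \<delta> \<ge> 0 \<Longrightarrow>
       (\<And>z. z \<in> L \<Longrightarrow> cmod (h' z) \<le> \<delta>) \<Longrightarrow> (\<forall>z\<in>L0. cmod (h z - h z0) \<le> M * \<delta>)"
proof -
  define ctl where "ctl X x L M \<longleftrightarrow> compact L \<and> L \<subseteq> V \<and> M > 0 \<and>
    (\<forall>h h' \<delta>. (\<forall>z\<in>V. (h has_field_derivative h' z) (at z)) \<longrightarrow> \<delta> \<ge> 0 \<longrightarrow>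
       (\<forall>z\<in>L. cmod (h' z) \<le> \<delta>) \<longrightarrow> (\<forall>z\<in>X. cmod (h z - h x) \<le> M * \<delta>))" for X x L M
  have ctlD: "cmod (h z - h x) \<le> M * \<delta>" if "ctl X x L M" "\<And>z. z \<in> V \<Longrightarrow> (h has_field_derivative h' z) (at z)"
    "\<delta> \<ge> 0" "\<And>z. z \<in> L \<Longrightarrow> cmod (h' z) \<le> \<delta>" "z \<in> X" for X x L M h h' \<delta> z
    using that unfolding ctl_def by blast
  have mono: "ctl Y x L M" if "ctl X x L M" "Y \<subseteq> X" for X Y x L M
    unfolding ctl_def
  proof (intro conjI allI impI ballI)
    fix h h' \<delta> z assume h: "\<forall>z\<in>V. (h has_field_derivative h' z) (at z)" "\<delta> \<ge> (0::real)"
      "\<forall>z\<in>L. cmod (h' z) \<le> \<delta>" "z \<in> Y"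
    then show "cmod (h z - h x) \<le> M * \<delta>"
      using that(2) by (intro ctlD[OF that(1), of h h' \<delta> z]) auto
  qed (use that(1) in \<open>auto simp: ctl_def\<close>)
  have ball: "ctl (cball x r) x (cball x r) r" if "cball x r \<subseteq> V" "r > 0" for x r
    unfolding ctl_def
  proof (intro conjI allI impI ballI)
    fix h h' \<delta> z assume h: "\<forall>z\<in>V. (h has_field_derivative h' z) (at z)" "\<delta> \<ge> (0::real)"
      "\<forall>z\<in>cball x r. cmod (h' z) \<le> \<delta>" "z \<in> cball x r"
    have "(h has_field_derivative h' y) (at y within cball x r)" if "y \<in> cball x r" for y
      using h(1) that \<open>cball x r \<subseteq> V\<close> by (meson has_field_derivative_at_within subsetD)
    then have "cmod (h z - h x) \<le> \<delta> * cmod (z - x)"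
      using h that by (intro field_differentiable_bound[of "cball x r" h h']) auto
    also have "\<dots> \<le> \<delta> * r" using h by (intro mult_left_mono) (auto simp: dist_norm norm_minus_commute)
    finally show "cmod (h z - h x) \<le> r * \<delta>" by (simp add: mult.commute)
  qed (use that in auto)
  have trans: "ctl X x (L \<union> L') (M + M')" if "ctl X y L M" "ctl {y} x L' M'" for X x y L M L' M'
    unfolding ctl_def
  proof (intro conjI allI impI ballI)
    fix h h' \<delta> z assume h: "\<forall>z\<in>V. (h has_field_derivative h' z) (at z)" "\<delta> \<ge> (0::real)"
      "\<forall>z\<in>L \<union> L'. cmod (h' z) \<le> \<delta>" "z \<in> X"
    have "cmod (h z - h y) \<le> M * \<delta>" "cmod (h y - h x) \<le> M' * \<delta>"
      using h ctlD[OF that(1), of h h' \<delta> z] ctlD[OF that(2), of h h' \<delta> y] by auto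
    then show "cmod (h z - h x) \<le> (M + M') * \<delta>"
      using norm_triangle_ineq[of "h z - h y" "h y - h x"] by (simp add: algebra_simps)
  qed (use that in \<open>auto simp: ctl_def\<close>)
  have point: "\<exists>L M. ctl {x} z0 L M" if "x \<in> V" for x
  proof (rule connected_equivalence_relation[OF V(2) that z0, of "\<lambda>x y. \<exists>L M. ctl {x} y L M"])
    fix x y assume "\<exists>L M. ctl {x} y L M"
    then show "\<exists>L M. ctl {y} x L M" unfolding ctl_def by (auto simp: norm_minus_commute)
  next
    fix x y z assume "\<exists>L M. ctl {x} y L M" "\<exists>L M. ctl {y} z L M"
    then show "\<exists>L M. ctl {x} z L M" using trans by blast
  next
    fix a assume "a \<in> V"
    then obtain r where r: "r > 0" "cball a r \<subseteq> V" using V(1) open_contains_cball by blast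
    show "\<exists>T. openin (top_of_set V) T \<and> a \<in> T \<and> (\<forall>x\<in>T. \<exists>L M. ctl {a} x L M)"
    proof (rule exI[of _ "ball a r"], intro conjI ballI)
      show "openin (top_of_set V) (ball a r)"
        using r ball_subset_cball by (intro open_subset) blast+
      fix x assume x: "x \<in> ball a r"
      have "ctl {a} x (cball a r) r"
        using ball[OF r(2,1)] x unfolding ctl_def
        by (smt (verit, best) ball_subset_cball norm_minus_commute singletonD subsetD)
      then show "\<exists>L M. ctl {a} x L M" by blast
    qed (use r in auto)
  qed
  have "\<exists>r L M. r > 0 \<and> ctl (ball x r) z0 L M" if xV: "x \<in> V" for x
  proof -
    obtain r where r: "r > 0" "cball x r \<subseteq> V" using V(1) xV open_contains_cball by blast
    obtain L M where "ctl {x} z0 L M" using point[OF xV] by blast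
    then have "ctl (cball x r) z0 (cball x r \<union> L) (r + M)" by (rule trans[OF ball[OF r(2,1)]])
    then have "ctl (ball x r) z0 (cball x r \<union> L) (r + M)"
      by (rule mono) (rule ball_subset_cball)
    then show ?thesis using r(1) by (intro exI conjI)
  qed
  then obtain r L M where rLM: "\<And>x. x \<in> V \<Longrightarrow> r x > 0 \<and> ctl (ball x (r x)) z0 (L x) (M x)" by metis
  obtain D where D: "D \<subseteq> L0" "finite D" "L0 \<subseteq> (\<Union>x\<in>D. ball x (r x))"
  proof (rule compactE_image[OF L0(1), of L0 "\<lambda>x. ball x (r x)"])
    show "L0 \<subseteq> (\<Union>x\<in>L0. ball x (r x))" using rLM L0(2) by fastforce
  qed auto
  have DV: "x \<in> V" if "x \<in> D" for x using that D L0 by auto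
  show ?thesis
  proof (rule that[of "\<Union>x\<in>D. L x" "(\<Sum>x\<in>D. M x) + 1"])
    show "compact (\<Union>x\<in>D. L x)" using D(2) rLM DV unfolding ctl_def by (intro compact_UN) auto
    show "(\<Union>x\<in>D. L x) \<subseteq> V" using rLM DV unfolding ctl_def by blast
    have Mpos: "M x > 0" if "x \<in> D" for x using rLM[OF DV[OF that]] unfolding ctl_def by blast
    then show "(\<Sum>x\<in>D. M x) + 1 > 0" by (intro add_nonneg_pos sum_nonneg) (auto intro: less_imp_le)
    fix h h' and \<delta> :: real
    assume h: "\<And>z. z \<in> V \<Longrightarrow> (h has_field_derivative h' z) (at z)" "\<delta> \<ge> 0"
      "\<And>z. z \<in> (\<Union>x\<in>D. L x) \<Longrightarrow> cmod (h' z) \<le> \<delta>"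
    show "\<forall>z\<in>L0. cmod (h z - h z0) \<le> ((\<Sum>x\<in>D. M x) + 1) * \<delta>"
    proof
      fix z assume "z \<in> L0"
      then obtain x where x: "x \<in> D" "z \<in> ball x (r x)" using D(3) by blast
      have "cmod (h z - h z0) \<le> M x * \<delta>"
        using rLM[OF DV[OF x(1)]] h x by (intro ctlD[of "ball x (r x)" z0 "L x" "M x" h h']) auto
      also have "\<dots> \<le> ((\<Sum>x\<in>D. M x) + 1) * \<delta>"
      proof (intro mult_right_mono h(2))
        have "M x \<le> (\<Sum>x\<in>D. M x)"
          using x(1) D(2) Mpos by (intro member_le_sum) (auto intro: less_imp_le)
        then show "M x \<le> (\<Sum>x\<in>D. M x) + 1" by simp
      qed
      finally show "cmod (h z - h z0) \<le> ((\<Sum>x\<in>D. M x) + 1) * \<delta>" .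
    qed
  qed
qed

section \<open>Moving singularities of locally univalent functions\<close>

text \<open>
  Locally univalent functions on the plane with exceptional set \<open>S\<close> and simple poles at \<open>A\<close>. The existence of
  the primitive \<open>g\<close> forces the residues of its derivative at \<open>A\<close> to vanish, which is why a double pole of the
  derivative is a simple pole of \<open>g\<close>. Values at points of \<open>A\<close> are left open.
\<close>
definition lu_class :: "complex set \<Rightarrow> complex set \<Rightarrow> (complex \<Rightarrow> complex) set" where
  "lu_class S A = {g. \<exists>F\<in>zero_free S. \<forall>z. z \<notin> S \<union> A \<longrightarrow>
      (g has_field_derivative F z / (\<Prod>a\<in>A. (z - a)\<^sup>2)) (at z)}"

lemma circle_functional:
  fixes r :: "complex \<Rightarrow> real"
  defines "J \<equiv> \<lambda>k f. contour_integral (circlepath k (r k)) f / (2 * of_real pi * \<i>)"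
  assumes r: "\<And>k. k \<in> I \<Longrightarrow> r k > 0 \<and> sphere k (r k) \<subseteq> L" and "finite I"
  shows "k \<in> I \<Longrightarrow> continuous_on L f \<Longrightarrow> continuous_on L g \<Longrightarrow>
       J k (\<lambda>z. a * f z + b * g z) = a * J k f + b * J k g"
    and "k \<in> I \<Longrightarrow> continuous_on L f \<Longrightarrow> (\<And>z. z \<in> L \<Longrightarrow> cmod (f z) \<le> B) \<Longrightarrow> B \<ge> 0 \<Longrightarrow>
       cmod (J k f) \<le> (1 + (\<Sum>k\<in>I. r k)) * B"
proof -
  assume k: "k \<in> I" and f: "continuous_on L f"
  have sub: "path_image (circlepath k (r k)) \<subseteq> L" using r[OF k] by (auto simp: path_image_circlepath)
  have int: "h contour_integrable_on circlepath k (r k)" if "continuous_on L h" for h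
    using continuous_on_subset[OF that sub] by (rule contour_integrable_continuous_circlepath)
  { assume g: "continuous_on L g"
    show "J k (\<lambda>z. a * f z + b * g z) = a * J k f + b * J k g"
      unfolding J_def using int[OF f] int[OF g]
      by (simp add: contour_integral_add contour_integral_lmul contour_integrable_lmul add_divide_distrib)
  }
  { assume B: "\<And>z. z \<in> L \<Longrightarrow> cmod (f z) \<le> B" "B \<ge> 0"
    have "cmod (contour_integral (circlepath k (r k)) f) \<le> B * (2 * pi * r k)"
    proof (rule has_contour_integral_bound_circlepath[OF has_contour_integral_integral[OF int[OF f]] B(2)])
      show "r k > 0" using r[OF k] by auto
      fix x assume "cmod (x - k) = r k"
      then have "x \<in> L" using r[OF k] by (auto simp: dist_norm norm_minus_commute)
      then show "cmod (f x) \<le> B" by (rule B)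
    qed
    then have "cmod (J k f) \<le> r k * B"
      unfolding J_def by (simp add: norm_divide norm_mult field_simps)
    also have "r k \<le> (\<Sum>k\<in>I. r k)"
      using k \<open>finite I\<close> r by (intro member_le_sum) (auto intro: less_imp_le)
    then have "r k * B \<le> (1 + (\<Sum>k\<in>I. r k)) * B" using B(2) by (intro mult_right_mono) auto
    finally show "cmod (J k f) \<le> (1 + (\<Sum>k\<in>I. r k)) * B" .
  }
qed

lemma circle_functional_pole:
  assumes "r > 0" "j \<noteq> k \<Longrightarrow> j \<notin> cball k r"
  shows "contour_integral (circlepath k r) (\<lambda>z. 1 / (z - j)) / (2 * of_real pi * \<i>) = (if k = j then 1 else 0)"
proof (cases "k = j")
  case True
  then show ?thesis using contour_integral_circlepath[OF assms(1), of k] by simp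
next
  case False
  then have "((\<lambda>z. 1 / (z - j)) has_contour_integral 0) (circlepath k r)"
    using assms by (intro Cauchy_theorem_convex_simple[of _ "cball k r"]) (auto intro!: holomorphic_intros)
  then show ?thesis using False contour_integral_unique by force
qed

text \<open>
  The exceptional set \<open>S\<close> is replaced by \<open>S'\<close>. Approximating the derivative by functions with singularities in
  \<open>S'\<close> destroys its integrability; the residues at \<open>S' \<union> A\<close> are measured by circles inside \<open>V\<close> and
  corrected by an exponential factor. A circle around a point of \<open>S'\<close> may enclose several points of \<open>S\<close>, which
  happens when these are merged into one.
\<close>
lemma lu_class_approx:
  assumes fin: "finite S" "finite S'" "finite A"
    and V: "open V" "connected V" "z0 \<in> V" "V \<inter> (S \<union> S' \<union> A) = {}"
    and circ: "\<And>b. b \<in> S' \<union> A \<Longrightarrow> \<exists>r>0. sphere b r \<subseteq> V \<and> cball b r \<inter> (S' \<union> A) = {b}"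
    and lin: "\<And>L s. compact L \<Longrightarrow> L \<subseteq> V \<Longrightarrow> s \<in> S \<Longrightarrow> unif_approx_by L (\<lambda>z. z - s) (zero_free S')"
    and g: "g \<in> lu_class S A" and L0: "compact L0" "L0 \<subseteq> V" and "eps > 0"
  obtains g' where "g' \<in> lu_class S' A" "\<And>z. z \<in> L0 \<Longrightarrow> cmod (g z - g' z) < eps"
proof -
  from circ obtain r where r: "\<And>b. b \<in> S' \<union> A \<Longrightarrow> r b > 0 \<and> sphere b (r b) \<subseteq> V \<and> cball b (r b) \<inter> (S' \<union> A) = {b}"
    by metis
  define P where "P z = (\<Prod>a\<in>A. (z - a)\<^sup>2)" for z :: complex
  define I where "I = S' \<union> A"
  have finI: "finite I" using fin by (simp add: I_def)
  obtain F0 where F0: "F0 \<in> zero_free S" "\<And>z. z \<notin> S \<union> A \<Longrightarrow> (g has_field_derivative F0 z / P z) (at z)"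
    using g unfolding lu_class_def P_def by blast
  define F where "F z = F0 z / P z" for z
  obtain L1 M where L1: "compact L1" "L1 \<subseteq> V" "M > 0"
    "\<And>h h' \<delta>. (\<And>z. z \<in> V \<Longrightarrow> (h has_field_derivative h' z) (at z)) \<Longrightarrow> \<delta> \<ge> 0 \<Longrightarrow>
       (\<And>z. z \<in> L1 \<Longrightarrow> cmod (h' z) \<le> \<delta>) \<Longrightarrow> (\<forall>z\<in>L0. cmod (h z - h z0) \<le> M * \<delta>)"
    using primitive_control[OF V(1,2) L0 V(3)] by blast
  define L where "L = L1 \<union> (\<Union>b\<in>I. sphere b (r b))"
  have L: "compact L" "L \<subseteq> V"
  proof -
    show "compact L" unfolding L_def using finI by (intro compact_Un L1(1) compact_UN) auto
    show "L \<subseteq> V" unfolding L_def I_def using L1(2) r by (intro Un_least UN_least) auto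
  qed
  have LS: "L \<inter> S = {}" "L \<inter> S' = {}" "L \<inter> A = {}" "L \<inter> I = {}" using L(2) V(4) by (auto simp: I_def)
  have P_nz: "P z \<noteq> 0" if "z \<in> L" for z using that LS fin by (auto simp: P_def)
  have F0_nz: "F0 z \<noteq> 0" if "z \<in> L" for z using zero_free_nonzero[OF F0(1)] that LS by blast
  have P_cont [continuous_intros]: "continuous_on X P" for X unfolding P_def by (intro continuous_intros)
  have zf_cont: "continuous_on L f" if "f \<in> zero_free S \<or> f \<in> zero_free S'" for f
    using that zero_free_holomorphic[of f] LS
    by (metis disjoint_eq_subset_Compl holomorphic_on_imp_continuous_on holomorphic_on_subset)
  have alg_cont: "continuous_on L f" if "f \<in> rat_alg S'" for f
    using that rat_alg_holomorphic[of f] LS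
    by (metis disjoint_eq_subset_Compl holomorphic_on_imp_continuous_on holomorphic_on_subset)
  have bdd: "bounded (f ` L)" if "continuous_on L f" for f :: "complex \<Rightarrow> complex"
    using that L(1) compact_continuous_image compact_imp_bounded by blast
  have F_cont: "continuous_on L F"
    unfolding F_def using P_nz zf_cont F0(1) by (auto intro!: continuous_intros)
  obtain C1 where C1: "C1 > 0" "\<And>z. z \<in> L \<Longrightarrow> cmod (F z) \<le> C1"
    using bdd[OF F_cont] unfolding bounded_pos by auto
  define J where "J k f = contour_integral (circlepath k (r k)) f / (2 * of_real pi * \<i>)" for k f
  define c where "c = 1 + (\<Sum>k\<in>I. r k)"
  have rI: "r k > 0 \<and> sphere k (r k) \<subseteq> L" if "k \<in> I" for k
    using r that by (auto simp: L_def I_def)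
  have J_lin: "J k (\<lambda>z. a * f z + b * h z) = a * J k f + b * J k h"
    if "k \<in> I" "continuous_on L f" "continuous_on L h" for k f h a b
    unfolding J_def by (rule circle_functional(1)[OF rI finI that])
  have J_bnd: "cmod (J k f) \<le> c * B"
    if "k \<in> I" "continuous_on L f" "\<And>z. z \<in> L \<Longrightarrow> cmod (f z) \<le> B" "B \<ge> 0" for k f B
    unfolding J_def c_def by (rule circle_functional(2)[OF rI finI that])
  have c: "c > 0" unfolding c_def using rI by (intro add_pos_nonneg sum_nonneg) (auto intro: less_imp_le)
  have J_cong: "J k f = J k h" if "k \<in> I" "\<And>z. z \<in> L \<Longrightarrow> f z = h z" for k f h
  proof -
    have "contour_integral (circlepath k (r k)) f = contour_integral (circlepath k (r k)) h"
      using rI[OF that(1)] that(2) by (intro contour_integral_cong) (auto simp: path_image_circlepath)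
    then show ?thesis by (simp add: J_def)
  qed
  \<comment> \<open>\<open>F z * H j z = 1 / (z - j)\<close>, so multiplying \<open>F\<close> by \<open>H j\<close> produces residue \<open>1\<close> at \<open>j\<close> and no other residue;
      for \<open>j \<in> A\<close> the double pole of \<open>F\<close> makes \<open>H j\<close> holomorphic at \<open>j\<close>.\<close>
  define e1 where "e1 = 1 / (4 * (real (card I) + 1)) / (c * C1)"
  have e1: "e1 > 0" "c * (C1 * e1) = 1 / (4 * (real (card I) + 1))"     using c C1(1) by (auto simp: e1_def intro!: divide_pos_pos add_nonneg_pos)
  define H where "H j z = P z / (z - j) * (1 / F0 z)" for j z
  have H_cont: "continuous_on L (H j)" if "j \<in> I" for j
    unfolding H_def using F0_nz zf_cont F0(1) that LS by (auto intro!: continuous_intros)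
  have "unif_approx_by L (H j) (rat_alg S')" if j: "j \<in> I" for j
    unfolding H_def
  proof (rule approx_mult)
    show "unif_approx_by L (\<lambda>z. 1 / F0 z) (rat_alg S')"
    proof (rule approx_trans)
      show "unif_approx_by L (\<lambda>z. 1 / F0 z) (zero_free S')"
        by (rule zero_free_approx_transfer[OF zero_free_inverse[OF F0(1)] L(1) LS(1,2) lin[OF L]])
      show "unif_approx_by L f (rat_alg S')" if "f \<in> zero_free S'" for f
        by (rule zero_free_approx_rational[OF that L(1) LS(2)])
    qed
    show "unif_approx_by L (\<lambda>z. P z / (z - j)) (rat_alg S')"
    proof (cases "j \<in> A")
      case True
      have "unif_approx_by L (\<lambda>z. (z - j) * (\<Prod>a\<in>A - {j}. (z - a)\<^sup>2)) (rat_alg S')"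
        by (intro approx_member rat_mult rat_alg_prod rat_alg_power rat_alg_diff_const)
      then show ?thesis
      proof (rule approx_cong)
        fix z assume "z \<in> L"
        then have "z \<noteq> j" using LS j by auto
        moreover have "P z = (z - j)\<^sup>2 * (\<Prod>a\<in>A - {j}. (z - a)\<^sup>2)"
          unfolding P_def using prod.remove[OF fin(3) True] by simp
        ultimately show "(z - j) * (\<Prod>a\<in>A - {j}. (z - a)\<^sup>2) = P z / (z - j)"
          by (simp add: power2_eq_square)
      qed
    next
      case False
      then have "j \<in> S'" using j by (simp add: I_def)
      then have "unif_approx_by L (\<lambda>z. P z * (1 / (z - j))) (rat_alg S')"
        unfolding P_def by (intro approx_member rat_mult rat_alg_prod rat_alg_power rat_alg_diff_const rat_pole)
      then show ?thesis by simp
    qed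
    show "bounded ((\<lambda>z. P z / (z - j)) ` L)" using LS j by (intro bdd continuous_intros) auto
    show "bounded ((\<lambda>z. 1 / F0 z) ` L)" using F0_nz zf_cont F0(1) by (intro bdd continuous_intros) auto
  qed (rule rat_mult)
  then have "\<forall>j\<in>I. \<exists>f\<in>rat_alg S'. \<forall>z\<in>L. cmod (H j z - f z) < e1"
    unfolding unif_approx_by_def using e1(1) by blast
  then obtain \<phi> where \<phi>: "\<And>j. j \<in> I \<Longrightarrow> \<phi> j \<in> rat_alg S'"
     "\<And>j z. j \<in> I \<Longrightarrow> z \<in> L \<Longrightarrow> cmod (H j z - \<phi> j z) < e1" by metis
  have \<phi>_cont: "continuous_on L (\<phi> j)" if "j \<in> I" for j using alg_cont \<phi>(1)[OF that] .
  have FH: "F z * H j z = 1 / (z - j)" if "z \<in> L" "j \<in> I" for z j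
    using P_nz[OF that(1)] F0_nz[OF that(1)] that LS by (auto simp: F_def H_def)
  have diag: "cmod ((if k = j then 1 else 0) - J k (\<lambda>z. F z * \<phi> j z)) \<le> 1 / (4 * (real (card I) + 1))"
    if k: "k \<in> I" and j: "j \<in> I" for k j
  proof -
    have "J k (\<lambda>z. F z * H j z) = J k (\<lambda>z. 1 / (z - j))" by (rule J_cong[OF k FH[OF _ j]])
    also have "\<dots> = (if k = j then 1 else 0)"
      unfolding J_def
    proof (rule circle_functional_pole)
      have "cball k (r k) \<inter> I = {k}" using r k by (simp add: I_def)
      then show "j \<notin> cball k (r k)" if "j \<noteq> k" using j that by blast
    qed (use rI[OF k] in auto)
    finally have "(if k = j then 1 else 0) - J k (\<lambda>z. F z * \<phi> j z) = J k (\<lambda>z. F z * H j z) - J k (\<lambda>z. F z * \<phi> j z)"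
      by simp
    also have "\<dots> = J k (\<lambda>z. 1 * (F z * H j z) + (- 1) * (F z * \<phi> j z))"
      by (subst J_lin[OF k]) (auto intro!: continuous_intros F_cont H_cont j \<phi>_cont)
    also have "cmod \<dots> \<le> c * (C1 * e1)"
    proof (rule J_bnd[OF k])
      show "continuous_on L (\<lambda>z. 1 * (F z * H j z) + - 1 * (F z * \<phi> j z))"
        by (intro continuous_intros F_cont H_cont j \<phi>_cont)
      fix z assume z: "z \<in> L"
      have "cmod (F z * (H j z - \<phi> j z)) \<le> C1 * e1"
        unfolding norm_mult using C1 \<phi>(2)[OF j z] z by (intro mult_mono) auto
      then show "cmod (1 * (F z * H j z) + - 1 * (F z * \<phi> j z)) \<le> C1 * e1" by (simp add: algebra_simps)
    qed (use C1 e1 in auto)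
    finally show ?thesis using e1(2) by simp
  qed
  have "bounded (F ` L \<union> (\<Union>j\<in>I. \<phi> j ` L))"
    using finI bdd[OF F_cont] bdd[OF \<phi>_cont] by auto
  then obtain C where "C > 0" and CB: "\<forall>y\<in>F ` L \<union> (\<Union>j\<in>I. \<phi> j ` L). cmod y \<le> C"
    unfolding bounded_pos by metis
  then have C: "C > 0" "\<And>z. z \<in> L \<Longrightarrow> cmod (F z) \<le> C"
    "\<And>j z. j \<in> I \<Longrightarrow> z \<in> L \<Longrightarrow> cmod (\<phi> j z) \<le> C" by auto
  have zero: "J k F = 0" if k: "k \<in> I" for k
  proof -
    have "(F has_contour_integral 0) (circlepath k (r k))"
    proof (rule Cauchy_theorem_primitive[of V g])
      show "(g has_field_derivative F x) (at x within V)" if "x \<in> V" for x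
        using F0(2)[of x] V(4) that unfolding F_def by (auto intro: has_field_derivative_at_within)
      show "path_image (circlepath k (r k)) \<subseteq> V"
        using rI[OF k] L(2) by (auto simp: path_image_circlepath)
    qed auto
    then show ?thesis by (simp add: J_def contour_integral_unique)
  qed
  define N where "N = real (card I) + 1"
  have N: "N > 0" by (simp add: N_def)
  define eps' where "eps' = eps / (2 * M)"
  have eps': "eps' > 0" "M * eps' < eps" using \<open>eps > 0\<close> L1(3) by (auto simp: eps'_def)
  define \<rho> where "\<rho> = min 1 (eps' / (8 * (C + 1)))"
  have \<rho>: "\<rho> > 0" "\<rho> \<le> 1" "(C + 1) * (4 * \<rho>) \<le> eps' / 2"
  proof -
    show "\<rho> > 0" "\<rho> \<le> 1" using eps' C(1) by (auto simp: \<rho>_def)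
    have "\<rho> \<le> eps' / (8 * (C + 1))" by (simp add: \<rho>_def)
    then have "\<rho> * (8 * (C + 1)) \<le> eps'" using C(1) by (subst (asm) pos_le_divide_eq) auto
    then show "(C + 1) * (4 * \<rho>) \<le> eps' / 2" by (simp add: algebra_simps)
  qed
  define eta where "eta = \<rho> / (N * C)"
  have eta: "eta > 0" "N * C * eta = \<rho>" using \<rho> N C(1) by (auto simp: eta_def)
  have "\<exists>\<delta>>0. \<forall>G. continuous_on L G \<longrightarrow> (\<forall>z\<in>L. cmod (G z - F z) \<le> \<delta>) \<longrightarrow>
      (\<exists>t. (\<forall>j\<in>I. cmod (t j) \<le> eta) \<and> (\<forall>k\<in>I. J k (\<lambda>z. G z * exp (\<Sum>j\<in>I. t j * \<phi> j z)) = 0))"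
    by (rule kill_functionals_by_exponential[of I L J c C F \<phi> eta])
       (fact finI J_lin J_bnd c C F_cont \<phi>_cont zero diag eta(1))+
  then obtain \<delta> where \<delta>: "\<delta> > 0"
    "\<And>G. continuous_on L G \<Longrightarrow> (\<forall>z\<in>L. cmod (G z - F z) \<le> \<delta>) \<Longrightarrow>
      \<exists>t. (\<forall>j\<in>I. cmod (t j) \<le> eta) \<and> (\<forall>k\<in>I. J k (\<lambda>z. G z * exp (\<Sum>j\<in>I. t j * \<phi> j z)) = 0)"
    by blast
  have "bounded ((\<lambda>z. 1 / P z) ` L)" using P_nz by (intro bdd continuous_intros) auto
  then obtain p where p: "p > 0" "\<And>z. z \<in> L \<Longrightarrow> cmod (1 / P z) \<le> p" unfolding bounded_pos by auto
  define d where "d = min \<delta> (min 1 (eps' / 2))"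
  have d: "d > 0" "d \<le> \<delta>" "d \<le> 1" "d \<le> eps' / 2" using \<delta>(1) eps'(1) by (auto simp: d_def)
  have "unif_approx_by L F0 (zero_free S')"
    by (rule zero_free_approx_transfer[OF F0(1) L(1) LS(1,2) lin[OF L]])
  then obtain G0 where G0: "G0 \<in> zero_free S'" "\<And>z. z \<in> L \<Longrightarrow> cmod (F0 z - G0 z) < d / p"
    unfolding unif_approx_by_def using d(1) p(1) by (meson divide_pos_pos)
  define G where "G z = G0 z / P z" for z
  have G_cont: "continuous_on L G"
    unfolding G_def using P_nz zf_cont G0(1) by (auto intro!: continuous_intros)
  have GF: "cmod (G z - F z) \<le> d" if "z \<in> L" for z
  proof -
    have "G z - F z = (G0 z - F0 z) * (1 / P z)" by (simp add: G_def F_def diff_divide_distrib)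
    then have "cmod (G z - F z) = cmod (F0 z - G0 z) * cmod (1 / P z)"
      by (simp only: norm_mult norm_minus_commute)
    also have "\<dots> \<le> (d / p) * p"
      using G0(2)[OF that] p that d by (intro mult_mono) (auto intro: less_imp_le)
    finally show ?thesis using p(1) by simp
  qed
  obtain t where t: "\<And>j. j \<in> I \<Longrightarrow> cmod (t j) \<le> eta"
    "\<And>k. k \<in> I \<Longrightarrow> J k (\<lambda>z. G z * exp (\<Sum>j\<in>I. t j * \<phi> j z)) = 0"
  proof -
    have "\<forall>z\<in>L. cmod (G z - F z) \<le> \<delta>" using GF d(2) order_trans by blast
    from \<delta>(2)[OF G_cont this] show ?thesis using that by auto
  qed
  define u where "u z = (\<Sum>j\<in>I. t j * \<phi> j z)" for z
  have u_alg: "u \<in> rat_alg S'"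
    unfolding u_def[abs_def] using \<phi>(1) by (intro rat_alg_sum rat_alg_cmult)
  define G1 where "G1 z = G0 z * exp (u z)" for z
  have G1: "G1 \<in> zero_free S'" unfolding G1_def[abs_def] by (intro zf_mult G0(1) zf_exp u_alg)
  define Fn where "Fn z = G1 z / P z" for z
  have Fn_hol: "Fn holomorphic_on - I"
  proof -
    have "G1 holomorphic_on - I"
      using zero_free_holomorphic[OF G1] by (rule holomorphic_on_subset) (auto simp: I_def)
    moreover have "P holomorphic_on - I" unfolding P_def by (intro holomorphic_intros)
    ultimately show ?thesis unfolding Fn_def using fin(3) by (auto intro!: holomorphic_intros simp: P_def I_def)
  qed
  have res: "residue Fn k = 0" if k: "k \<in> I" for k
  proof -
    have "(Fn has_contour_integral 2 * pi * \<i> * residue Fn k) (circlepath k (r k))"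
    proof (rule base_residue[of "- (I - {k})"])
      show "open (- (I - {k}))" using finI by (intro open_Compl finite_imp_closed finite_Diff)
      have "- (I - {k}) - {k} = - I" using k by auto
      then show "Fn holomorphic_on - (I - {k}) - {k}" using Fn_hol by simp
      show "cball k (r k) \<subseteq> - (I - {k})" using r k by (auto simp: I_def)
    qed (use rI[OF k] in auto)
    then have "J k Fn = residue Fn k" by (simp add: J_def contour_integral_unique)
    moreover have "Fn = (\<lambda>z. G z * exp (\<Sum>j\<in>I. t j * \<phi> j z))"
      by (simp add: fun_eq_iff Fn_def G1_def G_def u_def)
    ultimately show ?thesis using t(2)[OF k] by simp
  qed
  obtain g1 where g1: "\<And>z. z \<notin> I \<Longrightarrow> (g1 has_field_derivative Fn z) (at z)"
    using primitive_of_zero_residues[OF finI Fn_hol res] by blast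
  define g' where "g' z = g1 z + (g z0 - g1 z0)" for z
  have FnF: "cmod (F z - Fn z) \<le> eps'" if z: "z \<in> L" for z
  proof -
    have "cmod (u z) \<le> (\<Sum>j\<in>I. cmod (t j * \<phi> j z))" unfolding u_def by (rule norm_sum)
    also have "\<dots> \<le> (\<Sum>j\<in>I. eta * C)"
      using t(1) C(3) z eta(1) by (intro sum_mono) (auto simp: norm_mult intro!: mult_mono)
    also have "\<dots> \<le> N * C * eta" using C eta(1) by (simp add: N_def algebra_simps)
    finally have u\<rho>: "cmod (u z) \<le> \<rho>" using eta(2) by simp
    have "cmod (exp (u z) - exp 0 - (u z - 0)) \<le> 3 * \<rho> * cmod (u z - 0)"
      using u\<rho> \<rho> by (intro exp_linear_remainder) auto
    also have "\<dots> \<le> 3 * \<rho> * 1" using u\<rho> \<rho> by (intro mult_left_mono) auto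
    finally have "cmod (exp (u z) - 1) \<le> 4 * \<rho>"
      using u\<rho> norm_triangle_sub[of "exp (u z) - 1" "u z"] by simp
    moreover have "cmod (G z) \<le> C + 1"
      using GF[OF z] C(2)[OF z] d(3) norm_triangle_sub[of "G z" "F z"] by linarith
    ultimately have "cmod (G z * (exp (u z) - 1)) \<le> (C + 1) * (4 * \<rho>)"
      unfolding norm_mult using C(1) by (intro mult_mono) auto
    moreover have eq: "F z - Fn z = (F z - G z) - G z * (exp (u z) - 1)"
      by (simp add: Fn_def G1_def G_def right_diff_distrib diff_divide_distrib)
    moreover have "cmod (F z - G z) \<le> eps' / 2"
      using GF[OF z] d(4) by (simp add: norm_minus_commute)
    ultimately show ?thesis
      unfolding eq using \<rho>(3) norm_triangle_ineq4[of "F z - G z" "G z * (exp (u z) - 1)"] by linarith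
  qed
  show ?thesis
  proof (rule that[of g'])
    show "g' \<in> lu_class S' A"
      unfolding lu_class_def
    proof (intro CollectI bexI[OF _ G1] allI impI)
      fix z assume "z \<notin> S' \<union> A"
      then show "(g' has_field_derivative G1 z / (\<Prod>a\<in>A. (z - a)\<^sup>2)) (at z)"
        using g1[of z] unfolding g'_def Fn_def P_def I_def by (auto intro!: derivative_eq_intros)
    qed
    fix z assume z: "z \<in> L0"
    have "\<forall>z\<in>L0. cmod ((g z - g1 z) - (g z0 - g1 z0)) \<le> M * eps'"
    proof (rule L1(4))
      fix w assume "w \<in> V"
      then have "w \<notin> S \<union> A" "w \<notin> I" using V(4) by (auto simp: I_def)
      then show "((\<lambda>z. g z - g1 z) has_field_derivative F w - Fn w) (at w)"
        unfolding F_def by (intro derivative_intros F0(2) g1)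
    next
      fix w assume "w \<in> L1"
      then show "cmod (F w - Fn w) \<le> eps'" by (intro FnF) (simp add: L_def)
    qed (use eps' in simp)
    then have "cmod ((g z - g1 z) - (g z0 - g1 z0)) < eps" using z eps'(2) by force
    then show "cmod (g z - g' z) < eps" by (simp add: g'_def algebra_simps)
  qed
qed

text \<open>
  All exceptional points in a disc are merged into its centre. They are moved simultaneously because the
  residue at the centre is read off from a circle around the whole disc.
\<close>
lemma lu_class_merge_disc:
  assumes fin: "finite S" "finite A" and A: "cball d \<rho> \<inter> A = {}" and "\<rho> > 0"
    and g: "g \<in> lu_class S A" and L0: "compact L0" "L0 \<inter> (cball d \<rho> \<union> S \<union> A) = {}" and "eps > 0"
  obtains g' where "g' \<in> lu_class (insert d (S - cball d \<rho>)) A" "\<And>z. z \<in> L0 \<Longrightarrow> cmod (g z - g' z) < eps"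
proof -
  define X where "X = (S \<union> A) - cball d \<rho>"
  define V where "V = - cball d \<rho> - X"
  define S' where "S' = insert d (S - cball d \<rho>)"
  have finX: "finite X" using fin by (simp add: X_def)
  have S'A: "S' \<union> A = insert d X" using A by (auto simp: S'_def X_def)
  have V: "open V" "connected V"
  proof -
    show "open V" unfolding V_def using finX by (intro open_Diff finite_imp_closed) auto
    have "connected (- cball d \<rho>)" by (intro connected_complement_bounded_convex) auto
    then show "connected V" unfolding V_def using finX by (intro connected_open_delete_finite) auto
  qed
  have "bounded (cball d \<rho> \<union> X)" using finX by (simp add: finite_imp_bounded)
  then have "cball d \<rho> \<union> X \<noteq> UNIV" using not_bounded_UNIV by metis
  then obtain z0 where "z0 \<notin> cball d \<rho> \<union> X" by blast
  then have z0: "z0 \<in> V" by (simp add: V_def)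
  have circ: "\<exists>r>0. sphere b r \<subseteq> V \<and> cball b r \<inter> (S' \<union> A) = {b}" if b: "b \<in> S' \<union> A" for b
  proof (cases "b = d")
    case True
    define r where "r = Min (insert (\<rho> + 1) ((\<lambda>x. (\<rho> + dist d x) / 2) ` X))"
    have r\<rho>: "r > \<rho>" unfolding r_def using finX by (auto simp: X_def)
    have rX: "r < dist d x" if x: "x \<in> X" for x
    proof -
      have "r \<le> (\<rho> + dist d x) / 2" unfolding r_def using finX x by (intro Min_le) auto
      also have "\<dots> < dist d x" using x by (simp add: X_def)
      finally show ?thesis .
    qed
    have "x \<in> V" if "x \<in> sphere d r" for x using r\<rho> rX[of x] that by (auto simp: V_def)
    moreover have "x = d" if "x \<in> cball d r" "x \<in> insert d X" for x using rX[of x] that by auto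
    ultimately show ?thesis
      using r\<rho> \<open>\<rho> > 0\<close> True by (intro exI[of _ r]) (auto simp: S'A)
  next
    case False
    then have bX: "b \<in> - cball d \<rho>" "b \<in> X" using b S'A by (auto simp: X_def)
    obtain e where e: "e > 0" "\<forall>w\<in>cball b e. w \<in> - cball d \<rho> \<and> (w \<noteq> b \<longrightarrow> w \<notin> X)"
      using finite_cball_avoid[of "- cball d \<rho>" X] finX bX(1) by auto
    have "d \<notin> cball b e" using e(2) \<open>\<rho> > 0\<close> by force
    moreover have "w \<in> V" if "w \<in> sphere b e" for w
      using e that by (auto simp: V_def)
    ultimately show ?thesis using e bX by (intro exI[of _ e]) (auto simp: S'A)
  qed
  show ?thesis
  proof (rule lu_class_approx[OF fin(1) _ fin(2) V z0 _ circ _ g L0(1) _ \<open>eps > 0\<close>])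
    show "finite S'" using fin by (simp add: S'_def)
    show "V \<inter> (S \<union> S' \<union> A) = {}" using \<open>\<rho> > 0\<close> by (auto simp: V_def X_def S'_def)
    show "L0 \<subseteq> V" using L0(2) by (auto simp: V_def X_def)
    fix L s assume L: "compact L" "L \<subseteq> V" and s: "s \<in> S"
    show "unif_approx_by L (\<lambda>z. z - s) (zero_free S')"
    proof (cases "s \<in> cball d \<rho>")
      case True
      then show ?thesis using L
        by (intro linear_approx_move_to_center[of _ d \<rho>]) (auto simp: V_def S'_def)
    next
      case False
      then show ?thesis using s by (intro approx_member zf_lin) (auto simp: S'_def)
    qed
  qed (use that in \<open>auto simp: S'_def\<close>)
qed

text \<open>Here the disc is a neighbourhood of infinity, and no residue has to be corrected at its centre.\<close>
lemma lu_class_drop_outside_disc: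
  assumes fin: "finite S" "finite A" and A: "A \<subseteq> ball 0 \<rho>" and "\<rho> > 0"
    and g: "g \<in> lu_class S A" and L0: "compact L0" "L0 \<subseteq> ball 0 \<rho> - (S \<union> A)" and "eps > 0"
  obtains g' where "g' \<in> lu_class (S \<inter> ball 0 \<rho>) A" "\<And>z. z \<in> L0 \<Longrightarrow> cmod (g z - g' z) < eps"
proof -
  define X where "X = S \<union> A"
  define V where "V = ball 0 \<rho> - X"
  define S' where "S' = S \<inter> ball 0 \<rho>"
  have finX: "finite X" using fin by (simp add: X_def)
  have V: "open V" "connected V"
  proof -
    show "open V" unfolding V_def using finX by (intro open_Diff finite_imp_closed) auto
    show "connected V" unfolding V_def using finX by (intro connected_open_delete_finite) auto
  qed
  have "infinite (ball (0::complex) \<rho>)"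
    using \<open>\<rho> > 0\<close> by (intro uncountable_infinite uncountable_ball)
  then obtain z0 where z0: "z0 \<in> V"
    using finX unfolding V_def by (metis Diff_eq_empty_iff ex_in_conv finite_subset)
  have circ: "\<exists>r>0. sphere b r \<subseteq> V \<and> cball b r \<inter> (S' \<union> A) = {b}" if b: "b \<in> S' \<union> A" for b
  proof -
    have bX: "b \<in> ball 0 \<rho>" using b A by (auto simp: S'_def)
    obtain e where e: "e > 0" "\<forall>w\<in>cball b e. w \<in> ball 0 \<rho> \<and> (w \<noteq> b \<longrightarrow> w \<notin> X)"
      using finite_cball_avoid[of "ball 0 \<rho>" X] finX bX(1) by auto
    have "w \<in> V" if "w \<in> sphere b e" for w
      using e that by (auto simp: V_def)
    then show ?thesis using e b by (intro exI[of _ e]) (auto simp: S'_def X_def)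
  qed
  show ?thesis
  proof (rule lu_class_approx[OF fin(1) _ fin(2) V z0 _ circ _ g L0(1) _ \<open>eps > 0\<close>])
    show "finite S'" using fin by (simp add: S'_def)
    show "V \<inter> (S \<union> S' \<union> A) = {}" by (auto simp: V_def X_def S'_def)
    show "L0 \<subseteq> V" using L0(2) by (auto simp: V_def X_def)
    fix L s assume L: "compact L" "L \<subseteq> V" and s: "s \<in> S"
    show "unif_approx_by L (\<lambda>z. z - s) (zero_free S')"
    proof (cases "s \<in> ball 0 \<rho>")
      case False
      then show ?thesis using L \<open>\<rho> > 0\<close>
        by (intro linear_approx_move_to_infinity[of _ \<rho>]) (auto simp: V_def)
    next
      case True
      then show ?thesis using s by (intro approx_member zf_lin) (auto simp: S'_def)
    qed
  qed (use that in \<open>auto simp: S'_def\<close>)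
qed

text \<open>
  The points that can be reached from \<open>x\<close> by merging along chains of discs off \<open>K\<close> fill the component of \<open>x\<close> in the
  complement of \<open>K\<close>. Other exceptional points met on the way are swallowed by the discs and travel along, so
  that each round lowers the number of points that have not arrived.
\<close>
lemma lu_class_push:
  assumes K: "compact K" "K \<subseteq> ball 0 R" "R > 0"
    and A: "finite A" "A \<subseteq> K" and L0: "compact L0" "L0 \<subseteq> K - A"
    and S: "finite S" "S \<inter> K = {}"
    and reach: "\<And>s. s \<in> S \<Longrightarrow> \<exists>b. connected_component (- K) s b \<and> (b \<in> T \<or> R \<le> cmod b)"
    and g: "g \<in> lu_class S A" and "eps > 0"
  obtains S' g' where "finite S'" "S' \<subseteq> T" "g' \<in> lu_class S' A" "\<And>z. z \<in> L0 \<Longrightarrow> cmod (g z - g' z) < eps"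
proof -
  define ap where "ap g eps X \<longleftrightarrow> (\<exists>S' g'. finite S' \<and> S' \<subseteq> X \<and> g' \<in> lu_class S' A \<and>
     (\<forall>z\<in>L0. cmod (g z - g' z) < eps))" for g X and eps :: real
  have ap_refl: "ap g eps X" if "finite S" "S \<subseteq> X" "g \<in> lu_class S A" "eps > 0" for S g X eps
    unfolding ap_def using that by (intro exI[of _ S] exI[of _ g]) auto
  have ap_trans: "ap g eps X"
    if 1: "\<forall>z\<in>L0. cmod (g z - g1 z) < eps / 2" and ap1: "ap g1 (eps / 2) X" for g g1 eps X
  proof -
    obtain S2 g2 where 2: "finite S2" "S2 \<subseteq> X" "g2 \<in> lu_class S2 A" "\<forall>z\<in>L0. cmod (g1 z - g2 z) < eps / 2"
      using ap1 unfolding ap_def by blast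
    have "cmod (g w - g2 w) < eps" if "w \<in> L0" for w
      using 1 2(4) that norm_triangle_lt[of "g w - g1 w" "g1 w - g2 w" eps] by fastforce
    then show ?thesis unfolding ap_def using 2 by (intro exI[of _ S2] exI[of _ g2]) auto
  qed
  define mv where "mv x y \<longleftrightarrow> (\<forall>S g eps. finite S \<longrightarrow> S \<inter> K = {} \<longrightarrow> g \<in> lu_class S A \<longrightarrow> eps > 0 \<longrightarrow>
     ap g eps (insert y (S - {x})))" for x y
  have mvD: "\<exists>S' g'. finite S' \<and> S' \<subseteq> insert y (S - {x}) \<and> g' \<in> lu_class S' A \<and> (\<forall>z\<in>L0. cmod (g z - g' z) < eps / 2)"
    if "mv x y" "finite S" "S \<inter> K = {}" "g \<in> lu_class S A" "eps > 0" for x y S g eps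
    using that unfolding mv_def ap_def by (meson half_gt_zero)
  have refl: "mv x x" for x unfolding mv_def by (auto intro: ap_refl)
  have trans: "mv x z" if xy: "mv x y" and yz: "mv y z" and "y \<in> - K" for x y z
    unfolding mv_def
  proof (intro allI impI)
    fix S g and eps :: real assume S: "finite S" "S \<inter> K = {}" "g \<in> lu_class S A" "eps > 0"
    obtain S1 g1 where 1: "finite S1" "S1 \<subseteq> insert y (S - {x})" "g1 \<in> lu_class S1 A" "\<forall>z\<in>L0. cmod (g z - g1 z) < eps / 2"
      using mvD[OF xy S] by blast
    have "S1 \<inter> K = {}" using 1(2) S(2) \<open>y \<in> - K\<close> by auto
    then have "ap g1 (eps / 2) (insert z (S1 - {y}))" using yz 1 S(4) unfolding mv_def by simp
    moreover have "insert z (S1 - {y}) \<subseteq> insert z (S - {x})" using 1(2) by auto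
    ultimately have "ap g1 (eps / 2) (insert z (S - {x}))" unfolding ap_def by (meson order_trans)
    with 1(4) show "ap g eps (insert z (S - {x}))" by (rule ap_trans)
  qed
  have short: "mv x y" if "cball y (dist y x) \<inter> K = {}" for x y
  proof (cases "x = y")
    case False
    then have "dist y x > 0" by simp
    show ?thesis
      unfolding mv_def
    proof (intro allI impI)
      fix S g and eps :: real assume S: "finite S" "S \<inter> K = {}" "g \<in> lu_class S A" "eps > 0"
      have "cball y (dist y x) \<inter> A = {}" "L0 \<inter> (cball y (dist y x) \<union> S \<union> A) = {}"
        using that A L0 S by auto
      from lu_class_merge_disc[OF S(1) A(1) this(1) \<open>dist y x > 0\<close> S(3) L0(1) this(2) S(4)]
      obtain g' where "g' \<in> lu_class (insert y (S - cball y (dist y x))) A" "\<And>z. z \<in> L0 \<Longrightarrow> cmod (g z - g' z) < eps"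
        by blast
      then show "ap g eps (insert y (S - {x}))" unfolding ap_def
        using S(1) by (intro exI[of _ "insert y (S - cball y (dist y x))"] exI[of _ g']) auto
    qed
  qed (simp add: refl)
  have conn: "mv x y" if C: "connected C" "C \<subseteq> - K" "x \<in> C" "y \<in> C" for C x y
  proof -
    have "mv x y \<and> mv y x"
    proof (rule connected_equivalence_relation[OF C(1,3,4), of "\<lambda>x y. mv x y \<and> mv y x"])
      fix x y z assume "mv x y \<and> mv y x" "mv y z \<and> mv z y" "x \<in> C" "y \<in> C" "z \<in> C"
      then show "mv x z \<and> mv z x" using trans C(2) by blast
    next
      fix a assume "a \<in> C"
      moreover have "open (- K)" using K(1) by (simp add: compact_imp_closed open_Compl)
      ultimately obtain r where r: "r > 0" "ball a r \<subseteq> - K" using C(2) open_contains_ball by blast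
      have "mv a x \<and> mv x a" if x: "x \<in> ball a (r / 2)" for x
      proof -
        have "cball x (dist x a) \<subseteq> ball a r"
        proof
          fix w assume "w \<in> cball x (dist x a)"
          then show "w \<in> ball a r" using x dist_triangle[of a w x] by (simp add: dist_commute)
        qed
        moreover have "cball a (dist a x) \<subseteq> ball a r" using x r(1) by auto
        ultimately show ?thesis using r(2) by (auto intro!: short)
      qed
      then show "\<exists>T. openin (top_of_set C) T \<and> a \<in> T \<and> (\<forall>x\<in>T. mv a x \<and> mv x a)"
        using r(1) \<open>a \<in> C\<close> by (intro exI[of _ "C \<inter> ball a (r / 2)"]) auto
    qed auto
    then show ?thesis ..
  qed
  \<comment> \<open>Points far away count as having arrived, since they are discarded in the end.\<close>
  define T' where "T' = T \<union> - ball 0 R"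
  have main: "ap g eps (T' - K)"
    if "finite S" "S \<inter> K = {}" "g \<in> lu_class S A" "eps > 0"
      "\<And>s. s \<in> S \<Longrightarrow> \<exists>b\<in>T'. connected_component (- K) s b" for S g eps
    using that
  proof (induction "card (S - T')" arbitrary: S g eps rule: less_induct)
    case less
    show ?case
    proof (cases "S \<subseteq> T'")
      case True
      then show ?thesis using less.prems by (intro ap_refl[of S]) auto
    next
      case False
      then obtain s where s: "s \<in> S" "s \<notin> T'" by auto
      obtain b where b: "b \<in> T'" "connected_component (- K) s b" using less.prems(5)[OF s(1)] by blast
      have "mv s b" using b(2) conn unfolding connected_component_def by blast
      have bK: "b \<in> - K" using b(2) connected_component_in by blast
      obtain S1 g1 where 1: "finite S1" "S1 \<subseteq> insert b (S - {s})" "g1 \<in> lu_class S1 A" "\<forall>z\<in>L0. cmod (g z - g1 z) < eps / 2"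
        using mvD[OF \<open>mv s b\<close> less.prems(1-4)] by blast
      have "S1 - T' \<subset> S - T'" using 1(2) b(1) s by auto
      then have "card (S1 - T') < card (S - T')" using less.prems(1) by (intro psubset_card_mono) auto
      moreover have "S1 \<inter> K = {}" using 1(2) bK less.prems(2) by auto
      moreover have "\<exists>b\<in>T'. connected_component (- K) x b" if "x \<in> S1" for x
      proof (cases "x = b")
        case True
        then show ?thesis using b(1) bK by (intro bexI[of _ b]) auto
      next
        case False
        then show ?thesis using less.prems(5) that 1(2) by blast
      qed
      ultimately have "ap g1 (eps / 2) (T' - K)" using less.prems(4) by (intro less.hyps[OF _ 1(1) _ 1(3)]) auto
      with 1(4) show ?thesis by (rule ap_trans)
    qed
  qed
  have "\<exists>b\<in>T'. connected_component (- K) s b" if "s \<in> S" for s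
    using reach[OF that] by (auto simp: T'_def)
  with main[OF S g, of "eps / 2"] \<open>eps > 0\<close> obtain S1 g1 where 1: "finite S1" "S1 \<subseteq> T' - K"
    "g1 \<in> lu_class S1 A" "\<forall>z\<in>L0. cmod (g z - g1 z) < eps / 2"
    unfolding ap_def by auto
  have "A \<subseteq> ball 0 R" "L0 \<subseteq> ball 0 R - (S1 \<union> A)" using A K L0 1(2) by auto
  from lu_class_drop_outside_disc[OF 1(1) A(1) this(1) K(3) 1(3) L0(1) this(2), of "eps / 2"] \<open>eps > 0\<close>
  obtain g2 where 2: "g2 \<in> lu_class (S1 \<inter> ball 0 R) A" "\<And>z. z \<in> L0 \<Longrightarrow> cmod (g1 z - g2 z) < eps / 2"
    by auto
  show ?thesis
  proof (rule that[of "S1 \<inter> ball 0 R" g2])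
    show "cmod (g w - g2 w) < eps" if "w \<in> L0" for w
      using 1(4) 2(2) that norm_triangle_lt[of "g w - g1 w" "g1 w - g2 w" eps] by fastforce
  qed (use 1 2 in \<open>auto simp: T'_def\<close>)
qed

section \<open>Factoring rational functions\<close>

lemma rat_alg_poly_quotient:
  assumes "finite S" "Q \<in> rat_alg S"
  obtains p :: "complex poly" and n where "\<And>z. z \<notin> S \<Longrightarrow> Q z * (\<Prod>s\<in>S. z - s) ^ n = poly p z"
proof -
  define D where "D = (\<Prod>s\<in>S. [:- s, 1:])"
  have D: "poly D z = (\<Prod>s\<in>S. z - s)" for z by (simp add: D_def poly_prod)
  have "\<exists>p n. \<forall>z. z \<notin> S \<longrightarrow> Q z * poly D z ^ n = poly p z"
    using assms(2)
  proof induction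
    case (rat_const c)
    show ?case by (rule exI[of _ "[:c:]"], rule exI[of _ 0]) simp
  next
    case rat_id
    show ?case by (rule exI[of _ "[:0, 1:]"], rule exI[of _ 0]) simp
  next
    case (rat_pole s)
    have "1 / (z - s) * poly D z = poly (\<Prod>s\<in>S - {s}. [:- s, 1:]) z" if "z \<notin> S" for z
    proof -
      have "D = [:- s, 1:] * (\<Prod>s\<in>S - {s}. [:- s, 1:])"
        unfolding D_def using prod.remove[OF assms(1) rat_pole] .
      moreover have "z \<noteq> s" using that rat_pole by auto
      moreover have "1 / (z - s) * ((z - s) * w) = w" if "z \<noteq> s" for w using that by simp
      moreover have "poly [:- s, 1:] z = z - s" by simp
      ultimately show ?thesis by (metis poly_mult)
    qed
    then show ?case by (intro exI[of _ "\<Prod>s\<in>S - {s}. [:- s, 1:]"] exI[of _ 1]) simp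
  next
    case (rat_add f g)
    then obtain p m q n where pq: "\<forall>z. z \<notin> S \<longrightarrow> f z * poly D z ^ m = poly p z"
      "\<forall>z. z \<notin> S \<longrightarrow> g z * poly D z ^ n = poly q z" by blast
    show ?case
    proof (intro exI allI impI)
      fix z assume z: "z \<notin> S"
      have "(f z + g z) * poly D z ^ (m + n) = (f z * poly D z ^ m) * poly D z ^ n + (g z * poly D z ^ n) * poly D z ^ m"
        by (simp add: power_add algebra_simps)
      also have "\<dots> = poly (p * D ^ n + q * D ^ m) z" using pq z by simp
      finally show "(f z + g z) * poly D z ^ (m + n) = poly (p * D ^ n + q * D ^ m) z" .
    qed
  next
    case (rat_mult f g)
    then obtain p m q n where pq: "\<forall>z. z \<notin> S \<longrightarrow> f z * poly D z ^ m = poly p z"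
      "\<forall>z. z \<notin> S \<longrightarrow> g z * poly D z ^ n = poly q z" by blast
    show ?case
    proof (intro exI allI impI)
      fix z assume z: "z \<notin> S"
      have "(f z * g z) * poly D z ^ (m + n) = (f z * poly D z ^ m) * (g z * poly D z ^ n)"
        by (simp add: power_add algebra_simps)
      also have "\<dots> = poly (p * q) z" using pq z by simp
      finally show "(f z * g z) * poly D z ^ (m + n) = poly (p * q) z" .
    qed
  qed
  then show ?thesis using that by (auto simp: D)
qed

lemma zero_free_prod:
  assumes "\<And>i. i \<in> I \<Longrightarrow> f i \<in> zero_free S" shows "(\<lambda>z. \<Prod>i\<in>I. f i z) \<in> zero_free S"
  using assms by (induction I rule: infinite_finite_induct) (auto intro: zero_free_const zf_mult)

lemma zero_free_power: "f \<in> zero_free S \<Longrightarrow> (\<lambda>z. f z ^ n) \<in> zero_free S"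
  by (induction n) (auto intro: zero_free_const zf_mult)

lemma zero_free_poly:
  assumes "p \<noteq> 0" "{z. poly p z = 0} \<subseteq> Z" shows "poly p \<in> zero_free Z"
proof -
  have "poly p z = lead_coeff p * (\<Prod>w | poly p w = 0. (z - w) ^ order w p)" for z
    using arg_cong[OF complex_poly_decompose[of p], of "\<lambda>q. poly q z"]
    by (simp add: poly_prod poly_power)
  then have "poly p = (\<lambda>z. lead_coeff p * (\<Prod>w | poly p w = 0. (z - w) ^ order w p))" by blast
  also have "\<dots> \<in> zero_free Z"
    using assms by (intro zf_mult zero_free_const zero_free_prod zero_free_power zf_lin) auto
  finally show ?thesis .
qed

lemma rat_alg_zero_free:
  assumes "finite S" "Q \<in> rat_alg S" "w \<notin> S" "Q w \<noteq> 0"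
  obtains Z F where "finite Z" "\<And>z. z \<in> Z \<Longrightarrow> Q z = 0" "F \<in> zero_free (S \<union> Z)" "\<And>z. z \<notin> S \<Longrightarrow> F z = Q z"
proof -
  obtain p n where pn: "\<And>z. z \<notin> S \<Longrightarrow> Q z * (\<Prod>s\<in>S. z - s) ^ n = poly p z"
    using rat_alg_poly_quotient[OF assms(1,2)] by blast
  have D0: "(\<Prod>s\<in>S. z - s) \<noteq> 0" if "z \<notin> S" for z using that assms(1) by auto
  have p0: "p \<noteq> 0" using pn[OF assms(3)] assms(4) D0[OF assms(3)] by auto
  define Z where "Z = {z. poly p z = 0} - S"
  define F where "F z = poly p z * (\<Prod>s\<in>S. 1 / (z - s)) ^ n" for z
  show ?thesis
  proof (rule that[of Z F])
    show "finite Z" unfolding Z_def using poly_roots_finite[OF p0] by simp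
    show "Q z = 0" if "z \<in> Z" for z
    proof -
      have "Q z * (\<Prod>s\<in>S. z - s) ^ n = 0" "z \<notin> S" using that pn[of z] by (auto simp: Z_def)
      then show ?thesis using D0[of z] by simp
    qed
    have "poly p \<in> zero_free (S \<union> Z)" using p0 by (intro zero_free_poly) (auto simp: Z_def)
    then show "F \<in> zero_free (S \<union> Z)"
      unfolding F_def[abs_def] by (intro zf_mult zero_free_power zero_free_prod) (auto intro: zf_inv_lin)
    show "F z = Q z" if "z \<notin> S" for z
      using D0[OF that] unfolding F_def pn[OF that, symmetric]
      by (simp add: prod_dividef power_one_over)
  qed
qed

section \<open>Starting approximations\<close>

text \<open>
  Only the holomorphic part is approximated, the principal parts are kept. Multiplied by
  \<open>\<Prod>a\<in>A. (z - a)\<^sup>2\<close> the derivative extends holomorphically across the poles and has no zero on all of \<open>K\<close>, the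
  poles included; on the compact set \<open>K\<close> this is stable, so all zeros of the approximating derivative are off \<open>K\<close>.
\<close>
lemma lu_class_approx_on_neighbourhood:
  assumes U: "open U" "f0 holomorphic_on U" and K1: "compact K1" "K1 \<subseteq> U"
    and K: "compact K" "K \<noteq> {}" "\<delta> > 0" "\<And>z. z \<in> K \<Longrightarrow> cball z \<delta> \<subseteq> K1"
    and A: "finite A" "A \<subseteq> K" and c: "\<And>a. a \<in> A \<Longrightarrow> c a \<noteq> 0"
    and nz: "\<And>z. z \<in> K - A \<Longrightarrow> deriv f0 z - (\<Sum>a\<in>A. c a / (z - a)\<^sup>2) \<noteq> 0" and "eps > 0"
  obtains S g where "finite S" "S \<inter> K = {}" "g \<in> lu_class S A"
    "\<And>z. z \<in> K1 - A \<Longrightarrow> cmod (f0 z + (\<Sum>a\<in>A. c a / (z - a)) - g z) < eps"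
proof -
  define P where "P z = (\<Prod>a\<in>A. (z - a)\<^sup>2)" for z :: complex
  define B where "B z = (\<Sum>a\<in>A. c a * (\<Prod>b\<in>A - {a}. (z - b)\<^sup>2))" for z
  define h where "h z = P z * deriv f0 z - B z" for z
  have BP: "B z = P z * (\<Sum>a\<in>A. c a / (z - a)\<^sup>2)" if "z \<notin> A" for z
  proof -
    have "c a * (\<Prod>b\<in>A - {a}. (z - b)\<^sup>2) = P z * (c a / (z - a)\<^sup>2)" if a: "a \<in> A" for a
    proof -
      have "P z = (z - a)\<^sup>2 * (\<Prod>b\<in>A - {a}. (z - b)\<^sup>2)"
        unfolding P_def using prod.remove[OF A(1) a] by simp
      moreover have "z \<noteq> a" using a \<open>z \<notin> A\<close> by auto
      ultimately show ?thesis by simp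
    qed
    then show ?thesis unfolding B_def sum_distrib_left by (intro sum.cong refl)
  qed
  have P_nz: "P z \<noteq> 0" if "z \<notin> A" for z using that A(1) by (auto simp: P_def)
  have KK1: "K \<subseteq> K1" using K(3,4) by force
  have h_nz: "h z \<noteq> 0" if z: "z \<in> K" for z
  proof (cases "z \<in> A")
    case True
    have "P z = 0" using True A(1) by (auto simp: P_def)
    moreover have "B z = c z * (\<Prod>b\<in>A - {z}. (z - b)\<^sup>2)"
    proof -
      have "(\<Sum>a\<in>A - {z}. c a * (\<Prod>b\<in>A - {a}. (z - b)\<^sup>2)) = 0"
        using True A(1) by (intro sum.neutral) auto
      then show ?thesis unfolding B_def sum.remove[OF A(1) True] by simp
    qed
    moreover have "(\<Prod>b\<in>A - {z}. (z - b)\<^sup>2) \<noteq> 0" using A(1) by auto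
    ultimately show ?thesis using c[OF True] by (simp add: h_def)
  next
    case False
    have "h z = P z * (deriv f0 z - (\<Sum>a\<in>A. c a / (z - a)\<^sup>2))"
      by (simp add: h_def BP[OF False] right_diff_distrib)
    then show ?thesis using P_nz[OF False] nz[of z] z False by simp
  qed
  have h_cont: "continuous_on K h"
  proof -
    have "deriv f0 holomorphic_on U" using U by (intro holomorphic_deriv)
    then have "continuous_on K (deriv f0)"
      using K1(2) KK1 by (meson holomorphic_on_imp_continuous_on holomorphic_on_subset order_trans)
    then show ?thesis unfolding h_def P_def B_def by (intro continuous_intros)
  qed
  obtain w where w: "w \<in> K" "\<forall>z\<in>K. cmod (h w) \<le> cmod (h z)"
    using continuous_attains_inf[OF K(1,2) continuous_on_norm[OF h_cont]] by blast
  define \<mu> where "\<mu> = cmod (h w)"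
  have \<mu>: "\<mu> > 0" "\<And>z. z \<in> K \<Longrightarrow> \<mu> \<le> cmod (h z)" using h_nz w by (auto simp: \<mu>_def)
  have "bounded (P ` K)"
    unfolding P_def by (intro compact_imp_bounded compact_continuous_image continuous_intros K(1))
  then obtain C where C: "C > 0" "\<And>z. z \<in> K \<Longrightarrow> cmod (P z) \<le> C" unfolding bounded_pos by auto
  define eta where "eta = min eps (\<mu> * \<delta> / (2 * C))"
  have eta: "eta > 0" "eta \<le> eps" "C * (eta / \<delta>) < \<mu>"
  proof -
    show "eta > 0" "eta \<le> eps" using \<open>eps > 0\<close> \<mu> C K(3) by (auto simp: eta_def)
    have "eta \<le> \<mu> * \<delta> / (2 * C)" by (simp add: eta_def)
    then have "C * (eta / \<delta>) \<le> \<mu> / 2" using C(1) K(3) by (simp add: field_simps)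
    then show "C * (eta / \<delta>) < \<mu>" using \<mu>(1) by linarith
  qed
  obtain q where q: "q \<in> rat_alg (- K1)" "\<And>z. z \<in> K1 \<Longrightarrow> cmod (f0 z - q z) < eta"
    using runge_rational[OF U K1] eta(1) unfolding unif_approx_by_def by blast
  obtain S0 where S0: "finite S0" "S0 \<subseteq> - K1" "q \<in> rat_alg S0" using rat_alg_finite[OF q(1)] by blast
  obtain q' where q': "q' \<in> rat_alg S0" "\<And>z. z \<notin> S0 \<Longrightarrow> (q has_field_derivative q' z) (at z)"
    using rat_alg_deriv[OF S0(3)] by blast
  have close: "cmod (deriv f0 z - q' z) \<le> eta / \<delta>" if z: "z \<in> K" for z
  proof -
    have sub: "cball z \<delta> \<subseteq> K1" by (rule K(4)[OF z])
    have hol: "(\<lambda>x. f0 x - q x) holomorphic_on cball z \<delta>"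
      using sub K1(2) S0(2) rat_alg_holomorphic[OF S0(3)]
      by (intro holomorphic_intros holomorphic_on_subset[OF U(2)]) (auto intro: holomorphic_on_subset)
    have zz: "z \<in> U" "z \<notin> S0" using z KK1 K1(2) S0(2) by auto
    have "f0 field_differentiable at z" using U zz(1) holomorphic_on_imp_differentiable_at by blast
    then have "(f0 has_field_derivative deriv f0 z) (at z)" by (simp add: DERIV_deriv_iff_field_differentiable)
    then have "((\<lambda>x. f0 x - q x) has_field_derivative deriv f0 z - q' z) (at z)"
      by (intro derivative_intros q' zz(2))
    then have "deriv (\<lambda>x. f0 x - q x) z = deriv f0 z - q' z" by (rule DERIV_imp_deriv)
    moreover have "cmod ((deriv ^^ 1) (\<lambda>x. f0 x - q x) z) \<le> fact 1 * eta / \<delta> ^ 1"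
    proof (rule Cauchy_inequality)
      show "(\<lambda>x. f0 x - q x) holomorphic_on ball z \<delta>"
        using hol ball_subset_cball by (rule holomorphic_on_subset)
      show "continuous_on (cball z \<delta>) (\<lambda>x. f0 x - q x)" using hol by (rule holomorphic_on_imp_continuous_on)
      fix x assume "cmod (z - x) = \<delta>"
      then have "x \<in> K1" using sub by (auto simp: dist_norm)
      then show "cmod (f0 x - q x) \<le> eta" using q(2) less_imp_le by blast
    qed (rule K(3))
    ultimately show ?thesis by simp
  qed
  define hr where "hr z = P z * q' z + (- 1) * B z" for z
  have hr: "hr \<in> rat_alg S0"
    unfolding hr_def[abs_def] P_def B_def
    by (intro rat_add rat_mult q' rat_alg_cmult rat_alg_sum rat_alg_prod rat_alg_power rat_alg_diff_const)
  have hr_nz: "hr z \<noteq> 0" if z: "z \<in> K" for z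
  proof
    assume "hr z = 0"
    then have "h z = P z * (deriv f0 z - q' z)" by (simp add: h_def hr_def algebra_simps)
    then have "cmod (h z) = cmod (P z) * cmod (deriv f0 z - q' z)" by (simp add: norm_mult)
    also have "\<dots> \<le> C * (eta / \<delta>)"
      using C(1) C(2)[OF z] close[OF z] by (intro mult_mono) auto
    finally have "cmod (h z) \<le> C * (eta / \<delta>)" .
    then show False using \<mu>(2)[OF z] eta(3) by linarith
  qed
  have wS0: "w \<notin> S0" using w(1) KK1 S0(2) by auto
  obtain Z F where ZF: "finite Z" "\<And>z. z \<in> Z \<Longrightarrow> hr z = 0" "F \<in> zero_free (S0 \<union> Z)" "\<And>z. z \<notin> S0 \<Longrightarrow> F z = hr z"
    using rat_alg_zero_free[OF S0(1) hr wS0 hr_nz[OF w(1)]] by blast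
  show ?thesis
  proof (rule that[of "S0 \<union> Z" "\<lambda>z. q z + (\<Sum>a\<in>A. c a / (z - a))"])
    show "finite (S0 \<union> Z)" using S0 ZF by simp
    show "(S0 \<union> Z) \<inter> K = {}" using S0(2) KK1 ZF(2) hr_nz by blast
    show "(\<lambda>z. q z + (\<Sum>a\<in>A. c a / (z - a))) \<in> lu_class (S0 \<union> Z) A"
      unfolding lu_class_def
    proof (intro CollectI bexI[OF _ ZF(3)] allI impI)
      fix z assume z: "z \<notin> S0 \<union> Z \<union> A"
      have "((\<lambda>z. c a / (z - a)) has_field_derivative - (c a / (z - a)\<^sup>2)) (at z)" if "a \<in> A" for a
        using z that by (auto intro!: derivative_eq_intros simp: power2_eq_square)
      then have "((\<lambda>z. q z + (\<Sum>a\<in>A. c a / (z - a))) has_field_derivative q' z + (\<Sum>a\<in>A. - (c a / (z - a)\<^sup>2))) (at z)"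
        using z by (intro derivative_intros q') auto
      moreover have "q' z + (\<Sum>a\<in>A. - (c a / (z - a)\<^sup>2)) = F z / P z"
      proof -
        have "F z = P z * (q' z - (\<Sum>a\<in>A. c a / (z - a)\<^sup>2))"
          using z ZF(4)[of z] BP[of z] by (simp add: hr_def right_diff_distrib)
        then show ?thesis using P_nz[of z] z by (simp add: sum_negf)
      qed
      ultimately show "((\<lambda>z. q z + (\<Sum>a\<in>A. c a / (z - a))) has_field_derivative F z / (\<Prod>a\<in>A. (z - a)\<^sup>2)) (at z)"
        by (simp add: P_def)
    qed
    fix z assume "z \<in> K1 - A"
    then have "cmod (f0 z - q z) < eps" using q(2)[of z] eta(2) by simp
    then show "cmod (f0 z + (\<Sum>a\<in>A. c a / (z - a)) - (q z + (\<Sum>a\<in>A. c a / (z - a)))) < eps" by simp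
  qed
qed

section \<open>Simple poles\<close>

text \<open>
  Poles are isolated, so the neighbourhood can be shrunk until it contains no poles off \<open>K\<close>; those in \<open>K\<close>
  are finite in number, and subtracting the principal parts leaves removable singularities.
\<close>
lemma mero_lu_split_poles:
  assumes f: "f \<in> mero_lu U" and U: "open U" and K: "compact K" "K \<subseteq> U"
  obtains V A c f0 where "open V" "K \<subseteq> V" "finite A" "A \<subseteq> K" "f0 holomorphic_on V"
    "\<And>a. a \<in> A \<Longrightarrow> c a \<noteq> 0" "\<And>a. a \<in> A \<Longrightarrow> is_pole f a"
    "\<And>z. z \<in> V - A \<Longrightarrow> \<not> is_pole f z" "\<And>z. z \<in> V - A \<Longrightarrow> f z = f0 z + (\<Sum>a\<in>A. c a / (z - a))"
    "\<And>z. z \<in> V - A \<Longrightarrow> deriv f0 z - (\<Sum>a\<in>A. c a / (z - a)\<^sup>2) \<noteq> 0"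
proof -
  have nice: "f nicely_meromorphic_on U" and ord: "\<And>z. z \<in> U \<Longrightarrow> is_pole f z \<Longrightarrow> zorder f z = -1"
    and dnz: "\<And>z. z \<in> U \<Longrightarrow> \<not> is_pole f z \<Longrightarrow> deriv f z \<noteq> 0"
    using f by (auto simp: mero_lu_def)
  have iso: "\<exists>r>0. ball z r \<subseteq> U \<and> f analytic_on ball z r - {z}" if z: "z \<in> U" for z
  proof -
    have "f meromorphic_on {z}"
      using nice z unfolding nicely_meromorphic_on_def by (auto intro: meromorphic_on_subset)
    then have "isolated_singularity_at f z" by (intro meromorphic_on_isolated_singularity)
    then obtain r where r: "r > 0" "f analytic_on ball z r - {z}" unfolding isolated_singularity_at_def by blast
    obtain e where e: "e > 0" "ball z e \<subseteq> U" using U z open_contains_ball by blast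
    have "ball z (min r e) - {z} \<subseteq> ball z r - {z}" by auto
    with r(2) have "f analytic_on ball z (min r e) - {z}" by (rule analytic_on_subset)
    then show ?thesis using r(1) e by (intro exI[of _ "min r e"]) auto
  qed
  have nopole: "\<not> is_pole f w" if "f analytic_on ball z r - {z}" "w \<in> ball z r" "w \<noteq> z" for z r w
    using that analytic_on_subset[OF that(1), of "{w}"] analytic_at_imp_no_pole by auto
  define A where "A = {z\<in>K. is_pole f z}"
  have AU: "A \<subseteq> U" using K(2) by (auto simp: A_def)
  have finA: "finite A"
  proof (rule ccontr)
    assume "infinite A"
    moreover have "A \<subseteq> K" by (auto simp: A_def)
    ultimately obtain x where x: "x \<in> K" "x islimpt A" using K(1) unfolding compact_eq_Bolzano_Weierstrass by blast
    obtain r where r: "r > 0" "f analytic_on ball x r - {x}" using iso[of x] x(1) K(2) by blast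
    obtain y where y: "y \<in> A" "y \<in> ball x r" "y \<noteq> x"
      using x(2) r(1) unfolding islimpt_approachable by (auto simp: dist_commute)
    then show False using nopole[OF r(2) y(2,3)] by (simp add: A_def)
  qed
  define V where "V = {z\<in>U. is_pole f z \<longrightarrow> z \<in> K}"
  have V: "open V"
    unfolding open_contains_ball
  proof
    fix z assume z: "z \<in> V"
    then obtain r where r: "r > 0" "ball z r \<subseteq> U" "f analytic_on ball z r - {z}" using iso[of z] by (auto simp: V_def)
    have "ball z r \<subseteq> V"
    proof
      fix w assume w: "w \<in> ball z r"
      show "w \<in> V"
        using z nopole[OF r(3) w] w r(2) by (cases "w = z") (auto simp: V_def)
    qed
    then show "\<exists>e>0. ball z e \<subseteq> V" using r(1) by blast
  qed
  have VA: "\<not> is_pole f z" "z \<in> U" if "z \<in> V - A" for z using that by (auto simp: V_def A_def)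
  have KV: "K \<subseteq> V" using K(2) by (auto simp: V_def)
  have opVA: "open (V - A)" using V finA by (intro open_Diff finite_imp_closed)
  have holVA: "f holomorphic_on V - A"
    using VA nicely_meromorphic_on_imp_analytic_at[OF nice] analytic_on_analytic_at analytic_imp_holomorphic by blast
  have loc: "\<exists>P r. r > 0 \<and> P holomorphic_on cball a r \<and> P a \<noteq> 0 \<and> (\<forall>w\<in>cball a r - {a}. f w = P w / (w - a))"
    if a: "a \<in> A" for a
  proof -
    have aU: "a \<in> U" "is_pole f a" using a AU by (auto simp: A_def)
    obtain r where r: "r > 0" "f analytic_on ball a r - {a}" using iso[OF aU(1)] by blast
    have "f holomorphic_on ball a r - {a}" using r(2) by (rule analytic_imp_holomorphic)
    from zorder_exist_pole[OF this open_ball _ aU(2)] r(1) ord[OF aU]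
    show ?thesis by auto
  qed
  then obtain P r where P: "\<And>a. a \<in> A \<Longrightarrow> r a > 0 \<and> P a holomorphic_on cball a (r a) \<and> P a a \<noteq> 0 \<and>
      (\<forall>w\<in>cball a (r a) - {a}. f w = P a w / (w - a))" by metis
  define c where "c a = P a a" for a
  define F1 where "F1 z = f z - (\<Sum>a\<in>A. c a / (z - a))" for z
  have "\<exists>f0. f0 holomorphic_on V \<and> (\<forall>z\<in>V - A. f0 z = F1 z)"
  proof (rule removable_singularities[OF finA])
    show "A \<subseteq> interior V" using V KV by (auto simp: interior_open A_def)
    show "F1 holomorphic_on V - A"
      unfolding F1_def using holVA by (intro holomorphic_intros) auto
    fix a assume a: "a \<in> A"
    define D where "D = deriv (P a) a"
    have "a \<in> ball a (r a)" "P a holomorphic_on ball a (r a)"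
      using P[OF a] holomorphic_on_subset[OF _ ball_subset_cball] by auto
    then have "P a field_differentiable at a" using holomorphic_on_imp_differentiable_at open_ball by blast
    then have "(P a has_field_derivative D) (at a)" unfolding D_def by (simp add: DERIV_deriv_iff_field_differentiable)
    then have "((\<lambda>w. (P a w - P a a) / (w - a)) \<longlongrightarrow> D) (at a)" by (simp add: has_field_derivative_iff)
    moreover have "((\<lambda>w. \<Sum>b\<in>A - {a}. c b / (w - b)) \<longlongrightarrow> (\<Sum>b\<in>A - {a}. c b / (a - b))) (at a)"
      by (intro tendsto_intros) auto
    ultimately have lim: "((\<lambda>w. (P a w - P a a) / (w - a) - (\<Sum>b\<in>A - {a}. c b / (w - b))) \<longlongrightarrow>
         D - (\<Sum>b\<in>A - {a}. c b / (a - b))) (at a)" by (rule tendsto_diff)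
    have "eventually (\<lambda>w. w \<in> ball a (r a) - {a}) (at a)"
      using P[OF a] by (intro eventually_at_in_open) auto
    then have "eventually (\<lambda>w. (P a w - P a a) / (w - a) - (\<Sum>b\<in>A - {a}. c b / (w - b)) = F1 w) (at a)"
    proof eventually_elim
      case (elim w)
      then have "f w = P a w / (w - a)" using P[OF a] by auto
      moreover have "(\<Sum>b\<in>A. c b / (w - b)) = c a / (w - a) + (\<Sum>b\<in>A - {a}. c b / (w - b))"
        by (rule sum.remove[OF finA a])
      ultimately show ?case by (simp add: F1_def c_def diff_divide_distrib)
    qed
    then have "(F1 \<longlongrightarrow> D - (\<Sum>b\<in>A - {a}. c b / (a - b))) (at a)" using lim by (simp add: tendsto_cong)
    then show "F1 \<in> O[at a](\<lambda>_. 1)" by (intro bigoI_tendsto[of _ _ "D - (\<Sum>b\<in>A - {a}. c b / (a - b))"]) auto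
  qed
  then obtain f0 where f0: "f0 holomorphic_on V" "\<And>z. z \<in> V - A \<Longrightarrow> f0 z = F1 z" by blast
  have eq: "f z = f0 z + (\<Sum>a\<in>A. c a / (z - a))" if "z \<in> V - A" for z
    using f0(2)[OF that] by (simp add: F1_def)
  show ?thesis
  proof (rule that[of V A f0 c])
    fix z assume z: "z \<in> V - A"
    have "f0 field_differentiable at z" using f0(1) V z holomorphic_on_imp_differentiable_at by blast
    then have d0: "(f0 has_field_derivative deriv f0 z) (at z)" by (simp add: DERIV_deriv_iff_field_differentiable)
    have "((\<lambda>z. c a / (z - a)) has_field_derivative - (c a / (z - a)\<^sup>2)) (at z)" if "a \<in> A" for a
      using z that by (auto intro!: derivative_eq_intros simp: power2_eq_square)
    then have "((\<lambda>z. f0 z + (\<Sum>a\<in>A. c a / (z - a))) has_field_derivative deriv f0 z + (\<Sum>a\<in>A. - (c a / (z - a)\<^sup>2))) (at z)"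
      by (intro derivative_intros d0)
    then have "(f has_field_derivative deriv f0 z + (\<Sum>a\<in>A. - (c a / (z - a)\<^sup>2))) (at z)"
      by (rule has_field_derivative_transform_within_open[OF _ opVA z]) (simp add: eq)
    then have "deriv f z = deriv f0 z - (\<Sum>a\<in>A. c a / (z - a)\<^sup>2)"
      by (simp add: DERIV_imp_deriv sum_negf)
    then show "deriv f0 z - (\<Sum>a\<in>A. c a / (z - a)\<^sup>2) \<noteq> 0" using dnz[OF VA(2,1)[OF z]] by simp
  next
    show "A \<subseteq> K" by (auto simp: A_def)
    show "c a \<noteq> 0" if "a \<in> A" for a using P[OF that] by (simp add: c_def)
    show "is_pole f a" if "a \<in> A" for a using that by (simp add: A_def)
  qed (fact V KV finA f0(1) VA(1) eq)+
qed

text \<open>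
  The derivative has a double pole at \<open>a\<close>. Its coefficient of \<open>1 / (z - a)\<close> vanishes since it has the primitive
  \<open>g\<close> on a punctured disc; integrating the Laurent expansion gives a simple pole.
\<close>
lemma lu_class_pole_form:
  assumes "finite A" "g \<in> lu_class {} A" "a \<in> A" "R > 0" "ball a R \<inter> A = {a}"
  obtains N where "N holomorphic_on ball a R" "N a \<noteq> 0" "\<And>z. z \<in> ball a R - {a} \<Longrightarrow> g z = N z / (z - a)"
proof -
  let ?B = "ball a R"
  obtain F where F: "F \<in> zero_free {}" "\<And>z. z \<notin> A \<Longrightarrow> (g has_field_derivative F z / (\<Prod>a\<in>A. (z - a)\<^sup>2)) (at z)"
    using assms(2) unfolding lu_class_def by force
  define H where "H z = F z / (\<Prod>b\<in>A - {a}. (z - b)\<^sup>2)" for z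
  have others: "(\<Prod>b\<in>A - {a}. (z - b)\<^sup>2) \<noteq> 0" if "z \<in> ?B" for z
  proof -
    have "z \<noteq> b" if "b \<in> A - {a}" for b using assms(5) that \<open>z \<in> ?B\<close> by blast
    then show ?thesis using assms(1) by simp
  qed
  have H_hol: "H holomorphic_on ?B"
  proof -
    have "F holomorphic_on ?B" using zero_free_holomorphic[OF F(1)] by (rule holomorphic_on_subset) simp
    then show ?thesis unfolding H_def using others by (intro holomorphic_intros) auto
  qed
  have Ha: "H a \<noteq> 0"
    unfolding H_def using others[of a] \<open>R > 0\<close> zero_free_nonzero[OF F(1), of a] by simp
  have gd: "(g has_field_derivative H z / (z - a)\<^sup>2) (at z)" if "z \<in> ?B - {a}" for z
  proof -
    have "z \<notin> A" using that assms(5) by blast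
    then have "(g has_field_derivative F z / (\<Prod>a\<in>A. (z - a)\<^sup>2)) (at z)" by (rule F(2))
    also have "F z / (\<Prod>a\<in>A. (z - a)\<^sup>2) = H z / (z - a)\<^sup>2"
      unfolding H_def prod.remove[OF assms(1,3)] divide_divide_eq_left by (simp only: mult.commute)
    finally show ?thesis .
  qed
  define \<phi> where "\<phi> z = (if z = a then deriv H a else (H z - H a) / (z - a))" for z
  have \<phi>_hol: "\<phi> holomorphic_on ?B" unfolding \<phi>_def by (rule pole_lemma_open[OF H_hol open_ball])
  define k where "k z = (if z = a then deriv \<phi> a else (\<phi> z - \<phi> a) / (z - a))" for z
  have k_hol: "k holomorphic_on ?B" unfolding k_def by (rule pole_lemma_open[OF \<phi>_hol open_ball])
  have expand: "H z / (z - a)\<^sup>2 = H a / (z - a)\<^sup>2 + \<phi> a / (z - a) + k z" if "z \<noteq> a" for z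
    using that by (simp add: k_def \<phi>_def[of z] power2_eq_square divide_simps)
  obtain \<kappa> where \<kappa>: "\<And>z. z \<in> ?B \<Longrightarrow> (\<kappa> has_field_derivative k z) (at z)"
  proof -
    obtain \<kappa> where "\<And>z. z \<in> ?B \<Longrightarrow> (\<kappa> has_field_derivative k z) (at z within ?B)"
      using holomorphic_convex_primitive'[of ?B k] k_hol by auto
    then show ?thesis using that by (metis at_within_open open_ball)
  qed
  define q where "q z = g z + H a / (z - a) - \<kappa> z" for z
  have qd: "(q has_field_derivative \<phi> a / (z - a)) (at z)" if z: "z \<in> ?B - {a}" for z
  proof -
    have "((\<lambda>z. H a / (z - a)) has_field_derivative - (H a / (z - a)\<^sup>2)) (at z)"
      using z by (auto intro!: derivative_eq_intros simp: power2_eq_square)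
    then have "(q has_field_derivative H z / (z - a)\<^sup>2 + - (H a / (z - a)\<^sup>2) - k z) (at z)"
      unfolding q_def using z by (intro derivative_intros gd \<kappa>) auto
    then show ?thesis using expand[of z] z by simp
  qed
  \<comment> \<open>\<open>\<phi> a\<close> is the residue of the derivative of \<open>g\<close> at \<open>a\<close>.\<close>
  have "\<phi> a = 0"
  proof -
    have "((\<lambda>z. \<phi> a / (z - a)) has_contour_integral 0) (circlepath a (R / 2))"
    proof (rule Cauchy_theorem_primitive[of "?B - {a}" q])
      show "path_image (circlepath a (R / 2)) \<subseteq> ?B - {a}"
        using \<open>R > 0\<close> by (auto simp: path_image_circlepath)
    qed (use qd in \<open>auto intro: has_field_derivative_at_within\<close>)
    moreover have "((\<lambda>z. \<phi> a * (1 / (z - a))) has_contour_integral \<phi> a * (2 * pi * \<i>)) (circlepath a (R / 2))"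
    proof (rule has_contour_integral_lmul)
      have "(\<lambda>z. 1 / (z - a)) contour_integrable_on circlepath a (R / 2)"
        using \<open>R > 0\<close> by (intro contour_integrable_continuous_circlepath continuous_intros) (auto simp: path_image_circlepath)
      then have "((\<lambda>z. 1 / (z - a)) has_contour_integral contour_integral (circlepath a (R / 2)) (\<lambda>z. 1 / (z - a))) (circlepath a (R / 2))"
        by (rule has_contour_integral_integral)
      then show "((\<lambda>z. 1 / (z - a)) has_contour_integral 2 * pi * \<i>) (circlepath a (R / 2))"
        using contour_integral_circlepath[of "R / 2" a] \<open>R > 0\<close> by simp
    qed
    then have "((\<lambda>z. \<phi> a / (z - a)) has_contour_integral \<phi> a * (2 * pi * \<i>)) (circlepath a (R / 2))" by simp
    ultimately have "\<phi> a * (2 * pi * \<i>) = 0" by (rule has_contour_integral_unique[OF _, rotated])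
    then show ?thesis by simp
  qed
  have "q constant_on ?B - {a}"
  proof (rule has_field_derivative_0_imp_constant_on)
    show "(q has_field_derivative 0) (at z)" if "z \<in> ?B - {a}" for z
      using qd[OF that] \<open>\<phi> a = 0\<close> by simp
    show "connected (?B - {a})" by (intro connected_open_delete) auto
    show "open (?B - {a})" by (intro open_delete) auto
  qed
  then have "\<exists>C. \<forall>z\<in>?B - {a}. q z = C" by (simp add: constant_on_def)
  then obtain C where C: "\<And>z. z \<in> ?B - {a} \<Longrightarrow> q z = C" by blast
  show ?thesis
  proof (rule that[of "\<lambda>z. (z - a) * (\<kappa> z + C) - H a"])
    have "\<kappa> holomorphic_on ?B"
      using \<kappa> holomorphic_on_open[OF open_ball] by blast
    then show "(\<lambda>z. (z - a) * (\<kappa> z + C) - H a) holomorphic_on ?B" by (intro holomorphic_intros)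
    fix z assume z: "z \<in> ?B - {a}"
    have "g z = \<kappa> z + C - H a / (z - a)" using C[OF z] by (simp add: q_def algebra_simps)
    then show "g z = ((z - a) * (\<kappa> z + C) - H a) / (z - a)" using z by (simp add: diff_divide_distrib)
  qed (use Ha in simp)
qed

section \<open>Holomorphic approximation\<close>

lemma lu_class_holo_lu:
  assumes "g \<in> lu_class S {}" "\<Omega> \<inter> S = {}" "open \<Omega>"
  shows "g \<in> holo_lu \<Omega>"
proof -
  obtain F where F: "F \<in> zero_free S" "\<And>z. z \<notin> S \<Longrightarrow> (g has_field_derivative F z) (at z)"
    using assms(1) unfolding lu_class_def by auto
  have "z \<notin> S" if "z \<in> \<Omega>" for z using that assms(2) by auto
  moreover have "deriv g z = F z" if "z \<notin> S" for z using F(2)[OF that] by (rule DERIV_imp_deriv)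
  ultimately show ?thesis
    unfolding holo_lu_def using F(2) zero_free_nonzero[OF F(1)] holomorphic_on_open[OF assms(3)]
    by auto
qed

lemma id_lu_class: "(\<lambda>z. z) \<in> lu_class {} {}"
  unfolding lu_class_def using zero_free_const[of 1 "{}"]
  by (auto intro!: bexI[of _ "\<lambda>z. 1"] derivative_eq_intros)

lemma compact_nbhd:
  assumes "compact K" "K \<noteq> {}" "open U" "K \<subseteq> U"
  obtains \<delta> :: real where "\<delta> > 0" "{z::complex. infdist z K \<le> \<delta>} \<subseteq> U"
proof -
  obtain e where e: "e > 0" "(\<Union>x\<in>K. ball x e) \<subseteq> U"
    using compact_subset_open_imp_ball_epsilon_subset[OF assms(1,3,4)] by blast
  have "z \<in> U" if "infdist z K \<le> e / 2" for z
  proof -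
    obtain x where "x \<in> K" "infdist z K = dist z x"
      using infdist_attains_inf[OF compact_imp_closed[OF assms(1)] assms(2)] by blast
    then have "z \<in> ball x e" "x \<in> K" using that e(1) by (auto simp: dist_commute)
    then show ?thesis using e(2) by blast
  qed
  then show ?thesis using that[of "e / 2"] e(1) by auto
qed

lemma cball_subset_infdist: "x \<in> K \<Longrightarrow> cball x \<delta> \<subseteq> {z. infdist z K \<le> \<delta>}"
  by (auto intro: infdist_le2 simp: dist_commute)

text \<open>
  A bounded component of the complement of \<open>K\<close> that lies in \<open>\<Omega>\<close> would be a component of \<open>\<Omega> - K\<close> with closure in
  \<open>\<Omega> \<union> K = \<Omega>\<close>. So every exceptional point can be pushed out of \<open>\<Omega>\<close> or to infinity.
\<close>
lemma holo_lu_approx: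
  assumes \<Omega>: "open \<Omega>" and K: "compact K" "K \<subseteq> \<Omega>"
    and comp: "\<forall>C \<in> components (\<Omega> - K). \<not> relatively_compact_in C \<Omega>"
    and f: "f \<in> holo_lu_near K"
  shows "unif_approx_by K f (holo_lu \<Omega>)"
proof (cases "K = {}")
  case True
  then show ?thesis
    using lu_class_holo_lu[OF id_lu_class, of \<Omega>] \<Omega> by (auto simp: unif_approx_by_def)
next
  case False
  obtain U where U: "open U" "K \<subseteq> U" "f holomorphic_on U" "\<And>z. z \<in> U \<Longrightarrow> deriv f z \<noteq> 0"
    using f unfolding holo_lu_near_def holo_lu_def by auto
  obtain \<delta> where \<delta>: "\<delta> > 0" "{z. infdist z K \<le> \<delta>} \<subseteq> U" using compact_nbhd[OF K(1) False U(1,2)] by blast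
  show ?thesis unfolding unif_approx_by_def
  proof (intro allI impI)
    fix eps :: real assume "eps > 0"
    then have e2: "eps / 2 > 0" by simp
    have nz: "deriv f z - (\<Sum>a\<in>{}. 0 / (z - a)\<^sup>2) \<noteq> 0" if "z \<in> K - {}" for z
      using U that by auto
    obtain S g where S: "finite S" "S \<inter> K = {}" "g \<in> lu_class S {}"
      and g: "\<And>z. z \<in> {z. infdist z K \<le> \<delta>} - {} \<Longrightarrow> cmod (f z + (\<Sum>a\<in>{}. 0 / (z - a)) - g z) < eps / 2"
    proof (rule lu_class_approx_on_neighbourhood[where A = "{}" and c = "\<lambda>_. 0", OF U(1,3)
          compact_infdist_le[OF False K(1) \<delta>(1)] \<delta>(2) K(1) False \<delta>(1)
          cball_subset_infdist finite.emptyI empty_subsetI _ nz e2])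
    qed (use that in auto)
    obtain R where R: "R > 0" "K \<subseteq> ball 0 R"
      using bounded_subset_ballD[OF compact_imp_bounded[OF K(1)]] by blast
    have reach: "\<exists>b. connected_component (- K) s b \<and> (b \<in> - \<Omega> \<or> R \<le> cmod b)" if s: "s \<in> S" for s
    proof (rule ccontr)
      assume no: "\<not> ?thesis"
      define C where "C = connected_component_set (- K) s"
      have sK: "s \<in> - K" using s S(2) by auto
      have sC: "s \<in> C" using sK by (simp add: C_def)
      have C: "C \<subseteq> \<Omega>" "C \<subseteq> ball 0 R" using no by (force simp: C_def)+
      have CK: "C \<subseteq> - K" unfolding C_def by (rule connected_component_subset)
      have "C = connected_component_set (\<Omega> - K) s"
      proof
        show "C \<subseteq> connected_component_set (\<Omega> - K) s"
          using sC C(1) CK by (intro connected_component_maximal) (auto simp: C_def)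
        show "connected_component_set (\<Omega> - K) s \<subseteq> C"
          unfolding C_def by (rule connected_component_mono) auto
      qed
      then have "C \<in> components (\<Omega> - K)" using sC C(1) sK by (auto simp: components_def)
      moreover have "closure C \<subseteq> \<Omega>"
      proof
        fix x assume x: "x \<in> closure C"
        show "x \<in> \<Omega>"
        proof (cases "x \<in> K")
          case False
          define D where "D = connected_component_set (- K) x"
          have "open D" unfolding D_def using K(1) by (intro open_connected_component) (auto intro: compact_imp_closed)
          moreover have "x \<in> D" using False by (simp add: D_def)
          ultimately have "D \<inter> C \<noteq> {}" using x by (meson closure_iff_nhds_not_empty disjoint_iff open_Int_closure_eq_empty)
          then have "D = C" unfolding C_def D_def using connected_component_nonoverlap by blast
          then show ?thesis using \<open>x \<in> D\<close> C(1) by auto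
        qed (use K in auto)
      qed
      moreover have "compact (closure C)"
        using C(2) bounded_subset[OF bounded_ball] by (auto simp: compact_closure)
      ultimately show False using comp by (auto simp: relatively_compact_in_def)
    qed
    obtain S' g' where S': "finite S'" "S' \<subseteq> - \<Omega>" "g' \<in> lu_class S' {}"
      and g': "\<And>z. z \<in> K \<Longrightarrow> cmod (g z - g' z) < eps / 2"
      by (rule lu_class_push[OF K(1) R(2,1) finite.emptyI empty_subsetI K(1) _ S(1,2) reach S(3) e2]) auto
    have "g' \<in> holo_lu \<Omega>" using S' \<Omega> by (intro lu_class_holo_lu) auto
    moreover have "cmod (f z - g' z) < eps" if "z \<in> K" for z
    proof -
      have "infdist z K \<le> \<delta>" using that \<delta>(1) by simp
      then have "cmod (f z - g z) < eps / 2" using g[of z] by simp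
      then show ?thesis using g'[OF that] norm_triangle_lt[of "f z - g z" "g z - g' z" eps] by simp
    qed
    ultimately show "\<exists>g\<in>holo_lu \<Omega>. \<forall>z\<in>K. cmod (f z - g z) < eps" by blast
  qed
qed

section \<open>Meromorphic approximation\<close>

lemma lu_class_mero_lu:
  assumes A: "finite A" and g: "g \<in> lu_class {} A"
  defines "h \<equiv> \<lambda>z. if z \<in> A then 0 else g z"
  shows "h \<in> mero_lu UNIV" "\<And>z. is_pole h z \<longleftrightarrow> z \<in> A"
proof -
  obtain F where F: "F \<in> zero_free {}" "\<And>z. z \<notin> {} \<union> A \<Longrightarrow> (g has_field_derivative F z / (\<Prod>a\<in>A. (z - a)\<^sup>2)) (at z)"
    using g unfolding lu_class_def by blast
  have opA: "open (- A)" using A by (simp add: finite_imp_closed open_Compl)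
  have hd: "(h has_field_derivative F z / (\<Prod>a\<in>A. (z - a)\<^sup>2)) (at z)" if z: "z \<in> - A" for z
  proof (rule has_field_derivative_transform_within_open[OF _ opA z])
    show "(g has_field_derivative F z / (\<Prod>a\<in>A. (z - a)\<^sup>2)) (at z)" using z by (intro F(2)) simp
    show "g x = h x" if "x \<in> - A" for x using that by (simp add: h_def)
  qed
  have hol: "h holomorphic_on - A" using hd holomorphic_on_open[OF opA] by blast
  have dnz: "deriv h z \<noteq> 0" if "z \<in> - A" for z
  proof -
    have "deriv h z = F z / (\<Prod>a\<in>A. (z - a)\<^sup>2)" using hd[OF that] by (rule DERIV_imp_deriv)
    moreover have "(\<Prod>a\<in>A. (z - a)\<^sup>2) \<noteq> 0" using A that by auto
    ultimately show ?thesis using zero_free_nonzero[OF F(1), of z] by simp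
  qed
  have ana: "h analytic_on {z}" if "z \<in> - A" for z
    using hol opA that analytic_at by blast
  have pole: "is_pole h a \<and> zorder h a = -1 \<and> h meromorphic_on {a}" if a: "a \<in> A" for a
  proof -
    obtain R where R: "R > 0" "\<forall>w\<in>cball a R. w \<in> UNIV \<and> (w \<noteq> a \<longrightarrow> w \<notin> A)"
      using finite_cball_avoid[OF open_UNIV A, of] by blast
    have "ball a R \<inter> A = {a}" using R a by auto
    then obtain N where N: "N holomorphic_on ball a R" "N a \<noteq> 0" "\<And>z. z \<in> ball a R - {a} \<Longrightarrow> g z = N z / (z - a)"
      using lu_class_pole_form[OF A g a R(1)] by blast
    have hN: "h z = N z / (z - a)" if "z \<in> ball a R - {a}" for z
      using N(3)[OF that] R(2) that by (auto simp: h_def)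
    have "eventually (\<lambda>z. z \<in> ball a R - {a}) (at a)" using R(1) by (intro eventually_at_in_open) auto
    then have ev: "eventually (\<lambda>z. h z = N z / (z - a)) (at a)" by eventually_elim (rule hN)
    have Nan: "N analytic_on {a}" using N(1) R(1) analytic_at by (meson centre_in_ball open_ball)
    have "is_pole (\<lambda>z. N z / (z - a)) a"
    proof (rule is_pole_divide)
      show "isCont N a" using Nan analytic_at_imp_isCont by blast
      show "filterlim (\<lambda>z. z - a) (at 0) (at a)"
        by (auto simp: filterlim_at eventually_at_filter intro!: tendsto_eq_intros)
    qed (rule N(2))
    then have "is_pole h a" using is_pole_cong[OF ev refl] by simp
    moreover have "zorder h a = -1"
      by (rule zorder_eqI[of "ball a R" a N]) (use R N hN in \<open>auto simp: power_int_minus field_simps\<close>)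
    moreover have "h meromorphic_on {a}"
    proof -
      have "(\<lambda>z. N z / (z - a)) meromorphic_on {a}"
        using Nan by (intro meromorphic_intros analytic_on_imp_meromorphic_on)
      moreover have "h meromorphic_on {a} \<longleftrightarrow> (\<lambda>z. N z / (z - a)) meromorphic_on {a}"
        using ev by (intro meromorphic_on_cong) auto
      ultimately show ?thesis by simp
    qed
    ultimately show ?thesis by blast
  qed
  show isp: "is_pole h z \<longleftrightarrow> z \<in> A" for z
    using pole ana analytic_at_imp_no_pole by blast
  have "h meromorphic_on UNIV"
    unfolding meromorphic_on_meromorphic_at[of h UNIV]
    using pole ana analytic_on_imp_meromorphic_on by blast
  moreover have "is_pole h z \<and> h z = 0 \<or> h \<midarrow>z\<rightarrow> h z" for z
    using pole[of z] ana[of z] analytic_at_imp_isCont[of h z] by (cases "z \<in> A") (auto simp: h_def isCont_def)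
  ultimately show "h \<in> mero_lu UNIV"
    unfolding mero_lu_def nicely_meromorphic_on_def using pole dnz isp by auto
qed

lemma chordal_le_dist: "chordal (Some z) (Some w) \<le> cmod (z - w)"
proof -
  have "1 * 1 \<le> sqrt (1 + (cmod z)\<^sup>2) * sqrt (1 + (cmod w)\<^sup>2)" by (intro mult_mono) auto
  then have "cmod (z - w) / (sqrt (1 + (cmod z)\<^sup>2) * sqrt (1 + (cmod w)\<^sup>2)) \<le> cmod (z - w) / 1"
    by (intro divide_left_mono) auto
  then show ?thesis by simp
qed

text \<open>
  The chordal metric is invariant under inversion, so near a common pole the distance of the reciprocals
  bounds it.
\<close>
lemma chordal_le_inverse_dist:
  assumes "u \<noteq> 0" "v \<noteq> 0" "w \<noteq> 0"
  shows "chordal (Some (u / w)) (Some (v / w)) \<le> cmod (u - v) * cmod w / (cmod u * cmod v)"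
proof -
  have le: "cmod z \<le> sqrt (1 + (cmod z)\<^sup>2)" for z by (rule real_le_rsqrt) simp
  have "cmod (u / w - v / w) / (sqrt (1 + (cmod (u / w))\<^sup>2) * sqrt (1 + (cmod (v / w))\<^sup>2))
     \<le> cmod (u / w - v / w) / (cmod (u / w) * cmod (v / w))"
    using assms by (intro divide_left_mono mult_mono le mult_pos_pos) (auto simp: add_pos_nonneg)
  also have "\<dots> = cmod (u - v) * cmod w / (cmod u * cmod v)"
    using assms by (simp add: norm_divide flip: diff_divide_distrib)
  finally show ?thesis by simp
qed

text \<open>
  Away from small discs around the poles the error is bounded by the Euclidean distance. The radius of the
  discs must be small in terms of paths that connect the exceptional points to infinity, because the circles
  have to be avoided when the points are pushed, whereas the exceptional points depend on the accuracy.
  The accuracy is therefore fixed first, with constants that hold for all small radii.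
\<close>
lemma mero_lu_approx:
  assumes K: "compact K" "connected (- K)" and f: "f \<in> mero_lu_near K"
  shows "chordal_unif_approx_by K f (mero_lu UNIV)"
proof (cases "K = {}")
  case True
  then show ?thesis
    using lu_class_mero_lu(1)[OF finite.emptyI id_lu_class] unfolding chordal_unif_approx_by_def by auto
next
  case False
  obtain U where U: "open U" "K \<subseteq> U" "f \<in> mero_lu U" using f unfolding mero_lu_near_def by blast
  obtain V A c f0 where V: "open V" "K \<subseteq> V" and A: "finite A" "A \<subseteq> K" and f0: "f0 holomorphic_on V"
    and c: "\<And>a. a \<in> A \<Longrightarrow> c a \<noteq> 0" and pole: "\<And>a. a \<in> A \<Longrightarrow> is_pole f a"
    and nopole: "\<And>z. z \<in> V - A \<Longrightarrow> \<not> is_pole f z"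
    and feq: "\<And>z. z \<in> V - A \<Longrightarrow> f z = f0 z + (\<Sum>a\<in>A. c a / (z - a))"
    and nz: "\<And>z. z \<in> V - A \<Longrightarrow> deriv f0 z - (\<Sum>a\<in>A. c a / (z - a)\<^sup>2) \<noteq> 0"
    by (rule mero_lu_split_poles[OF U(3,1) K(1) U(2)]) (rule that; assumption)
  obtain \<delta>0 where \<delta>0: "\<delta>0 > 0" "{z. infdist z K \<le> \<delta>0} \<subseteq> V" using compact_nbhd[OF K(1) False V] by blast
  define K1 where "K1 = {z. infdist z K \<le> \<delta>0}"
  have K1: "compact K1" "K1 \<subseteq> V" using compact_infdist_le[OF False K(1) \<delta>0(1)] \<delta>0(2) by (auto simp: K1_def)
  \<comment> \<open>\<open>M a z\<close> is the holomorphic extension of \<open>(z - a) * f z\<close> to \<open>a\<close>.\<close>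
  define M where "M a z = c a + (z - a) * (f0 z + (\<Sum>b\<in>A - {a}. c b / (z - b)))" for a z
  have fM: "f z = M a z / (z - a)" if "a \<in> A" "z \<in> V - A" for a z
  proof -
    have "z \<noteq> a" using that by auto
    moreover have "(\<Sum>b\<in>A. c b / (z - b)) = c a / (z - a) + (\<Sum>b\<in>A - {a}. c b / (z - b))"
      by (rule sum.remove[OF A(1) that(1)])
    ultimately show ?thesis using feq[OF that(2)] by (simp add: M_def add_divide_distrib)
  qed
  have M_hol: "M a holomorphic_on X" if "X \<subseteq> V" "X \<inter> A \<subseteq> {a}" for a X
    unfolding M_def using that by (intro holomorphic_intros holomorphic_on_subset[OF f0]) auto
  have "\<exists>r>0. cball a r \<subseteq> V \<and> cball a r \<inter> A = {a} \<and> (\<forall>z\<in>cball a r. cmod (c a) / 2 \<le> cmod (M a z))"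
    if a: "a \<in> A" for a
  proof -
    have aV: "a \<in> V" using a A(2) V(2) by auto
    obtain r1 where r1: "r1 > 0" "\<forall>w\<in>cball a r1. w \<in> V \<and> (w \<noteq> a \<longrightarrow> w \<notin> A)"
      using finite_cball_avoid[OF V(1) A(1)] aV by blast
    have "continuous_on (cball a r1) (M a)"
      using r1(2) by (intro holomorphic_on_imp_continuous_on M_hol) auto
    then have "continuous (at a within cball a r1) (M a)" using r1(1) by (simp add: continuous_on_eq_continuous_within)
    moreover have "cmod (c a) / 2 > 0" using c[OF a] by simp
    ultimately obtain d where d: "d > 0" "\<And>z. z \<in> cball a r1 \<Longrightarrow> dist z a < d \<Longrightarrow> dist (M a z) (M a a) < cmod (c a) / 2"
      unfolding continuous_within_eps_delta by blast
    define r where "r = min r1 (d / 2)"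
    have "cmod (c a) / 2 \<le> cmod (M a z)" if z: "z \<in> cball a r" for z
    proof -
      have "dist (M a z) (M a a) < cmod (c a) / 2"
        using z d(1) by (intro d(2)) (auto simp: r_def dist_commute)
      then have "cmod (M a z - c a) < cmod (c a) / 2" by (simp add: dist_norm M_def)
      then show ?thesis using norm_triangle_ineq2[of "c a" "M a z"] by (simp add: norm_minus_commute)
    qed
    moreover have "cball a r \<subseteq> cball a r1" by (auto simp: r_def)
    moreover have "r > 0" using r1(1) d(1) by (simp add: r_def)
    ultimately show ?thesis using r1(2) a by (intro exI[of _ r]) auto
  qed
  then obtain ra where ra: "\<And>a. a \<in> A \<Longrightarrow> ra a > 0 \<and> cball a (ra a) \<subseteq> V \<and> cball a (ra a) \<inter> A = {a} \<and>
      (\<forall>z\<in>cball a (ra a). cmod (c a) / 2 \<le> cmod (M a z))" by metis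
  define r0 where "r0 = Min (insert 1 (ra ` A))"
  have r0: "r0 > 0" "r0 \<le> 1" "\<And>a. a \<in> A \<Longrightarrow> r0 \<le> ra a" using A(1) ra by (auto simp: r0_def)
  define m where "m = Min (insert 1 ((\<lambda>a. cmod (c a) / 2) ` A))"
  have m: "m > 0" "\<And>a. a \<in> A \<Longrightarrow> m \<le> cmod (c a) / 2"
    unfolding m_def using A(1) c by (auto intro!: Min_le simp del: le_divide_eq_numeral1)
  have sub0: "cball a r0 \<subseteq> cball a (ra a)" if "a \<in> A" for a using r0(3)[OF that] by auto
  have M_low: "m \<le> cmod (M a z)" if "a \<in> A" "z \<in> cball a r0" for a z
    using sub0[OF that(1)] ra[OF that(1)] that m(2) by force
  have A0: "cball a r0 \<subseteq> V" "cball a r0 \<inter> A = {a}" if "a \<in> A" for a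
    using sub0[OF that] ra[OF that] r0(1) that by auto
  show ?thesis unfolding chordal_unif_approx_by_def
  proof (intro allI impI)
    fix eps :: real assume "eps > 0"
    define eps' where "eps' = min (eps / 4) (min (m / 4) (eps * m * m / 8))"
    have eps': "eps' > 0" "2 * eps' < eps" "2 * eps' \<le> m / 2" "2 * eps' \<le> eps * m * m / 4"
    proof -
      have "eps / 4 > 0" "m / 4 > 0" "eps * m * m / 8 > 0" using \<open>eps > 0\<close> m(1) by simp_all
      then show "eps' > 0" unfolding eps'_def by (simp only: min_less_iff_conj)
      have "eps' \<le> eps / 4" "eps' \<le> m / 4" "eps' \<le> eps * m * m / 8" unfolding eps'_def by linarith+
      then show "2 * eps' < eps" "2 * eps' \<le> m / 2" "2 * eps' \<le> eps * m * m / 4"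
        using \<open>eps > 0\<close> by linarith+
    qed
    obtain S g where S: "finite S" "S \<inter> K = {}" "g \<in> lu_class S A"
      and g: "\<And>z. z \<in> K1 - A \<Longrightarrow> cmod (f0 z + (\<Sum>a\<in>A. c a / (z - a)) - g z) < eps'"
    proof (rule lu_class_approx_on_neighbourhood[OF V(1) f0 K1 K(1) False \<delta>0(1) _ A c _ eps'(1)])
      show "cball z \<delta>0 \<subseteq> K1" if "z \<in> K" for z unfolding K1_def by (rule cball_subset_infdist[OF that])
      show "deriv f0 z - (\<Sum>a\<in>A. c a / (z - a)\<^sup>2) \<noteq> 0" if "z \<in> K - A" for z
        using V(2) that by (intro nz) auto
    qed (use that in auto)
    obtain R where R: "R > 0" "K1 \<subseteq> ball 0 R"
      using bounded_subset_ballD[OF compact_imp_bounded[OF K1(1)]] by blast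
    have KK1: "K \<subseteq> K1" using \<delta>0(1) by (auto simp: K1_def)
    have opK: "open (- K)" using K(1) by (simp add: compact_imp_closed open_Compl)
    have bR: "of_real R \<in> - K" using R KK1 by auto
    have "\<exists>p. path p \<and> path_image p \<subseteq> - K \<and> pathstart p = s \<and> pathfinish p = of_real R" if "s \<in> S" for s
    proof -
      have "path_connected (- K)" using opK K(2) by (rule connected_open_path_connected)
      moreover have "s \<in> - K" using that S(2) by auto
      ultimately show ?thesis using bR unfolding path_connected_def by blast
    qed
    then obtain p where p: "\<And>s. s \<in> S \<Longrightarrow> path (p s) \<and> path_image (p s) \<subseteq> - K \<and> pathstart (p s) = s \<and> pathfinish (p s) = of_real R"
      by metis
    define P where "P = (\<Union>s\<in>S. path_image (p s))"
    have "compact P" unfolding P_def using S(1) p by (intro compact_UN) (auto intro: compact_path_image)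
    moreover have "P \<subseteq> - K" unfolding P_def using p by (intro UN_least) blast
    ultimately obtain e where e: "e > 0" "(\<Union>x\<in>P. ball x e) \<subseteq> - K"
      using compact_subset_open_imp_ball_epsilon_subset[of P "- K"] opK by blast
    \<comment> \<open>The bound \<open>r0 / 2\<close> keeps the circle around one pole outside the discs around the others.\<close>
    define \<delta> where "\<delta> = min \<delta>0 (min (r0 / 2) (e / 2))"
    have \<delta>: "\<delta> > 0" "\<delta> \<le> \<delta>0" "\<delta> \<le> r0 / 2" "\<delta> < e" using \<delta>0(1) r0(1) e(1) by (auto simp: \<delta>_def)
    define K2 where "K2 = {z. infdist z K \<le> \<delta>}"
    have K2: "compact K2" "K2 \<subseteq> K1" "K \<subseteq> K2"
      using compact_infdist_le[OF False K(1) \<delta>(1)] \<delta>(1,2) by (auto simp: K2_def K1_def)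
    have PK2: "P \<inter> K2 = {}"
    proof -
      have False if x: "x \<in> P" "x \<in> K2" for x
      proof -
        obtain y where y: "y \<in> K" "infdist x K = dist x y"
          using infdist_attains_inf[OF compact_imp_closed[OF K(1)] False] by blast
        then have "y \<in> ball x e" using x(2) \<delta>(4) by (simp add: K2_def)
        then show False using e(2) x(1) y(1) by blast
      qed
      then show ?thesis by blast
    qed
    have pS: "connected_component (- K2) s (of_real R)" "s \<in> P" if s: "s \<in> S" for s
    proof -
      have "path_image (p s) \<subseteq> P" using s by (auto simp: P_def)
      then have "path_image (p s) \<subseteq> - K2" using PK2 by auto
      moreover have "s \<in> path_image (p s)" "of_real R \<in> path_image (p s)"
        using p[OF s] pathstart_in_path_image pathfinish_in_path_image by metis+
      moreover have "connected (path_image (p s))" using p[OF s] by (intro connected_path_image) auto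
      ultimately show "connected_component (- K2) s (of_real R)" unfolding connected_component_def by blast
      show "s \<in> P" using \<open>s \<in> path_image (p s)\<close> \<open>path_image (p s) \<subseteq> P\<close> by blast
    qed
    have SK2: "S \<inter> K2 = {}" using pS(2) PK2 by blast
    have ballK2: "cball a \<delta> \<subseteq> K2" if "a \<in> A" for a
      unfolding K2_def using A(2) that by (intro cball_subset_infdist) auto
    define L0 where "L0 = K2 - (\<Union>a\<in>A. ball a \<delta>)"
    have L0: "compact L0" "L0 \<subseteq> K2 - A"
    proof -
      show "compact L0" unfolding L0_def using K2(1) by (intro compact_diff) auto
      have "A \<subseteq> (\<Union>a\<in>A. ball a \<delta>)" using \<delta>(1) by auto
      then show "L0 \<subseteq> K2 - A" unfolding L0_def by blast
    qed
    have K2R: "K2 \<subseteq> ball 0 R" "A \<subseteq> K2" using K2 R A(2) by auto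
    obtain S' g' where S': "S' \<subseteq> {}" "g' \<in> lu_class S' A" and g': "\<And>z. z \<in> L0 \<Longrightarrow> cmod (g z - g' z) < eps'"
    proof (rule lu_class_push[OF K2(1) K2R(1) R(1) A(1) K2R(2) L0 S(1) SK2 _ S(3) eps'(1), of "{}"])
      show "\<exists>b. connected_component (- K2) s b \<and> (b \<in> {} \<or> R \<le> cmod b)" if "s \<in> S" for s
        using pS(1)[OF that] R(1) by (intro exI[of _ "of_real R"]) auto
    qed (use that in auto)
    have g'A: "g' \<in> lu_class {} A" using S' by simp
    have fg: "cmod (f z - g' z) < 2 * eps'" if z: "z \<in> L0" for z
    proof -
      have "z \<in> K1 - A" using z L0(2) K2(2) by auto
      moreover from this have "f z = f0 z + (\<Sum>a\<in>A. c a / (z - a))" using K1(2) by (intro feq) auto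
      ultimately have "cmod (f z - g z) < eps'" using g by simp
      then show ?thesis using g'[OF z] norm_triangle_lt[of "f z - g z" "g z - g' z" "2 * eps'"] by simp
    qed
    define h where "h z = (if z \<in> A then 0 else g' z)" for z
    have h: "h \<in> mero_lu UNIV" "\<And>z. is_pole h z \<longleftrightarrow> z \<in> A"
      unfolding h_def[abs_def] by (rule lu_class_mero_lu[OF A(1) g'A])+
    have "chordal (sphere_val f z) (sphere_val h z) < eps" if z: "z \<in> K" for z
    proof (cases "z \<in> A")
      case True
      then show ?thesis using pole h(2) \<open>eps > 0\<close> by (simp add: sphere_val_def)
    next
      case False
      have zV: "z \<in> V - A" using z V(2) False by auto
      have sv: "sphere_val f z = Some (f z)" "sphere_val h z = Some (g' z)"
        using nopole[OF zV] h(2) False by (auto simp: sphere_val_def h_def)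
      show ?thesis
      proof (cases "z \<in> L0")
        case True
        have "chordal (Some (f z)) (Some (g' z)) \<le> cmod (f z - g' z)" by (rule chordal_le_dist)
        then show ?thesis unfolding sv using fg[OF True] eps'(2) by linarith
      next
        case outside: False
        then obtain a where a: "a \<in> A" "z \<in> ball a \<delta>" using z K2(3) by (auto simp: L0_def)
        have "a \<in> ball a r0" using r0(1) by simp
        then have r0A: "ball a r0 \<inter> A = {a}"
          using A0(2)[OF a(1)] a(1) ball_subset_cball[of a r0] by blast
        obtain N where N: "N holomorphic_on ball a r0" "\<And>z. z \<in> ball a r0 - {a} \<Longrightarrow> g' z = N z / (z - a)"
          using lu_class_pole_form[OF A(1) g'A a(1) r0(1) r0A] by blast
        have cb: "cball a \<delta> \<subseteq> ball a r0" using \<delta>(3) r0(1) by auto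
        have sph: "cmod (M a w - N w) \<le> 2 * eps'" if w: "w \<in> sphere a \<delta>" for w
        proof -
          have "w \<in> K2" using ballK2[OF a(1)] w by auto
          moreover have "w \<notin> ball b \<delta>" if b: "b \<in> A" for b
          proof
            assume "w \<in> ball b \<delta>"
            then have "dist a b < r0" using w \<delta>(3) dist_triangle[of a b w] by (simp add: dist_commute)
            then have "b \<in> cball a r0 \<inter> A" using b by simp
            then have "b = a" unfolding A0(2)[OF a(1)] by simp
            then show False using \<open>w \<in> ball b \<delta>\<close> w by simp
          qed
          ultimately have wL: "w \<in> L0" by (auto simp: L0_def)
          then have wV: "w \<in> V - A" using L0(2) K2(2) K1(2) by auto
          have wa: "w \<noteq> a" "w \<in> ball a r0" using w \<delta>(1) cb by auto
          have "M a w - N w = (w - a) * (f w - g' w)"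
            using fM[OF a(1) wV] N(2)[of w] wa by (simp add: right_diff_distrib)
          then have "cmod (M a w - N w) = \<delta> * cmod (f w - g' w)"
            using w by (simp add: norm_mult dist_norm norm_minus_commute)
          also have "\<dots> \<le> 1 * (2 * eps')"
            using fg[OF wL] \<delta> r0(2) by (intro mult_mono) auto
          finally show ?thesis by simp
        qed
        have MN: "cmod (M a z - N z) \<le> 2 * eps'"
        proof (rule maximum_modulus_frontier[of "\<lambda>z. M a z - N z" "cball a \<delta>"])
          show "cmod (M a w - N w) \<le> 2 * eps'" if "w \<in> frontier (cball a \<delta>)" for w
            using that by (intro sph) simp
          have hol: "(\<lambda>z. M a z - N z) holomorphic_on ball a r0"
          proof (intro holomorphic_intros N(1) M_hol)
            show "ball a r0 \<subseteq> V" using A0(1)[OF a(1)] ball_subset_cball by blast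
            show "ball a r0 \<inter> A \<subseteq> {a}" by (simp only: r0A)
          qed
          then show "continuous_on (closure (cball a \<delta>)) (\<lambda>z. M a z - N z)"
            using cb by (intro holomorphic_on_imp_continuous_on) (auto intro: holomorphic_on_subset)
          show "(\<lambda>z. M a z - N z) holomorphic_on interior (cball a \<delta>)"
            using hol by (rule holomorphic_on_subset) (use cb in auto)
        qed (use a(2) in auto)
        have z0: "z \<in> cball a r0" "z \<noteq> a" "z \<in> ball a r0"
          using a(2) False a(1) \<delta>(3) r0(1) by auto
        have Ml: "m \<le> cmod (M a z)" by (rule M_low[OF a(1) z0(1)])
        have Nl: "m / 2 \<le> cmod (N z)"
          using norm_triangle_ineq2[of "M a z" "N z"] MN Ml eps'(3) by linarith
        have nz2: "M a z \<noteq> 0" "N z \<noteq> 0" using Ml Nl m(1) by auto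
        have "chordal (Some (M a z / (z - a))) (Some (N z / (z - a)))
            \<le> cmod (M a z - N z) * cmod (z - a) / (cmod (M a z) * cmod (N z))"
          using nz2 z0(2) by (intro chordal_le_inverse_dist) auto
        also have "\<dots> \<le> (2 * eps' * 1) / (m * (m / 2))"
        proof (rule frac_le)
          show "cmod (M a z - N z) * cmod (z - a) \<le> 2 * eps' * 1"
            using MN z0(1) r0(2) eps'(1) by (intro mult_mono) (auto simp: dist_norm norm_minus_commute)
          show "m * (m / 2) \<le> cmod (M a z) * cmod (N z)"
            using Ml Nl m(1) by (intro mult_mono) auto
        qed (use m(1) eps'(1) in auto)
        also have "\<dots> \<le> (eps * m * m / 4) / (m * (m / 2))"
          using eps'(4) m(1) by (intro divide_right_mono) auto
        also have "\<dots> < eps" using m(1) \<open>eps > 0\<close> by (simp add: field_simps)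
        finally have "chordal (Some (M a z / (z - a))) (Some (N z / (z - a))) < eps" .
        moreover have "f z = M a z / (z - a)" "g' z = N z / (z - a)"
          using fM[OF a(1) zV] N(2) z0 by auto
        ultimately show ?thesis unfolding sv by simp
      qed
    qed
    then show "\<exists>g\<in>mero_lu UNIV. \<forall>z\<in>K. chordal (sphere_val f z) (sphere_val g z) < eps"
      using h(1) by blast
  qed
qed

theorem theorem2p1:
  fixes \<Omega> K :: "complex set"
  assumes "open \<Omega>" and "connected \<Omega>" and "\<Omega> \<noteq> {}"
    and "compact K" and "K \<subseteq> \<Omega>"
    and "\<forall>C \<in> components (\<Omega> - K). \<not> relatively_compact_in C \<Omega>"
  shows "(\<forall>f \<in> holo_lu_near K. unif_approx_by K f (holo_lu \<Omega>)) \<and>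
         (connected (- K) \<longrightarrow>
           (\<forall>f \<in> mero_lu_near K. chordal_unif_approx_by K f (mero_lu UNIV)))"
  using holo_lu_approx[OF assms(1,4,5,6)] mero_lu_approx[OF assms(4)] by blast

end
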